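(* Let $\mathbf{A}=\mathbf{Com}\circ\mathbf{NCP}$. For any $X$-indexed noncrossing partition $\pi$ and any $\sim\in\mathcal{E}[X]$, put $$\delta_\sim(\pi)=\begin{cases}\pi/\!\sim\;\otimes\;\pi\mid_\cdot\sim&\text{if }\sim\in\mathcal{E}_c[\pi],\\0&\text{otherwise,}\end{cases}$$ and extend by multiplicativity: if $X=X_1\sqcup\ldots\sqcup X_k$ and $\pi_i$ is an $X_i$-indexed noncrossing partition for every $i$, then for any $\sim\in\mathcal{E}[X]$, $$\delta_\sim(\pi_1\cdot\ldots\cdot\pi_k)=\begin{cases}\delta_{\sim\cap X_1^2}(\pi_1)\cdot\ldots\cdot\delta_{\sim\cap X_k^2}(\pi_k)&\text{if }\sim=(\sim\cap X_1^2)\sqcup\ldots\sqcup(\sim\cap X_k^2),\\0&\text{otherwise.}\end{cases}$$ Then $\delta=(\delta_\sim)$ is a contraction-extraction coproduct on $\mathbf{A}$, compatible with $m$ and $\Delta$.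
   Context: $\mathbb{K}$ is a field of characteristic zero, $[n]=\{1,\ldots,n\}$. $\mathcal{E}[X]$ is the set of equivalence relations on the finite set $X$. Noncrossing partitions. A noncrossing partition is a partition $\pi$ of a set $[n]$, $n\ge1$, into nonempty blocks such that there are no distinct blocks $b\ne b'$ and $x,z\in b$, $y,t\in b'$ with $x<y<z<t$. An $X$-indexed noncrossing partition $\pi=(\pi_x)_{x\in X}$ is a noncrossing partition whose blocks are bijectively indexed by the finite set $X$ (none for $X=\emptyset$). For $Y\subseteq X$ nonempty, $\pi_{\mid Y}$ is the $Y$-indexed noncrossing partition obtained by deleting the blocks not indexed by $Y$ and renumbering the remaining elements increasingly; $\pi_{\mid\emptyset}=1$. The species $\mathbf{A}$. $\mathbf{A}[X]$ has basis the commutative monomials $\pi_1\cdot\ldots\cdot\pi_k$, where $\{X_1,\ldots,X_k\}$ is a partition of $X$ into nonempty sets and $\pi_i$ is an $X_i$-indexed noncrossing partition; $\mathbf{A}[\emptyset]=\mathbb{K}1$. The product $m=\cdot$ is concatenation of monomials. The coproduct $\Delta_{I,J}:\mathbf{A}[I\sqcup J]\to\mathbf{A}[I]\otimes\mathbf{A}[J]$ is multiplicative and is given on an indexed noncrossing partition $\pi$ by $\Delta_{I,J}(\pi)=\pi_{\mid I}\otimes\pi_{\mid_\cdot J}$ if $J$ is an ideal of $\pi$, and $0$ otherwise. Here $J$ is an ideal if each connected component (maximal subset of consecutive integers) $J'_i$ of $\bigcup_{x\in J}\pi_x$ is a union of blocks of $\pi$, and then $\pi_{\mid_\cdot J}=\prod_i\pi_{\mid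 J_i}$ with $J_i$ the set of indices of the blocks contained in $J'_i$. $(\mathbf{A},m,\Delta)$ is a twisted bialgebra. Contraction and extraction. Let $\pi=(\pi_x)_{x\in X}$ and $\sim\in\mathcal{E}[X]$. $\pi/\!\sim$ is the $X/\!\sim$-indexed partition with blocks $\pi_{C}=\bigsqcup_{y\in C}\pi_y$, $C\in X/\!\sim$. $\sim\in\mathcal{E}_c[\pi]$ means that $\pi/\!\sim$ is noncrossing. $\pi\mid_\cdot\sim\,=\prod_{C\in X/\sim}\pi_{\mid C}\in\mathbf{A}[X]$ (product $\cdot$). Contraction-extraction coproduct compatible with $m$ and $\Delta$. This means a family of linear maps $\delta_\sim:\mathbf{A}[X]\to\mathbf{A}[X/\!\sim]\otimes\mathbf{A}[X]$, for $X$ a finite set and $\sim\in\mathcal{E}[X]$, natural with respect to bijections, such that: (1) Coassociativity: if $\sim'\subseteq\sim$ (each class of $\sim$ is a union of classes of $\sim'$) and $\overline\sim$ is the equivalence induced by $\sim$ on $X/\!\sim'$, then, identifying $(X/\!\sim')/\overline\sim$ with $X/\!\sim$, $(\delta_{\overline\sim}\otimes\mathrm{Id})\circ\delta_{\sim'}=(\mathrm{Id}\otimes\delta_{\sim'})\circ\delta_\sim$; if $\sim'\not\subseteq\sim$, then $(\mathrm{Id}\otimes\delta_{\sim'})\circ\delta_\sim=0$. (2) Counit: there is a twisted algebra morphism $\epsilon_\delta:\mathbf{A}\to\mathbf{Com}$, where $\mathbf{Com}[X]=\mathbb{K}$ for all $X$ with product that of $\mathbb{K}$, such that $\sum_{\sim\in\mathcal{E}[X]}(\epsilon_\delta[X/\!\sim]\otimes\mathrm{Id})\circ\delta_\sim=\mathrm{Id}_{\mathbf{A}[X]}$,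 and $(\mathrm{Id}\otimes\epsilon_\delta[X])\circ\delta_\sim$ equals the identity if $\sim$ is the equality of $X$ and $0$ otherwise. (3) Compatibility with $m$: for $X,Y$ disjoint, $x\in\mathbf{A}[X]$, $y\in\mathbf{A}[Y]$ and $\sim\in\mathcal{E}[X\sqcup Y]$, $\delta_\sim(x\cdot y)=\delta_{\sim\cap X^2}(x)\cdot\delta_{\sim\cap Y^2}(y)$ (componentwise product) if $\sim=(\sim\cap X^2)\sqcup(\sim\cap Y^2)$, and $0$ otherwise; and $\delta(1)=1\otimes1$. (4) Compatibility with $\Delta$: for $X,Y$ disjoint, $\sim_X\in\mathcal{E}[X]$, $\sim_Y\in\mathcal{E}[Y]$, $\sim=\sim_X\sqcup\sim_Y$, one has $(\Delta_{X/\sim_X,Y/\sim_Y}\otimes\mathrm{Id})\circ\delta_\sim=m_{1,3,24}\circ(\delta_{\sim_X}\otimes\delta_{\sim_Y})\circ\Delta_{X,Y}$, where $m_{1,3,24}(a_1\otimes a_2\otimes a_3\otimes a_4)=a_1\otimes a_3\otimes a_2\cdot a_4$. *)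

theory Defs
  imports
    "HOL-Library.Poly_Mapping"
    "HOL-Library.Product_Plus"
    "HOL-Library.Multiset"
    "HOL-Library.Disjoint_Sets"
    "HOL-Library.FSet"
begin

section \<open>Finite sets and their quotients\<close>

text \<open>
  Species are functors on finite sets, and a contraction-extraction coproduct relates the values at
  \<^term>\<open>X\<close> and at a quotient of \<^term>\<open>X\<close>. To have all finite sets of labels, their quotients, the
  quotients of these, and so on, inside one type (so that one may quantify over a species
  morphism), labels are hereditarily finite sets over an arbitrary type of atoms.
  The equivalence class \<open>C\<close> of labels is itself the label \<open>cls C\<close>.
\<close>

datatype 'a label = Atom 'a | Class (members: "'a label fset")

definition cls :: "'a label set \<Rightarrow> 'a label" where
  "cls C = Class (Abs_fset C)"

definition elems :: "'a label \<Rightarrow> 'a label set" where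
  "elems c = fset (members c)"

lemma elems_cls [simp]: "finite C \<Longrightarrow> elems (cls C) = C"
  by (simp add: cls_def elems_def Abs_fset_inverse)

definition quot :: "'a label set \<Rightarrow> ('a label \<times> 'a label) set \<Rightarrow> 'a label set" where
  "quot X r = cls ` (X // r)"

text \<open>The equivalence induced by \<open>r\<close> on the quotient by a finer equivalence \<open>r'\<close>.\<close>
definition induced_rel ::
  "('a label \<times> 'a label) set \<Rightarrow> ('a label \<times> 'a label) set \<Rightarrow> ('a label \<times> 'a label) set" where
  "induced_rel r' r = {(cls (r' `` {x}), cls (r' `` {y})) | x y. (x, y) \<in> r}"

text \<open>
  The identifications of \<open>(X/r')/(induced_rel r' r)\<close> with \<open>X/r\<close>, and of the quotient of \<open>X\<close> by
  equality with \<open>X\<close>; and the map induced on quotients by a map of labels.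
\<close>
definition flatten :: "'a label \<Rightarrow> 'a label" where
  "flatten c = cls (\<Union>d\<in>elems c. elems d)"

definition unsingleton :: "'a label \<Rightarrow> 'a label" where
  "unsingleton c = the_elem (elems c)"

definition quot_map :: "('a label \<Rightarrow> 'a label) \<Rightarrow> 'a label \<Rightarrow> 'a label" where
  "quot_map f c = cls (f ` elems c)"

section \<open>Indexed noncrossing partitions\<close>

definition noncrossing_partition :: "nat \<Rightarrow> nat set set \<Rightarrow> bool" where
  "noncrossing_partition n P \<longleftrightarrow> n \<ge> 1 \<and> partition_on {1..n} P \<and>
     \<not> (\<exists>b\<in>P. \<exists>b'\<in>P. b \<noteq> b' \<and>
          (\<exists>x\<in>b. \<exists>z\<in>b. \<exists>y\<in>b'. \<exists>t\<in>b'. x < y \<and> y < z \<and> z < t))"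

text \<open>
  A family of blocks indexed by \<open>X\<close> is a function that is empty outside \<open>X\<close>. As blocks are
  nonempty, its index set is \<open>idx \<pi>\<close>.
\<close>
type_synonym 'x family = "'x \<Rightarrow> nat set"

definition idx :: "'x family \<Rightarrow> 'x set" where
  "idx \<pi> = {x. \<pi> x \<noteq> {}}"

definition indexed_ncp :: "'x set \<Rightarrow> 'x family \<Rightarrow> bool" where
  "indexed_ncp X \<pi> \<longleftrightarrow> finite X \<and> (\<forall>x. x \<notin> X \<longrightarrow> \<pi> x = {}) \<and> inj_on \<pi> X \<and>
     (\<exists>n. noncrossing_partition n (\<pi> ` X))"

definition relabel :: "('x \<Rightarrow> 'y) \<Rightarrow> 'x family \<Rightarrow> 'y family" where
  "relabel f \<pi> = (\<lambda>y. \<Union>x\<in>{x. f x = y}. \<pi> x)"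

text \<open>\<open>rank S\<close> renumbers the elements of \<open>S\<close> increasingly by \<open>1, 2, \<dots>\<close>\<close>
definition rank :: "nat set \<Rightarrow> nat \<Rightarrow> nat" where
  "rank S i = card {j\<in>S. j \<le> i}"

definition restr :: "'x family \<Rightarrow> 'x set \<Rightarrow> 'x family" where
  "restr \<pi> Y = (\<lambda>x. if x \<in> Y then rank (\<Union>y\<in>Y. \<pi> y) ` \<pi> x else {})"

section \<open>The species A\<close>

text \<open>
  Commutative monomials are multisets of indexed noncrossing partitions, the monomial \<open>1\<close> being
  \<open>{#}\<close> and the product of monomials being \<open>+\<close>. Linear combinations of monomials are finitely
  supported functions; the multiplication \<open>*\<close> of \<^type>\<open>poly_mapping\<close> is then the bilinear
  extension of the product of monomials. Tensor products of spaces with given bases are spaces with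
  basis the pairs of basis elements; on pairs of monomials \<open>+\<close> is componentwise, hence \<open>*\<close> is the
  componentwise product of tensors.
\<close>
type_synonym 'x monom = "'x family multiset"
type_synonym ('x, 'k) alg = "'x monom \<Rightarrow>\<^sub>0 'k"
type_synonym ('x, 'k) alg2 = "('x monom \<times> 'x monom) \<Rightarrow>\<^sub>0 'k"

definition monoms :: "'x set \<Rightarrow> 'x monom set" where
  "monoms X = {image_mset F (mset_set P) | F P.
     finite P \<and> partition_on X P \<and> (\<forall>Y\<in>P. indexed_ncp Y (F Y))}"

definition A :: "'x set \<Rightarrow> ('x, 'k::field_char_0) alg set" where
  "A X = {p. Poly_Mapping.keys p \<subseteq> monoms X}"

definition A2 :: "'x set \<Rightarrow> 'x set \<Rightarrow> ('x, 'k::field_char_0) alg2 set" where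
  "A2 X Y = {t. Poly_Mapping.keys t \<subseteq> monoms X \<times> monoms Y}"

subsection \<open>Linear algebra on finitely supported functions\<close>

definition scale :: "'k \<Rightarrow> ('b \<Rightarrow>\<^sub>0 'k) \<Rightarrow> ('b \<Rightarrow>\<^sub>0 'k::field_char_0)" where
  "scale c p = Poly_Mapping.map ((*) c) p"

definition linear_between ::
  "('k \<Rightarrow> 'v \<Rightarrow> 'v) \<Rightarrow> 'v set \<Rightarrow> ('k \<Rightarrow> 'w \<Rightarrow> 'w) \<Rightarrow> 'w set \<Rightarrow> ('v::plus \<Rightarrow> 'w::plus) \<Rightarrow> bool" where
  "linear_between s V s' W f \<longleftrightarrow> (\<forall>p\<in>V. f p \<in> W) \<and>
     (\<forall>p\<in>V. \<forall>q\<in>V. f (p + q) = f p + f q) \<and> (\<forall>c. \<forall>p\<in>V. f (s c p) = s' c (f p))"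

definition lin_ext :: "('b \<Rightarrow> ('c \<Rightarrow>\<^sub>0 'k)) \<Rightarrow> ('b \<Rightarrow>\<^sub>0 'k::field_char_0) \<Rightarrow> ('c \<Rightarrow>\<^sub>0 'k)" where
  "lin_ext g p = (\<Sum>b\<in>Poly_Mapping.keys p. scale (Poly_Mapping.lookup p b) (g b))"

abbreviation basis :: "'b \<Rightarrow> ('b \<Rightarrow>\<^sub>0 'k::field_char_0)" where
  "basis b \<equiv> Poly_Mapping.single b 1"

definition tensor :: "('b \<Rightarrow>\<^sub>0 'k) \<Rightarrow> ('c \<Rightarrow>\<^sub>0 'k) \<Rightarrow> ('b \<times> 'c \<Rightarrow>\<^sub>0 'k::field_char_0)" where
  "tensor p q = (\<Sum>b\<in>Poly_Mapping.keys p. \<Sum>c\<in>Poly_Mapping.keys q. Poly_Mapping.single (b, c) (Poly_Mapping.lookup p b * Poly_Mapping.lookup q c))"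

text \<open>The tensor product of two linear maps.\<close>
definition tensor_map ::
  "(('b \<Rightarrow>\<^sub>0 'k) \<Rightarrow> ('d \<Rightarrow>\<^sub>0 'k)) \<Rightarrow> (('c \<Rightarrow>\<^sub>0 'k) \<Rightarrow> ('e \<Rightarrow>\<^sub>0 'k)) \<Rightarrow>
   ('b \<times> 'c \<Rightarrow>\<^sub>0 'k) \<Rightarrow> ('d \<times> 'e \<Rightarrow>\<^sub>0 'k::field_char_0)" where
  "tensor_map f g = lin_ext (\<lambda>(b, c). tensor (f (basis b)) (g (basis c)))"

text \<open>
  For a linear form \<open>e\<close>: \<open>e \<otimes> Id\<close> and \<open>Id \<otimes> e\<close>, the tensor products with the ground field
  being identified with the other factor.
\<close>
definition form_left :: "(('b \<Rightarrow>\<^sub>0 'k) \<Rightarrow> 'k) \<Rightarrow> ('b \<times> 'c \<Rightarrow>\<^sub>0 'k) \<Rightarrow> ('c \<Rightarrow>\<^sub>0 'k::field_char_0)" where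
  "form_left e = lin_ext (\<lambda>(b, c). scale (e (basis b)) (basis c))"

definition form_right :: "(('c \<Rightarrow>\<^sub>0 'k) \<Rightarrow> 'k) \<Rightarrow> ('b \<times> 'c \<Rightarrow>\<^sub>0 'k) \<Rightarrow> ('b \<Rightarrow>\<^sub>0 'k::field_char_0)" where
  "form_right e = lin_ext (\<lambda>(b, c). scale (e (basis c)) (basis b))"

definition assoc :: "(('b \<times> 'c) \<times> 'd \<Rightarrow>\<^sub>0 'k) \<Rightarrow> ('b \<times> 'c \<times> 'd \<Rightarrow>\<^sub>0 'k::field_char_0)" where
  "assoc = lin_ext (\<lambda>((b, c), d). basis (b, c, d))"

text \<open>\<open>m\<^bsub>1,3,24\<^esub>\<close>\<close>
definition m1324 ::
  "(('b \<times> 'm::plus) \<times> ('c \<times> 'm) \<Rightarrow>\<^sub>0 'k) \<Rightarrow> (('b \<times> 'c) \<times> 'm \<Rightarrow>\<^sub>0 'k::field_char_0)" where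
  "m1324 = lin_ext (\<lambda>((a\<^sub>1, a\<^sub>2), (a\<^sub>3, a\<^sub>4)). basis ((a\<^sub>1, a\<^sub>3), a\<^sub>2 + a\<^sub>4))"

subsection \<open>The functor and the coproduct\<close>

definition A_map :: "('x \<Rightarrow> 'y) \<Rightarrow> ('x, 'k::field_char_0) alg \<Rightarrow> ('y, 'k) alg" where
  "A_map f = lin_ext (\<lambda>M. basis (image_mset (relabel f) M))"

definition restr_monom :: "'x family \<Rightarrow> 'x set \<Rightarrow> 'x monom" where
  "restr_monom \<pi> Y = (if Y = {} then {#} else {#restr \<pi> Y#})"

definition segments :: "nat set \<Rightarrow> nat set set" where
  "segments S = {{a..b} | a b. a \<le> b \<and> {a..b} \<subseteq> S}"

definition components :: "nat set \<Rightarrow> nat set set" where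
  "components S = {T \<in> segments S. \<forall>T' \<in> segments S. T \<subseteq> T' \<longrightarrow> T' = T}"

definition is_ideal :: "'x family \<Rightarrow> 'x set \<Rightarrow> bool" where
  "is_ideal \<pi> J \<longleftrightarrow> (\<forall>T \<in> components (\<Union>x\<in>J. \<pi> x). \<exists>K \<subseteq> idx \<pi>. T = (\<Union>x\<in>K. \<pi> x))"

text \<open>\<open>\<pi>\<^bsub>|.J\<^esub>\<close> for an ideal \<open>J\<close>\<close>
definition ideal_restr :: "'x family \<Rightarrow> 'x set \<Rightarrow> 'x monom" where
  "ideal_restr \<pi> J =
     (\<Sum>T\<in>components (\<Union>x\<in>J. \<pi> x). restr_monom \<pi> {x \<in> idx \<pi>. \<pi> x \<subseteq> T})"

definition Delta_ncp :: "'x set \<Rightarrow> 'x set \<Rightarrow> 'x family \<Rightarrow> ('x, 'k::field_char_0) alg2" where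
  "Delta_ncp I J \<pi> = (if is_ideal \<pi> J then basis (restr_monom \<pi> I, ideal_restr \<pi> J) else 0)"

definition Delta :: "'x set \<Rightarrow> 'x set \<Rightarrow> ('x, 'k::field_char_0) alg \<Rightarrow> ('x, 'k) alg2" where
  "Delta I J = lin_ext (\<lambda>M. \<Prod>\<pi>\<in>#M. Delta_ncp (I \<inter> idx \<pi>) (J \<inter> idx \<pi>) \<pi>)"

section \<open>Contraction and extraction\<close>

definition contract ::
  "'a label set \<Rightarrow> ('a label \<times> 'a label) set \<Rightarrow> 'a label family \<Rightarrow> 'a label family" where
  "contract X r \<pi> = (\<lambda>c. \<Union>{\<pi> y | C y. C \<in> X // r \<and> cls C = c \<and> y \<in> C})"

definition Ec :: "'a label set \<Rightarrow> 'a label family \<Rightarrow> ('a label \<times> 'a label) set set" where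
  "Ec X \<pi> = {r. equiv X r \<and> indexed_ncp (quot X r) (contract X r \<pi>)}"

definition extract_monom ::
  "'a label set \<Rightarrow> ('a label \<times> 'a label) set \<Rightarrow> 'a label family \<Rightarrow> 'a label monom" where
  "extract_monom X r \<pi> = (\<Sum>C\<in>X // r. restr_monom \<pi> C)"

definition delta_ncp ::
  "'a label set \<Rightarrow> ('a label \<times> 'a label) set \<Rightarrow> 'a label family \<Rightarrow>
   ('a label, 'k::field_char_0) alg2" where
  "delta_ncp X r \<pi> =
     (if r \<in> Ec X \<pi> then basis ({#contract X r \<pi>#}, extract_monom X r \<pi>) else 0)"

definition delta_monom ::
  "('a label \<times> 'a label) set \<Rightarrow> 'a label monom \<Rightarrow> ('a label, 'k::field_char_0) alg2" where
  "delta_monom r M =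
     (if r = (\<Union>\<pi>\<in>set_mset M. r \<inter> (idx \<pi> \<times> idx \<pi>))
      then \<Prod>\<pi>\<in>#M. delta_ncp (idx \<pi>) (r \<inter> (idx \<pi> \<times> idx \<pi>)) \<pi> else 0)"

definition delta ::
  "'a label set \<Rightarrow> ('a label \<times> 'a label) set \<Rightarrow>
   ('a label, 'k::field_char_0) alg \<Rightarrow> ('a label, 'k) alg2" where
  "delta X r = lin_ext (delta_monom r)"

section \<open>Contraction-extraction coproducts\<close>

text \<open>
  In the following, a family of linear maps is a function of \<open>X\<close> (and \<open>r\<close>) and only its values at
  finite sets \<open>X\<close>, equivalences \<open>r\<close> on \<open>X\<close> and arguments in \<open>A X\<close> matter.
\<close>

definition twisted_algebra_morphism_to_Com ::
  "('x set \<Rightarrow> ('x, 'k::field_char_0) alg \<Rightarrow> 'k) \<Rightarrow> bool" where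
  "twisted_algebra_morphism_to_Com e \<longleftrightarrow>
     (\<forall>X. finite X \<longrightarrow> linear_between scale (A X) (*) UNIV (e X)) \<and>
     (\<forall>X Y f. finite X \<and> bij_betw f X Y \<longrightarrow> (\<forall>p\<in>A X. e Y (A_map f p) = e X p)) \<and>
     e {} 1 = 1 \<and>
     (\<forall>X Y. finite X \<and> finite Y \<and> X \<inter> Y = {} \<longrightarrow>
        (\<forall>p\<in>A X. \<forall>q\<in>A Y. e (X \<union> Y) (p * q) = e X p * e Y q))"

type_synonym ('a, 'k) coproduct_family =
  "'a label set \<Rightarrow> ('a label \<times> 'a label) set \<Rightarrow> ('a label, 'k) alg \<Rightarrow> ('a label, 'k) alg2"

definition natural_linear_family :: "('a, 'k::field_char_0) coproduct_family \<Rightarrow> bool" where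
  "natural_linear_family d \<longleftrightarrow>
     (\<forall>X r. finite X \<and> equiv X r \<longrightarrow>
        linear_between scale (A X) scale (A2 (quot X r) X) (d X r)) \<and>
     (\<forall>X Y f r. finite X \<and> bij_betw f X Y \<and> equiv X r \<longrightarrow>
        (\<forall>p\<in>A X. d Y (map_prod f f ` r) (A_map f p) =
           tensor_map (A_map (quot_map f)) (A_map f) (d X r p)))"

definition coassociative :: "('a, 'k::field_char_0) coproduct_family \<Rightarrow> bool" where
  "coassociative d \<longleftrightarrow>
     (\<forall>X r r'. finite X \<and> equiv X r \<and> equiv X r' \<longrightarrow>
        (r' \<subseteq> r \<longrightarrow> (\<forall>p\<in>A X.
           tensor_map (A_map flatten) id
             (assoc (tensor_map (d (quot X r') (induced_rel r' r)) id (d X r' p))) =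
           tensor_map id (d X r') (d X r p))) \<and>
        (\<not> r' \<subseteq> r \<longrightarrow> (\<forall>p\<in>A X. tensor_map id (d X r') (d X r p) = 0)))"

definition counital :: "('a, 'k::field_char_0) coproduct_family \<Rightarrow> bool" where
  "counital d \<longleftrightarrow>
     (\<exists>e. twisted_algebra_morphism_to_Com e \<and>
        (\<forall>X. finite X \<longrightarrow> (\<forall>p\<in>A X.
           (\<Sum>r\<in>{r. equiv X r}. form_left (e (quot X r)) (d X r p)) = p)) \<and>
        (\<forall>X r. finite X \<and> equiv X r \<longrightarrow> (\<forall>p\<in>A X.
           (r = Id_on X \<longrightarrow> A_map unsingleton (form_right (e X) (d X r p)) = p) \<and>
           (r \<noteq> Id_on X \<longrightarrow> form_right (e X) (d X r p) = 0))))"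

definition compatible_with_product :: "('a, 'k::field_char_0) coproduct_family \<Rightarrow> bool" where
  "compatible_with_product d \<longleftrightarrow>
     (\<forall>X Y r. finite X \<and> finite Y \<and> X \<inter> Y = {} \<and> equiv (X \<union> Y) r \<longrightarrow>
        (\<forall>p\<in>A X. \<forall>q\<in>A Y. d (X \<union> Y) r (p * q) =
           (if r = (r \<inter> (X \<times> X)) \<union> (r \<inter> (Y \<times> Y))
            then d X (r \<inter> (X \<times> X)) p * d Y (r \<inter> (Y \<times> Y)) q else 0))) \<and>
     d {} {} 1 = tensor 1 1"

definition compatible_with_Delta :: "('a, 'k::field_char_0) coproduct_family \<Rightarrow> bool" where
  "compatible_with_Delta d \<longleftrightarrow>
     (\<forall>X Y r s. finite X \<and> finite Y \<and> X \<inter> Y = {} \<and> equiv X r \<and> equiv Y s \<longrightarrow>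
        (\<forall>p\<in>A (X \<union> Y).
           tensor_map (Delta (quot X r) (quot Y s)) id (d (X \<union> Y) (r \<union> s) p) =
           m1324 (tensor_map (d X r) (d Y s) (Delta X Y p))))"

definition contraction_extraction_coproduct ::
  "('a, 'k::field_char_0) coproduct_family \<Rightarrow> bool" where
  "contraction_extraction_coproduct d \<longleftrightarrow>
     natural_linear_family d \<and> coassociative d \<and> counital d \<and>
     compatible_with_product d \<and> compatible_with_Delta d"

end

theory Submission
  imports Defs
begin

text \<open>
  Every map in the axioms is the linear extension of a map that sends a monomial either to a single
  monomial (or a tensor of monomials) or to \<open>0\<close>. So each axiom says that two partially defined
  operations on monomials are defined for the same monomials and agree there. For \<open>\<delta>\<close> this shape is
  \<open>delta_monom_eq\<close>: the value at a monomial \<open>M\<close> is \<open>0\<close> unless \<open>r\<close> relates only labels of the same factor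
  of \<open>M\<close> (\<open>splits\<close>) and each factor contracts to a noncrossing partition (\<open>contractible\<close>).

  The key is to express that \<open>\<pi>/r\<close> is noncrossing without forming a quotient: there are no
  \<open>i < j < k < l\<close> such that \<open>i, k\<close> lie in blocks with related labels, \<open>j, l\<close> lie in blocks with related
  labels, and the two classes differ (\<open>noncrossing_wrt\<close>, \<open>indexed_ncp_contract_iff\<close>). Whether this holds does
  not change under renumbering, renaming of labels, and passing to the quotient by a finer
  equivalence (\<open>noncrossing_wrt_restr\<close>, \<open>noncrossing_wrt_relabel\<close>, \<open>noncrossing_wrt_contract\<close>), so
  iterated contractions and extractions can all be compared inside the original family \<open>\<pi>\<close>.

  Coassociativity. Let \<open>r' \<subseteq> r\<close>. On one side \<open>\<pi>/r'\<close> and \<open>(\<pi>/r')/r = \<pi>/r\<close> must be noncrossing, on the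
  other side \<open>\<pi>/r\<close> and all \<open>\<pi>|C / r'\<close> for the classes \<open>C\<close> of \<open>r\<close>. These conditions agree: if \<open>\<pi>/r\<close> is
  noncrossing, two crossing classes of \<open>r'\<close> lie in the same class \<open>C\<close> of \<open>r\<close>, and their crossing is
  seen in \<open>\<pi>|C\<close> (\<open>noncrossing_wrt_classes\<close>). Where both sides are nonzero, the three
  tensor factors agree by transitivity of restriction and contraction.

  Compatibility with \<open>\<Delta>\<close>. The labels \<open>Y/s\<close> form an ideal of \<open>\<pi>/(r \<union> s)\<close> exactly if all blocks of a
  class of \<open>s\<close> lie in a single connected component of the union of the blocks with labels in \<open>Y\<close>; that
  is, \<open>Y\<close> is an ideal of \<open>\<pi>\<close> and \<open>s\<close> relates only labels of the same component. In that case a class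
  of \<open>s\<close> is contained in an interval that avoids all blocks with labels in \<open>X\<close>, so it crosses neither a
  class of \<open>r\<close> nor a class of \<open>s\<close> in another component: \<open>\<pi>/(r \<union> s)\<close> is noncrossing as soon as the
  contractions of \<open>\<pi>|X\<close> and of the components are (\<open>noncrossing_ideal_iff\<close>).

  Counit. It is the indicator of the monomials whose factors all have one block. The quotient \<open>\<pi>/r\<close>
  has one block only if \<open>r\<close> relates all labels, and then \<open>\<pi>\<close> is what is extracted; all extracted
  partitions have one block only if \<open>r\<close> is the equality, and then contracting just renames the labels.
\<close>

section \<open>Linear extensions\<close>

lemma lookup_scale [simp]: "Poly_Mapping.lookup (scale c p) k = c * Poly_Mapping.lookup p k"
  unfolding scale_def by (simp add: Poly_Mapping.map.rep_eq when_def)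

lemma scale_add: "scale c (p + q) = scale c p + scale c q"
  and scale_add_left: "scale (c + d) p = scale c p + scale d p"
  and scale_scale: "scale c (scale d p) = scale (c * d) p"
  and scale_0_left [simp]: "scale 0 p = 0"
  and scale_0_right [simp]: "scale c 0 = 0"
  and scale_1 [simp]: "scale 1 p = p"
  by (auto intro!: poly_mapping_eqI simp: lookup_add algebra_simps)

lemma scale_sum: "scale c (\<Sum>b\<in>S. f b) = (\<Sum>b\<in>S. scale c (f b))"
  by (induction S rule: infinite_finite_induct) (auto simp: scale_add)

lemma scale_single [simp]: "scale c (Poly_Mapping.single b d) = Poly_Mapping.single b (c * d)"
  by (rule poly_mapping_eqI) (simp add: lookup_single when_def)

lemma scale_mult_scale:
  fixes p q :: "'b::comm_monoid_add \<Rightarrow>\<^sub>0 'k::field_char_0"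
  shows "scale c p * scale d q = scale (c * d) (p * q)"
proof -
  have "Poly_Mapping.single 0 c * p * (Poly_Mapping.single 0 d * q) =
      (Poly_Mapping.single 0 c * Poly_Mapping.single 0 d) * (p * q)"
    by (simp only: mult.assoc mult.left_commute)
  then show ?thesis
    unfolding scale_def mult_map_scale_conv_mult by (simp add: mult_single)
qed

lemma sum_single_lookup:
  "(\<Sum>b\<in>Poly_Mapping.keys p. Poly_Mapping.single b (Poly_Mapping.lookup p b)) = p"
  by (rule poly_mapping_eqI)
    (simp add: lookup_sum lookup_single when_def in_keys_iff)

lemma lin_ext_finite:
  assumes "finite S" "Poly_Mapping.keys p \<subseteq> S"
  shows "lin_ext g p = (\<Sum>b\<in>S. scale (Poly_Mapping.lookup p b) (g b))"
  unfolding lin_ext_def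
  by (rule sum.mono_neutral_left) (use assms in \<open>auto simp: in_keys_iff\<close>)

lemma lin_ext_0 [simp]: "lin_ext g 0 = 0"
  by (simp add: lin_ext_def)

lemma lin_ext_single [simp]: "lin_ext g (Poly_Mapping.single b c) = scale c (g b)"
  by (subst lin_ext_finite[of "{b}"]) auto

lemma lin_ext_add: "lin_ext g (p + q) = lin_ext g p + lin_ext g q"
proof -
  let ?S = "Poly_Mapping.keys p \<union> Poly_Mapping.keys q"
  have "lin_ext g (p + q) = (\<Sum>b\<in>?S. scale (Poly_Mapping.lookup (p + q) b) (g b))"
    by (rule lin_ext_finite) (use keys_add[of p q] in auto)
  also have "\<dots> = (\<Sum>b\<in>?S. scale (Poly_Mapping.lookup p b) (g b)) +
      (\<Sum>b\<in>?S. scale (Poly_Mapping.lookup q b) (g b))"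
    by (simp add: lookup_add scale_add_left sum.distrib)
  also have "\<dots> = lin_ext g p + lin_ext g q"
    by (subst (1 2) lin_ext_finite[of ?S]) auto
  finally show ?thesis .
qed

lemma lin_ext_scale: "lin_ext g (scale c p) = scale c (lin_ext g p)"
proof -
  have "Poly_Mapping.keys (scale c p) \<subseteq> Poly_Mapping.keys p"
    by (auto simp: in_keys_iff)
  then show ?thesis
    by (simp add: lin_ext_finite[of "Poly_Mapping.keys p"] scale_sum scale_scale)
qed

lemma lin_ext_sum: "lin_ext g (\<Sum>b\<in>S. f b) = (\<Sum>b\<in>S. lin_ext g (f b))"
  by (induction S rule: infinite_finite_induct) (auto simp: lin_ext_add)

text \<open>
  Moving all linear maps inside one linear extension is how identities between composite maps are
  reduced to their values at monomials.
\<close>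
lemma lin_ext_lin_ext: "lin_ext g (lin_ext h p) = lin_ext (\<lambda>b. lin_ext g (h b)) p"
  unfolding lin_ext_def[of h] lin_ext_def[of "\<lambda>b. lin_ext g (h b)"] lin_ext_sum lin_ext_scale ..

lemma lin_ext_cong:
  "(\<And>b. b \<in> Poly_Mapping.keys p \<Longrightarrow> g b = h b) \<Longrightarrow> lin_ext g p = lin_ext h p"
  unfolding lin_ext_def by (rule sum.cong) auto

lemma lin_ext_basis: "lin_ext basis p = p"
  unfolding lin_ext_def by (simp add: sum_single_lookup)

lemma lin_ext_eq_0: "(\<And>b. b \<in> Poly_Mapping.keys p \<Longrightarrow> g b = 0) \<Longrightarrow> lin_ext g p = 0"
  unfolding lin_ext_def by simp

lemma sum_lin_ext: "(\<Sum>r\<in>R. lin_ext (h r) p) = lin_ext (\<lambda>b. \<Sum>r\<in>R. h r b) p"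
  unfolding lin_ext_def by (subst sum.swap) (simp add: scale_sum)

text \<open>
  Bilinearity of the product: a multiplicative rule on basis elements extends to all of the algebra.
\<close>
lemma lin_ext_mult:
  fixes p q :: "'b::comm_monoid_add \<Rightarrow>\<^sub>0 'k::field_char_0"
    and g h :: "'b \<Rightarrow> 'c::comm_monoid_add \<Rightarrow>\<^sub>0 'k"
  assumes "\<And>b c. b \<in> Poly_Mapping.keys p \<Longrightarrow> c \<in> Poly_Mapping.keys q \<Longrightarrow> f (b + c) = g b * h c"
  shows "lin_ext f (p * q) = lin_ext g p * lin_ext h q"
proof -
  have "p * q = (\<Sum>b\<in>Poly_Mapping.keys p. \<Sum>c\<in>Poly_Mapping.keys q.
      Poly_Mapping.single (b + c) (Poly_Mapping.lookup p b * Poly_Mapping.lookup q c))"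
    by (subst (1) sum_single_lookup[of p, symmetric],
        subst (1) sum_single_lookup[of q, symmetric])
      (simp add: sum_product mult_single)
  then show ?thesis
    by (simp add: lin_ext_sum lin_ext_def[of g] lin_ext_def[of h] sum_product scale_mult_scale assms)
qed

lemma keys_lin_ext:
  assumes "\<And>b. b \<in> Poly_Mapping.keys p \<Longrightarrow> Poly_Mapping.keys (g b) \<subseteq> S"
  shows "Poly_Mapping.keys (lin_ext g p) \<subseteq> S"
proof -
  have "Poly_Mapping.keys (scale c (g b)) \<subseteq> Poly_Mapping.keys (g b)" for c b
    by (auto simp: in_keys_iff)
  then show ?thesis
    unfolding lin_ext_def using assms keys_sum by fastforce
qed

lemma tensor_basis [simp]: "tensor (basis b) (basis c) = basis (b, c)"
  by (simp add: tensor_def)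

lemma tensor_0 [simp]: "tensor 0 q = 0" "tensor p 0 = 0"
  by (simp_all add: tensor_def)

section \<open>Noncrossing families of blocks\<close>

definition disjoint_blocks :: "'x family \<Rightarrow> bool" where
  "disjoint_blocks \<pi> \<longleftrightarrow> (\<forall>x y i. i \<in> \<pi> x \<longrightarrow> i \<in> \<pi> y \<longrightarrow> x = y)"

text \<open>
  For an equivalence \<open>r\<close> this says that the classes of \<open>r\<close>, each merged into one block, do not cross.
  For \<open>r = Id\<close> it says that \<open>\<pi>\<close> is noncrossing. It makes sense for arbitrary families, so it can be
  tested before renumbering and before contracting.
\<close>
definition noncrossing_wrt :: "'x family \<Rightarrow> ('x \<times> 'x) set \<Rightarrow> bool" where
  "noncrossing_wrt \<pi> r \<longleftrightarrow> (\<forall>x y z t i j k l. (x, z) \<in> r \<longrightarrow> (y, t) \<in> r \<longrightarrow>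
     i \<in> \<pi> x \<longrightarrow> j \<in> \<pi> y \<longrightarrow> k \<in> \<pi> z \<longrightarrow> l \<in> \<pi> t \<longrightarrow> i < j \<longrightarrow> j < k \<longrightarrow> k < l \<longrightarrow> (x, y) \<in> r)"

lemma noncrossing_wrtI:
  "(\<And>x y z t i j k l. \<lbrakk>(x, z) \<in> r; (y, t) \<in> r; i \<in> \<pi> x; j \<in> \<pi> y; k \<in> \<pi> z; l \<in> \<pi> t;
    i < j; j < k; k < l\<rbrakk> \<Longrightarrow> (x, y) \<in> r) \<Longrightarrow> noncrossing_wrt \<pi> r"
  unfolding noncrossing_wrt_def by blast

lemma noncrossing_wrtD:
  "\<lbrakk>noncrossing_wrt \<pi> r; (x, z) \<in> r; (y, t) \<in> r; i \<in> \<pi> x; j \<in> \<pi> y; k \<in> \<pi> z; l \<in> \<pi> t;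
    i < j; j < k; k < l\<rbrakk> \<Longrightarrow> (x, y) \<in> r"
  unfolding noncrossing_wrt_def by blast

lemma in_idxI: "i \<in> \<pi> x \<Longrightarrow> x \<in> idx \<pi>"
  by (auto simp: idx_def)

lemma in_idx_iff: "x \<in> idx \<pi> \<longleftrightarrow> (\<exists>i. i \<in> \<pi> x)"
  by (auto simp: idx_def)

text \<open>
  Crossings are preserved and reflected when the elements are renumbered by an order-preserving map
  \<open>h\<close> and the labels are mapped by \<open>f\<close>, possibly merging blocks, if \<open>f\<close> preserves and reflects the
  relations: a crossing of the new family lifts by choosing preimages of its four elements.
\<close>
lemma noncrossing_wrt_image:
  assumes mem: "\<And>i y. i \<in> \<rho> y \<longleftrightarrow> (\<exists>x\<in>X. y = f x \<and> (\<exists>i'\<in>\<pi> x. i = h i'))"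
    and less: "\<And>x y i j. \<lbrakk>x \<in> X; y \<in> X; i \<in> \<pi> x; j \<in> \<pi> y\<rbrakk> \<Longrightarrow> h i < h j \<longleftrightarrow> i < j"
    and rel: "\<And>x y. \<lbrakk>x \<in> X; y \<in> X\<rbrakk> \<Longrightarrow> (f x, f y) \<in> R \<longleftrightarrow> (x, y) \<in> r"
    and X: "\<And>x y. \<lbrakk>(x, y) \<in> r; x \<in> idx \<pi>; y \<in> idx \<pi>\<rbrakk> \<Longrightarrow> x \<in> X \<and> y \<in> X"
  shows "noncrossing_wrt \<rho> R \<longleftrightarrow> noncrossing_wrt \<pi> r"
proof
  assume L: "noncrossing_wrt \<rho> R"
  show "noncrossing_wrt \<pi> r"
  proof (rule noncrossing_wrtI)
    fix x y z t i j k l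
    assume a: "(x, z) \<in> r" "(y, t) \<in> r" "i \<in> \<pi> x" "j \<in> \<pi> y" "k \<in> \<pi> z" "l \<in> \<pi> t"
      "i < j" "j < k" "k < l"
    have b: "x \<in> X" "y \<in> X" "z \<in> X" "t \<in> X"
      using X[OF a(1)] X[OF a(2)] in_idxI[of i \<pi> x] in_idxI[of j \<pi> y] in_idxI[of k \<pi> z]
        in_idxI[of l \<pi> t] a(3-6) by simp_all
    have "h i \<in> \<rho> (f x)" "h j \<in> \<rho> (f y)" "h k \<in> \<rho> (f z)" "h l \<in> \<rho> (f t)"
      using a(3-6) b unfolding mem by blast+
    moreover have "h i < h j" "h j < h k" "h k < h l"
      using a(3-9) b less by simp_all
    moreover have "(f x, f z) \<in> R" "(f y, f t) \<in> R"
      using a(1,2) b rel by simp_all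
    ultimately have "(f x, f y) \<in> R"
      using noncrossing_wrtD[OF L, of "f x" "f z" "f y" "f t" "h i" "h j" "h k" "h l"] by simp
    then show "(x, y) \<in> r"
      using b rel by simp
  qed
next
  assume R: "noncrossing_wrt \<pi> r"
  show "noncrossing_wrt \<rho> R"
  proof (rule noncrossing_wrtI)
    fix c d e g i j k l
    assume a: "(c, e) \<in> R" "(d, g) \<in> R" "i \<in> \<rho> c" "j \<in> \<rho> d" "k \<in> \<rho> e" "l \<in> \<rho> g"
      "i < j" "j < k" "k < l"
    obtain x i' where x: "x \<in> X" "c = f x" "i' \<in> \<pi> x" "i = h i'"
      using a(3) unfolding mem by blast
    obtain y j' where y: "y \<in> X" "d = f y" "j' \<in> \<pi> y" "j = h j'"
      using a(4) unfolding mem by blast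
    obtain z k' where z: "z \<in> X" "e = f z" "k' \<in> \<pi> z" "k = h k'"
      using a(5) unfolding mem by blast
    obtain t l' where t: "t \<in> X" "g = f t" "l' \<in> \<pi> t" "l = h l'"
      using a(6) unfolding mem by blast
    have "(x, y) \<in> r"
      by (rule noncrossing_wrtD[OF R _ _ x(3) y(3) z(3) t(3)])
        (use a(1,2,7-9) x y z t rel less in simp_all)
    then show "(c, d) \<in> R"
      using x y rel by simp
  qed
qed

text \<open>
  The blocks are separated by their labels rather than as members of a set of blocks. That the
  partitioned set \<open>{1..n}\<close> is nonempty becomes \<open>X \<noteq> {}\<close>.
\<close>
lemma indexed_ncp_iff:
  "indexed_ncp X \<pi> \<longleftrightarrow> finite X \<and> X \<noteq> {} \<and> idx \<pi> = X \<and> disjoint_blocks \<pi> \<and>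
     (\<exists>n. (\<Union>x\<in>X. \<pi> x) = {1..n}) \<and> noncrossing_wrt \<pi> Id" (is "?L \<longleftrightarrow> ?R")
proof
  assume L: ?L
  then obtain n where ncp: "noncrossing_partition n (\<pi> ` X)"
    unfolding indexed_ncp_def by blast
  then have n: "n \<ge> 1" "partition_on {1..n} (\<pi> ` X)"
    unfolding noncrossing_partition_def by simp_all
  have nc: False
    if "x \<in> X" "y \<in> X" "\<pi> x \<noteq> \<pi> y" "i \<in> \<pi> x" "k \<in> \<pi> x" "j \<in> \<pi> y" "l \<in> \<pi> y"
      "i < j" "j < k" "k < l" for x y i j k l
    using ncp that unfolding noncrossing_partition_def by (meson imageI)
  have inj: "inj_on \<pi> X" and out: "\<And>x. x \<notin> X \<Longrightarrow> \<pi> x = {}" and fin: "finite X"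
    using L unfolding indexed_ncp_def by auto
  have idx: "idx \<pi> = X"
    using n(2) out unfolding idx_def partition_on_def by force
  have un: "(\<Union>x\<in>X. \<pi> x) = {1..n}"
    using n(2) unfolding partition_on_def by simp
  have dis: "disjoint_blocks \<pi>"
    unfolding disjoint_blocks_def
  proof (intro allI impI)
    fix x y i assume i: "i \<in> \<pi> x" "i \<in> \<pi> y"
    then have "x \<in> X" "y \<in> X"
      using out by blast+
    moreover have "\<pi> x = \<pi> y"
    proof (rule ccontr)
      assume "\<pi> x \<noteq> \<pi> y"
      then have "\<pi> x \<inter> \<pi> y = {}"
        using n(2) \<open>x \<in> X\<close> \<open>y \<in> X\<close> unfolding partition_on_def disjoint_def by simp
      with i show False
        by blast
    qed
    ultimately show "x = y"
      using inj by (auto dest: inj_onD)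
  qed
  have "noncrossing_wrt \<pi> Id"
  proof (rule noncrossing_wrtI)
    fix x y z t i j k l
    assume a: "(x, z) \<in> Id" "(y, t) \<in> Id" "i \<in> \<pi> x" "j \<in> \<pi> y" "k \<in> \<pi> z" "l \<in> \<pi> t"
      "i < j" "j < k" "k < l"
    then have "x \<in> X" "y \<in> X"
      using out by blast+
    then show "(x, y) \<in> Id"
      using nc[of x y i k j l] a inj by (auto dest: inj_onD)
  qed
  moreover have "X \<noteq> {}"
    using un n(1) by auto
  ultimately show ?R
    using fin idx dis un by blast
next
  assume R: ?R
  then obtain n where n: "(\<Union>x\<in>X. \<pi> x) = {1..n}"
    by blast
  have X: "\<And>x. x \<in> X \<longleftrightarrow> \<pi> x \<noteq> {}"
    using R by (auto simp: idx_def)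
  have dis: "\<And>x y i. i \<in> \<pi> x \<Longrightarrow> i \<in> \<pi> y \<Longrightarrow> x = y"
    using R unfolding disjoint_blocks_def by blast
  have inj: "inj_on \<pi> X"
    unfolding inj_on_def using X dis by (metis all_not_in_conv)
  have "n \<ge> 1"
  proof -
    obtain x where "x \<in> X"
      using R by auto
    moreover from this obtain i where "i \<in> \<pi> x"
      using X by fastforce
    ultimately have "i \<in> (\<Union>x\<in>X. \<pi> x)"
      by blast
    then have "i \<in> {1..n}"
      using n by simp
    then show ?thesis
      by simp
  qed
  moreover have "partition_on {1..n} (\<pi> ` X)"
    unfolding partition_on_def disjoint_def
  proof (intro conjI ballI impI)
    show "\<Union> (\<pi> ` X) = {1..n}" by (fact n)
    show "{} \<notin> \<pi> ` X" using X by auto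
  next
    fix b b' assume "b \<in> \<pi> ` X" "b' \<in> \<pi> ` X" "b \<noteq> b'"
    then obtain x y where "b = \<pi> x" "b' = \<pi> y" "x \<noteq> y"
      by blast
    then show "b \<inter> b' = {}"
      using dis by blast
  qed
  moreover have "\<not> (\<exists>b\<in>\<pi> ` X. \<exists>b'\<in>\<pi> ` X. b \<noteq> b' \<and>
          (\<exists>x\<in>b. \<exists>z\<in>b. \<exists>y\<in>b'. \<exists>t\<in>b'. x < y \<and> y < z \<and> z < t))"
  proof
    assume "\<exists>b\<in>\<pi> ` X. \<exists>b'\<in>\<pi> ` X. b \<noteq> b' \<and>
          (\<exists>x\<in>b. \<exists>z\<in>b. \<exists>y\<in>b'. \<exists>t\<in>b'. x < y \<and> y < z \<and> z < t)"
    then obtain x y i j k l where "\<pi> x \<noteq> \<pi> y" "i \<in> \<pi> x" "j \<in> \<pi> x" "k \<in> \<pi> y" "l \<in> \<pi> y"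
      "i < k" "k < j" "j < l"
      by blast
    then show False
      using noncrossing_wrtD[of \<pi> Id x x y y i k j l] R by auto
  qed
  ultimately have "noncrossing_partition n (\<pi> ` X)"
    unfolding noncrossing_partition_def by (intro conjI)
  then show ?L
    unfolding indexed_ncp_def using R X inj by metis
qed

lemma indexed_ncpD:
  assumes "indexed_ncp X \<pi>"
  shows "finite X" "X \<noteq> {}" "idx \<pi> = X" "disjoint_blocks \<pi>" "noncrossing_wrt \<pi> Id"
    "\<And>Y. finite (\<Union>y\<in>Y. \<pi> y)" "finite (\<pi> x)"
proof -
  show "finite X" "X \<noteq> {}" "idx \<pi> = X" "disjoint_blocks \<pi>" "noncrossing_wrt \<pi> Id"
    using assms by (simp_all add: indexed_ncp_iff)
  obtain n where "(\<Union>x\<in>X. \<pi> x) = {1..n}" "idx \<pi> = X"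
    using assms by (auto simp: indexed_ncp_iff)
  then have "(\<Union>y\<in>Y. \<pi> y) \<subseteq> {1..n}" for Y
    by (fastforce simp: idx_def)
  then show "finite (\<Union>y\<in>Y. \<pi> y)" for Y
    by (rule finite_subset) simp
  from this[of "{x}"] show "finite (\<pi> x)"
    by simp
qed

subsection \<open>Renumbering\<close>

lemma rank_less_iff:
  assumes "finite S" "i \<in> S" "j \<in> S"
  shows "rank S i < rank S j \<longleftrightarrow> i < j"
proof -
  have *: "rank S i < rank S j" if "i < j" "j \<in> S" for i j
    unfolding rank_def
  proof (rule psubset_card_mono)
    have "j \<in> {k \<in> S. k \<le> j}" "j \<notin> {k \<in> S. k \<le> i}"
      using that by auto
    then have "{k \<in> S. k \<le> i} \<noteq> {k \<in> S. k \<le> j}"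
      by metis
    then show "{k \<in> S. k \<le> i} \<subset> {k \<in> S. k \<le> j}"
      using \<open>i < j\<close> by (intro psubsetI) auto
  qed (use assms(1) in auto)
  show ?thesis
    using *[of i j] *[of j i] assms by (metis less_asym linorder_neqE_nat)
qed

lemma rank_eq_iff: "finite S \<Longrightarrow> i \<in> S \<Longrightarrow> j \<in> S \<Longrightarrow> rank S i = rank S j \<longleftrightarrow> i = j"
  using rank_less_iff[of S i j] rank_less_iff[of S j i] by (metis less_irrefl linorder_neqE_nat)

lemma rank_image:
  assumes "finite S"
  shows "rank S ` S = {1..card S}"
proof (rule card_subset_eq)
  have "rank S i \<le> card S" for i
    unfolding rank_def by (rule card_mono) (use assms in auto)
  moreover have "rank S i \<ge> 1" if "i \<in> S" for i
    unfolding rank_def using assms that by (auto simp: Suc_le_eq card_gt_0_iff)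
  ultimately show "rank S ` S \<subseteq> {1..card S}"
    by auto
  have "inj_on (rank S) S"
    using rank_eq_iff[OF assms] by (auto simp: inj_on_def)
  then show "card (rank S ` S) = card {1..card S}"
    by (simp add: card_image)
qed simp

lemma rank_atLeastAtMost: "i \<in> {1..n} \<Longrightarrow> rank {1..n} i = i"
proof -
  assume "i \<in> {1..n}"
  then have "{j \<in> {1..n}. j \<le> i} = {1..i}"
    by auto
  then show ?thesis
    by (simp add: rank_def)
qed

text \<open>
  Renumbering \<open>S\<close> and then a subset of it is the same as renumbering the subset at once, because
  the first renumbering preserves the order. This gives transitivity of restriction.
\<close>
lemma rank_rank:
  assumes "finite S" "T \<subseteq> S" "i \<in> S"
  shows "rank (rank S ` T) (rank S i) = rank T i"
proof -
  have le: "rank S j \<le> rank S i \<longleftrightarrow> j \<le> i" if "j \<in> T" for j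
    using rank_less_iff[of S i j] assms that by (metis not_le subset_iff)
  have "{j \<in> rank S ` T. j \<le> rank S i} = rank S ` {j \<in> T. j \<le> i}"
    using le by auto
  moreover have "inj_on (rank S) {j \<in> T. j \<le> i}"
    using assms rank_eq_iff[of S] by (auto simp: inj_on_def)
  ultimately show ?thesis
    unfolding rank_def[of "rank S ` T"] rank_def[of T] by (simp add: card_image)
qed

lemma in_restr: "i \<in> restr \<pi> Y x \<longleftrightarrow> x \<in> Y \<and> (\<exists>i'\<in>\<pi> x. i = rank (\<Union>y\<in>Y. \<pi> y) i')"
  by (auto simp: restr_def)

lemma idx_restr: "idx (restr \<pi> Y) = Y \<inter> idx \<pi>"
  by (auto simp: restr_def idx_def)

lemma restr_restr:
  assumes "finite (\<Union>y\<in>Y. \<pi> y)" "Z \<subseteq> Y"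
  shows "restr (restr \<pi> Y) Z = restr \<pi> Z"
proof
  fix x
  have un: "(\<Union>z\<in>Z. restr \<pi> Y z) = rank (\<Union>y\<in>Y. \<pi> y) ` (\<Union>z\<in>Z. \<pi> z)"
    using assms(2) by (fastforce simp: restr_def)
  show "restr (restr \<pi> Y) Z x = restr \<pi> Z x"
  proof (cases "x \<in> Z")
    case True
    have "rank (\<Union>z\<in>Z. restr \<pi> Y z) (rank (\<Union>y\<in>Y. \<pi> y) i) = rank (\<Union>z\<in>Z. \<pi> z) i"
      if "i \<in> \<pi> x" for i
      unfolding un by (rule rank_rank[OF assms(1)]) (use True assms(2) that in auto)
    with True assms(2) show ?thesis
      by (force simp: set_eq_iff in_restr)
  qed (simp add: restr_def)
qed

lemma restr_idx: "indexed_ncp X \<pi> \<Longrightarrow> restr \<pi> X = \<pi>"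
proof
  fix x assume X: "indexed_ncp X \<pi>"
  then obtain n where n: "(\<Union>x\<in>X. \<pi> x) = {1..n}"
    by (auto simp: indexed_ncp_iff)
  show "restr \<pi> X x = \<pi> x"
  proof (cases "x \<in> X")
    case True
    have "rank {1..n} i = i" if "i \<in> \<pi> x" for i
      by (rule rank_atLeastAtMost) (use True n that in blast)
    with True n show ?thesis
      by (simp add: restr_def)
  next
    case False
    then show ?thesis
      using indexed_ncpD(3)[OF X] by (auto simp: restr_def idx_def)
  qed
qed

lemma noncrossing_wrt_restr:
  assumes "finite (\<Union>y\<in>Y. \<pi> y)" "\<And>x y. (x, y) \<in> r \<Longrightarrow> x \<in> Y \<and> y \<in> Y"
  shows "noncrossing_wrt (restr \<pi> Y) r \<longleftrightarrow> noncrossing_wrt \<pi> r"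
proof (rule noncrossing_wrt_image)
  show "i \<in> restr \<pi> Y y \<longleftrightarrow> (\<exists>x\<in>Y. y = x \<and> (\<exists>i'\<in>\<pi> x. i = rank (\<Union>y\<in>Y. \<pi> y) i'))" for i y
    by (simp add: in_restr)
  show "rank (\<Union>y\<in>Y. \<pi> y) i < rank (\<Union>y\<in>Y. \<pi> y) j \<longleftrightarrow> i < j"
    if "x \<in> Y" "y \<in> Y" "i \<in> \<pi> x" "j \<in> \<pi> y" for x y i j
    by (rule rank_less_iff[OF assms(1)]) (use that in blast)+
qed (use assms(2) in auto)

lemma noncrossing_wrt_Int: "noncrossing_wrt \<pi> r \<Longrightarrow> noncrossing_wrt \<pi> (r \<inter> Y \<times> Y)"
  unfolding noncrossing_wrt_def[of _ "r \<inter> Y \<times> Y"] by (auto dest: noncrossing_wrtD)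

lemma noncrossing_wrt_Int_iff:
  assumes "idx \<pi> \<subseteq> Y"
  shows "noncrossing_wrt \<pi> (r \<inter> Y \<times> Y) \<longleftrightarrow> noncrossing_wrt \<pi> r"
proof
  assume L: "noncrossing_wrt \<pi> (r \<inter> Y \<times> Y)"
  have Y: "x \<in> Y" if "i \<in> \<pi> x" for x i
    using assms that by (auto simp: idx_def)
  show "noncrossing_wrt \<pi> r"
  proof (rule noncrossing_wrtI)
    fix x y z t i j k l
    assume a: "(x, z) \<in> r" "(y, t) \<in> r" "i \<in> \<pi> x" "j \<in> \<pi> y" "k \<in> \<pi> z" "l \<in> \<pi> t"
      "i < j" "j < k" "k < l"
    show "(x, y) \<in> r"
      using noncrossing_wrtD[OF L _ _ a(3-9)] a(3-6)[THEN Y] a(1,2) by blast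
  qed
qed (rule noncrossing_wrt_Int)

lemma indexed_ncp_restr:
  assumes X: "indexed_ncp X \<pi>" and Y: "Y \<subseteq> X" "Y \<noteq> {}"
  shows "indexed_ncp Y (restr \<pi> Y)"
proof -
  let ?S = "\<Union>y\<in>Y. \<pi> y"
  note fin = indexed_ncpD(6)[OF X, of Y]
  have idx: "idx (restr \<pi> Y) = Y"
    using Y indexed_ncpD(3)[OF X] by (auto simp: idx_restr)
  have "(\<Union>y\<in>Y. restr \<pi> Y y) = rank ?S ` ?S"
    by (fastforce simp: restr_def)
  then have "\<exists>n. (\<Union>y\<in>Y. restr \<pi> Y y) = {1..n}"
    using rank_image[OF fin] by metis
  moreover have "disjoint_blocks (restr \<pi> Y)"
    unfolding disjoint_blocks_def
  proof (intro allI impI)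
    fix x y i assume "i \<in> restr \<pi> Y x" "i \<in> restr \<pi> Y y"
    then obtain i' i'' where "x \<in> Y" "y \<in> Y" "i' \<in> \<pi> x" "i'' \<in> \<pi> y" "rank ?S i' = rank ?S i''"
      by (auto simp: in_restr)
    moreover from this have "i' = i''"
      using rank_eq_iff[OF fin, of i' i''] by blast
    ultimately show "x = y"
      using indexed_ncpD(4)[OF X] unfolding disjoint_blocks_def by blast
  qed
  moreover have "noncrossing_wrt (restr \<pi> Y) (Id \<inter> Y \<times> Y)"
    by (subst noncrossing_wrt_restr[OF fin])
      (auto intro: noncrossing_wrt_Int[OF indexed_ncpD(5)[OF X]])
  then have "noncrossing_wrt (restr \<pi> Y) Id"
    using idx by (subst (asm) noncrossing_wrt_Int_iff) auto
  moreover have "finite Y"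
    using X Y by (meson finite_subset indexed_ncpD(1))
  ultimately show ?thesis
    using idx Y unfolding indexed_ncp_iff by blast
qed

section \<open>Contraction\<close>

definition class_label :: "('a label \<times> 'a label) set \<Rightarrow> 'a label \<Rightarrow> 'a label" where
  "class_label r x = cls (r `` {x})"

lemma equiv_mem: "equiv X r \<Longrightarrow> (x, y) \<in> r \<Longrightarrow> x \<in> X \<and> y \<in> X"
  using equiv_type[of X r] by blast

lemma equiv_refl: "equiv X r \<Longrightarrow> x \<in> X \<Longrightarrow> (x, x) \<in> r"
  and equiv_symD: "equiv X r \<Longrightarrow> (x, y) \<in> r \<Longrightarrow> (y, x) \<in> r"
  and equiv_transD: "equiv X r \<Longrightarrow> (x, y) \<in> r \<Longrightarrow> (y, z) \<in> r \<Longrightarrow> (x, z) \<in> r"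
  by (auto elim!: equivE dest: refl_onD symD transD)

lemma elems_class_label: "equiv X r \<Longrightarrow> finite X \<Longrightarrow> elems (class_label r x) = r `` {x}"
  unfolding class_label_def
  by (rule elems_cls, rule finite_subset[of _ X]) (auto dest: equiv_mem)

lemma class_label_eq_iff:
  assumes "equiv X r" "finite X" "x \<in> X" "y \<in> X"
  shows "class_label r x = class_label r y \<longleftrightarrow> (x, y) \<in> r"
proof -
  have "class_label r x = class_label r y \<longleftrightarrow> r `` {x} = r `` {y}"
    using elems_class_label[OF assms(1,2)] by (metis class_label_def)
  then show ?thesis
    using eq_equiv_class_iff[OF assms(1,3,4)] by simp
qed

lemma quot_eq: "quot X r = class_label r ` X"
  by (auto simp: quot_def class_label_def quotient_def)

text \<open>
  A class is named by any of its members; with this rule contractions are computed elementwise and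
  the set of classes disappears.
\<close>
lemma in_contract:
  assumes "equiv X r"
  shows "i \<in> contract X r \<pi> c \<longleftrightarrow> (\<exists>y\<in>X. c = class_label r y \<and> i \<in> \<pi> y)"
proof
  assume "i \<in> contract X r \<pi> c"
  then obtain C y where C: "C \<in> X // r" "cls C = c" "y \<in> C" "i \<in> \<pi> y"
    by (auto simp: contract_def)
  then obtain x where "x \<in> X" "C = r `` {x}"
    by (auto elim: quotientE)
  with C(3) have "C = r `` {y}" "y \<in> X"
    using equiv_class_eq[OF assms, of x y] equiv_mem[OF assms] by auto
  with C show "\<exists>y\<in>X. c = class_label r y \<and> i \<in> \<pi> y"
    by (auto simp: class_label_def)
next
  assume "\<exists>y\<in>X. c = class_label r y \<and> i \<in> \<pi> y"
  then obtain y where y: "y \<in> X" "c = class_label r y" "i \<in> \<pi> y"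
    by blast
  moreover have "r `` {y} \<in> X // r" "y \<in> r `` {y}"
    using y(1) equiv_refl[OF assms] by (auto simp: quotientI)
  ultimately show "i \<in> contract X r \<pi> c"
    unfolding contract_def class_label_def by blast
qed

lemma idx_contract: "equiv X r \<Longrightarrow> X \<subseteq> idx \<pi> \<Longrightarrow> idx (contract X r \<pi>) = quot X r"
  by (fastforce simp: in_idx_iff in_contract quot_eq)

lemma equiv_Int: "equiv X r \<Longrightarrow> C \<subseteq> X \<Longrightarrow> equiv C (r \<inter> C \<times> C)"
  by (rule equivI) (auto intro!: refl_onI symI transI dest: equiv_refl equiv_symD equiv_transD)

lemma class_label_Int:
  "(\<And>x y. x \<in> C \<Longrightarrow> (x, y) \<in> r \<Longrightarrow> y \<in> C) \<Longrightarrow> x \<in> C \<Longrightarrow> class_label (r \<inter> C \<times> C) x = class_label r x"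
  by (auto simp: class_label_def intro!: arg_cong[of _ _ cls])

lemma UN_contract:
  assumes "equiv X r" "finite X" "C \<subseteq> X" "\<And>x y. x \<in> C \<Longrightarrow> (x, y) \<in> r \<Longrightarrow> y \<in> C"
  shows "(\<Union>c\<in>class_label r ` C. contract X r \<pi> c) = (\<Union>x\<in>C. \<pi> x)"
proof (intro subset_antisym subsetI)
  fix i assume "i \<in> (\<Union>c\<in>class_label r ` C. contract X r \<pi> c)"
  then obtain x y where "x \<in> C" "y \<in> X" "class_label r x = class_label r y" "i \<in> \<pi> y"
    by (auto simp: in_contract[OF assms(1)])
  moreover from this have "y \<in> C"
    using class_label_eq_iff[OF assms(1,2), of x y] assms(3,4) by blast
  ultimately show "i \<in> (\<Union>x\<in>C. \<pi> x)"
    by blast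
next
  fix i assume "i \<in> (\<Union>x\<in>C. \<pi> x)"
  then show "i \<in> (\<Union>c\<in>class_label r ` C. contract X r \<pi> c)"
    using assms(3) by (auto simp: in_contract[OF assms(1)])
qed

text \<open>
  Extraction commutes with contraction for a union \<open>C\<close> of classes: the renumbered set is the same
  on both sides, since contracting does not change the union of the blocks.
\<close>
lemma contract_restr:
  assumes X: "equiv X r" "finite X" and C: "C \<subseteq> X" "\<And>x y. x \<in> C \<Longrightarrow> (x, y) \<in> r \<Longrightarrow> y \<in> C"
  shows "contract C (r \<inter> C \<times> C) (restr \<pi> C) = restr (contract X r \<pi>) (class_label r ` C)"
proof (intro ext set_eqI)
  fix c i
  let ?S = "\<Union>x\<in>C. \<pi> x"
  have un: "(\<Union>c\<in>class_label r ` C. contract X r \<pi> c) = ?S"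
    by (rule UN_contract[OF assms])
  have "i \<in> contract C (r \<inter> C \<times> C) (restr \<pi> C) c \<longleftrightarrow>
      (\<exists>y\<in>C. c = class_label r y \<and> (\<exists>i'\<in>\<pi> y. i = rank ?S i'))"
    unfolding in_contract[OF equiv_Int[OF X(1) C(1)]] in_restr
    using class_label_Int[of C r] C(2) by auto
  also have "\<dots> \<longleftrightarrow> (\<exists>y\<in>X. c \<in> class_label r ` C \<and> c = class_label r y \<and> (\<exists>i'\<in>\<pi> y. i = rank ?S i'))"
  proof (intro iffI; elim bexE conjE)
    fix y i' assume a: "y \<in> X" "c \<in> class_label r ` C" "c = class_label r y" "i' \<in> \<pi> y" "i = rank ?S i'"
    then obtain x where "x \<in> C" "class_label r x = class_label r y"
      by auto
    then have "y \<in> C"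
      using class_label_eq_iff[OF X, of x y] a(1) C by blast
    then show "\<exists>y\<in>C. c = class_label r y \<and> (\<exists>i'\<in>\<pi> y. i = rank ?S i')"
      using a by blast
  qed (use C(1) in blast)
  also have "\<dots> \<longleftrightarrow> i \<in> restr (contract X r \<pi>) (class_label r ` C) c"
    unfolding in_restr un Bex_def in_contract[OF X(1)] by blast
  finally show "i \<in> contract C (r \<inter> C \<times> C) (restr \<pi> C) c \<longleftrightarrow>
      i \<in> restr (contract X r \<pi>) (class_label r ` C) c" .
qed

text \<open>
  The two uses are \<open>R = Id\<close>, which yields the criterion for \<open>\<pi>/r\<close> to be
  noncrossing, and \<open>R\<close> the equivalence induced on a quotient by a coarser one.
\<close>
lemma noncrossing_wrt_contract:
  assumes X: "equiv X r'" "idx \<pi> \<subseteq> X"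
    and r: "\<And>x y. x \<in> X \<Longrightarrow> y \<in> X \<Longrightarrow> (class_label r' x, class_label r' y) \<in> R \<longleftrightarrow> (x, y) \<in> r"
  shows "noncrossing_wrt (contract X r' \<pi>) R \<longleftrightarrow> noncrossing_wrt \<pi> r"
proof (rule noncrossing_wrt_image)
  show "i \<in> contract X r' \<pi> c \<longleftrightarrow> (\<exists>x\<in>X. c = class_label r' x \<and> (\<exists>i'\<in>\<pi> x. i = i'))" for i c
    by (simp add: in_contract[OF X(1)])
qed (use X(2) r in auto)

lemma indexed_ncp_contract_iff:
  assumes \<pi>: "indexed_ncp X \<pi>" and r: "equiv X r"
  shows "indexed_ncp (quot X r) (contract X r \<pi>) \<longleftrightarrow> noncrossing_wrt \<pi> r"
proof -
  note D = indexed_ncpD[OF \<pi>]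
  have "noncrossing_wrt (contract X r \<pi>) Id \<longleftrightarrow> noncrossing_wrt \<pi> r"
    by (rule noncrossing_wrt_contract[OF r]) (use D class_label_eq_iff[OF r D(1)] in auto)
  moreover have "idx (contract X r \<pi>) = quot X r"
    by (rule idx_contract[OF r]) (use D in auto)
  moreover have "disjoint_blocks (contract X r \<pi>)"
    using D(4) unfolding disjoint_blocks_def in_contract[OF r] by blast
  moreover have "\<exists>n. (\<Union>c\<in>quot X r. contract X r \<pi> c) = {1..n}"
  proof -
    have "(\<Union>c\<in>quot X r. contract X r \<pi> c) = (\<Union>x\<in>X. \<pi> x)"
      unfolding quot_eq by (rule UN_contract[OF r D(1)]) (auto dest: equiv_mem[OF r])
    then show ?thesis
      using \<pi> by (simp add: indexed_ncp_iff)
  qed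
  moreover have "finite (quot X r)" "quot X r \<noteq> {}"
    using D by (auto simp: quot_eq)
  ultimately show ?thesis
    unfolding indexed_ncp_iff by blast
qed

lemma Ec_iff: "indexed_ncp X \<pi> \<Longrightarrow> r \<in> Ec X \<pi> \<longleftrightarrow> equiv X r \<and> noncrossing_wrt \<pi> r"
  using indexed_ncp_contract_iff[of X \<pi> r] by (auto simp: Ec_def)

subsection \<open>Iterated contractions\<close>

lemma in_induced_rel:
  assumes "equiv X r" "equiv X r'" "finite X" "r' \<subseteq> r" "x \<in> X" "y \<in> X"
  shows "(class_label r' x, class_label r' y) \<in> induced_rel r' r \<longleftrightarrow> (x, y) \<in> r"
proof
  assume "(class_label r' x, class_label r' y) \<in> induced_rel r' r"
  then obtain x' y' where *: "class_label r' x = class_label r' x'" "class_label r' y = class_label r' y'"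
    "(x', y') \<in> r"
    by (auto simp: induced_rel_def class_label_def)
  then have "(x, x') \<in> r'" "(y, y') \<in> r'"
    using class_label_eq_iff[OF assms(2,3)] assms(5,6) equiv_mem[OF assms(1)] by blast+
  with * show "(x, y) \<in> r"
    using assms(4) equiv_transD[OF assms(1)] equiv_symD[OF assms(1)] by (meson subsetD)
qed (auto simp: induced_rel_def class_label_def)

lemma induced_rel_sub: "equiv X r \<Longrightarrow> (c, d) \<in> induced_rel r' r \<Longrightarrow>
   \<exists>x\<in>X. \<exists>y\<in>X. c = class_label r' x \<and> d = class_label r' y \<and> (x, y) \<in> r"
  by (fastforce simp: induced_rel_def class_label_def dest: equiv_mem)

lemma equiv_induced_rel:
  assumes r: "equiv X r" "equiv X r'" "finite X" "r' \<subseteq> r"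
  shows "equiv (quot X r') (induced_rel r' r)"
proof (rule equivI)
  note I = in_induced_rel[OF assms] and E = induced_rel_sub[OF r(1), where r' = r']
  show "induced_rel r' r \<subseteq> quot X r' \<times> quot X r'"
    using E by (auto simp: quot_eq)
  show "refl_on (quot X r') (induced_rel r' r)"
    using I equiv_refl[OF r(1)] by (auto simp: quot_eq intro!: refl_onI)
  show "sym (induced_rel r' r)"
    by (rule symI) (use E I equiv_symD[OF r(1)] in metis)
  show "trans (induced_rel r' r)"
    by (rule transI) (use E I equiv_transD[OF r(1)] in metis)
qed

lemma class_induced_rel:
  assumes r: "equiv X r" "equiv X r'" "finite X" "r' \<subseteq> r" and x: "x \<in> X"
  shows "induced_rel r' r `` {class_label r' x} = class_label r' ` (r `` {x})"
proof (intro set_eqI iffI)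
  fix c assume "c \<in> induced_rel r' r `` {class_label r' x}"
  then obtain y where "y \<in> X" "c = class_label r' y" "(class_label r' x, c) \<in> induced_rel r' r"
    using induced_rel_sub[OF r(1), of "class_label r' x" c r'] by auto
  then show "c \<in> class_label r' ` (r `` {x})"
    using in_induced_rel[OF r x] by auto
next
  fix c assume "c \<in> class_label r' ` (r `` {x})"
  then show "c \<in> induced_rel r' r `` {class_label r' x}"
    using in_induced_rel[OF r x] equiv_mem[OF r(1)] by auto
qed

lemma flatten_class_label:
  assumes r: "equiv X r" "equiv X r'" "finite X" "r' \<subseteq> r" and x: "x \<in> X"
  shows "flatten (class_label (induced_rel r' r) (class_label r' x)) = class_label r x"
proof -
  have "finite (quot X r')"
    using r(3) by (simp add: quot_eq)
  then have "elems (class_label (induced_rel r' r) (class_label r' x)) = class_label r' ` (r `` {x})"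
    using elems_class_label[OF equiv_induced_rel[OF r]] class_induced_rel[OF r x] by metis
  then have "flatten (class_label (induced_rel r' r) (class_label r' x)) = cls (\<Union>y\<in>r `` {x}. r' `` {y})"
    by (simp add: flatten_def elems_class_label[OF r(2,3)])
  also have "(\<Union>y\<in>r `` {x}. r' `` {y}) = r `` {x}"
  proof (intro set_eqI iffI)
    fix z assume "z \<in> (\<Union>y\<in>r `` {x}. r' `` {y})"
    then obtain y where "(x, y) \<in> r" "(y, z) \<in> r"
      using r(4) by auto
    then show "z \<in> r `` {x}"
      using equiv_transD[OF r(1)] by simp
  next
    fix z assume "z \<in> r `` {x}"
    moreover from this have "(z, z) \<in> r'"
      using equiv_mem[OF r(1), of x z] equiv_refl[OF r(2)] by simp
    ultimately show "z \<in> (\<Union>y\<in>r `` {x}. r' `` {y})"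
      by blast
  qed
  finally show ?thesis
    by (simp add: class_label_def)
qed

lemma in_relabel: "i \<in> relabel f \<pi> y \<longleftrightarrow> (\<exists>x. f x = y \<and> i \<in> \<pi> x)"
  by (auto simp: relabel_def)

lemma idx_relabel: "idx (relabel f \<pi>) = f ` idx \<pi>"
  by (fastforce simp: idx_def relabel_def)

text \<open>
  Both sides have the block of \<open>y\<close> under a label that depends only on \<open>y\<close>, and \<open>flatten\<close> turns the
  class of classes of \<open>y\<close> into the class of \<open>y\<close>.
\<close>
lemma relabel_flatten_contract_contract:
  assumes r: "equiv X r" "equiv X r'" "finite X" "r' \<subseteq> r"
  shows "relabel flatten (contract (quot X r') (induced_rel r' r) (contract X r' \<pi>)) = contract X r \<pi>"
proof (intro ext set_eqI)
  fix c i
  have "i \<in> relabel flatten (contract (quot X r') (induced_rel r' r) (contract X r' \<pi>)) c \<longleftrightarrow>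
     (\<exists>y\<in>X. flatten (class_label (induced_rel r' r) (class_label r' y)) = c \<and> i \<in> \<pi> y)"
    unfolding in_relabel in_contract[OF equiv_induced_rel[OF r]] in_contract[OF r(2)]
    unfolding quot_eq by auto
  then show "i \<in> relabel flatten (contract (quot X r') (induced_rel r' r) (contract X r' \<pi>)) c \<longleftrightarrow>
     i \<in> contract X r \<pi> c"
    using flatten_class_label[OF r] by (auto simp: in_contract[OF r(1)])
qed

lemma relabel_unsingleton_contract_Id:
  assumes "idx \<pi> = X" "finite X"
  shows "relabel unsingleton (contract X (Id_on X) \<pi>) = \<pi>"
proof (intro ext set_eqI)
  fix x i
  have eq: "equiv X (Id_on X)"
    by (auto intro!: equivI refl_onI symI transI)
  have "unsingleton (class_label (Id_on X) y) = y" if "y \<in> X" for y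
  proof -
    have "Id_on X `` {y} = {y}"
      using that by auto
    then show ?thesis
      by (simp add: unsingleton_def elems_class_label[OF eq assms(2)])
  qed
  then show "i \<in> relabel unsingleton (contract X (Id_on X) \<pi>) x \<longleftrightarrow> i \<in> \<pi> x"
    using assms(1) by (auto simp: in_relabel in_contract[OF eq] dest: in_idxI)
qed

subsection \<open>Renaming the labels\<close>

lemma in_map_prod_iff:
  assumes "inj_on f X" "r \<subseteq> X \<times> X" "x \<in> X" "y \<in> X"
  shows "(f x, f y) \<in> map_prod f f ` r \<longleftrightarrow> (x, y) \<in> r"
proof
  assume "(f x, f y) \<in> map_prod f f ` r"
  then obtain x' y' where "(x', y') \<in> r" "f x = f x'" "f y = f y'"
    by auto
  with assms show "(x, y) \<in> r"
    by (metis inj_onD mem_Sigma_iff subsetD)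
qed auto

lemma equiv_map_prod:
  assumes "equiv X r" "inj_on f X"
  shows "equiv (f ` X) (map_prod f f ` r)"
proof (rule equivI)
  show "map_prod f f ` r \<subseteq> f ` X \<times> f ` X"
    using equiv_mem[OF assms(1)] by auto
  show "refl_on (f ` X) (map_prod f f ` r)"
    using equiv_refl[OF assms(1)] by (auto intro!: refl_onI)
  show "sym (map_prod f f ` r)"
    using equiv_symD[OF assms(1)] by (auto intro!: symI)
  show "trans (map_prod f f ` r)"
  proof (rule transI)
    fix a b c assume "(a, b) \<in> map_prod f f ` r" "(b, c) \<in> map_prod f f ` r"
    then obtain x y y' z where "(x, y) \<in> r" "(y', z) \<in> r" "a = f x" "b = f y" "f y = f y'" "c = f z"
      by auto
    moreover from this have "y = y'"
      using equiv_mem[OF assms(1)] assms(2) by (meson inj_onD)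
    ultimately show "(a, c) \<in> map_prod f f ` r"
      using equiv_transD[OF assms(1), of x y z] by auto
  qed
qed

lemma Image_map_prod:
  assumes "equiv X r" "inj_on f X" "x \<in> X"
  shows "(map_prod f f ` r) `` {f x} = f ` (r `` {x})"
proof (intro set_eqI iffI)
  fix y assume "y \<in> (map_prod f f ` r) `` {f x}"
  then obtain x' y' where "(x', y') \<in> r" "y = f y'" "f x = f x'"
    by auto
  moreover from this have "x = x'"
    using equiv_mem[OF assms(1)] assms(2,3) by (meson inj_onD)
  ultimately show "y \<in> f ` (r `` {x})"
    by auto
qed auto

lemma class_label_map_prod:
  assumes "equiv X r" "finite X" "inj_on f X" "x \<in> X"
  shows "class_label (map_prod f f ` r) (f x) = quot_map f (class_label r x)"
  unfolding quot_map_def elems_class_label[OF assms(1,2)]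
  by (simp add: class_label_def Image_map_prod[OF assms(1,3,4)])

text \<open>
  Names may be renamed by any map that is injective on the labels in use; outside of them the
  blocks are empty, so collisions there do no harm.
\<close>
lemma contract_relabel:
  assumes r: "equiv X r" "finite X" "inj_on f X" and "idx \<pi> \<subseteq> X"
  shows "contract (f ` X) (map_prod f f ` r) (relabel f \<pi>) = relabel (quot_map f) (contract X r \<pi>)"
proof (intro ext set_eqI)
  fix c i
  have X: "x \<in> X" if "i \<in> \<pi> x" for x
    using assms(4) that by (auto dest: in_idxI)
  have "i \<in> contract (f ` X) (map_prod f f ` r) (relabel f \<pi>) c \<longleftrightarrow>
      (\<exists>x\<in>X. c = class_label (map_prod f f ` r) (f x) \<and> i \<in> \<pi> x)"
    unfolding in_contract[OF equiv_map_prod[OF r(1,3)]] in_relabel using X by (metis imageE imageI)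
  also have "\<dots> \<longleftrightarrow> (\<exists>x\<in>X. c = quot_map f (class_label r x) \<and> i \<in> \<pi> x)"
    using class_label_map_prod[OF r] by auto
  also have "\<dots> \<longleftrightarrow> i \<in> relabel (quot_map f) (contract X r \<pi>) c"
    unfolding in_relabel in_contract[OF r(1)] by blast
  finally show "i \<in> contract (f ` X) (map_prod f f ` r) (relabel f \<pi>) c \<longleftrightarrow>
      i \<in> relabel (quot_map f) (contract X r \<pi>) c" .
qed

lemma restr_relabel:
  assumes "inj_on f X" "idx \<pi> \<subseteq> X" "C \<subseteq> X"
  shows "restr (relabel f \<pi>) (f ` C) = relabel f (restr \<pi> C)"
proof -
  have *: "x \<in> C" if "f x \<in> f ` C" "i \<in> \<pi> x" for x i
    using that assms by (metis image_iff in_idx_iff inj_onD subsetD)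
  have un: "(\<Union>y\<in>f ` C. relabel f \<pi> y) = (\<Union>x\<in>C. \<pi> x)"
  proof (intro set_eqI iffI)
    fix i assume "i \<in> (\<Union>y\<in>f ` C. relabel f \<pi> y)"
    then obtain x where "f x \<in> f ` C" "i \<in> \<pi> x"
      by (auto simp: in_relabel)
    with * show "i \<in> (\<Union>x\<in>C. \<pi> x)"
      by blast
  qed (auto simp: in_relabel)
  show ?thesis
  proof (intro ext set_eqI)
    fix y i
    have "i \<in> restr (relabel f \<pi>) (f ` C) y \<longleftrightarrow>
        (\<exists>x. f x \<in> f ` C \<and> f x = y \<and> (\<exists>i'\<in>\<pi> x. i = rank (\<Union>x\<in>C. \<pi> x) i'))"
      unfolding in_restr un Bex_def in_relabel by blast
    also have "\<dots> \<longleftrightarrow> (\<exists>x. f x = y \<and> x \<in> C \<and> (\<exists>i'\<in>\<pi> x. i = rank (\<Union>x\<in>C. \<pi> x) i'))"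
      using * by (metis imageI)
    finally show "i \<in> restr (relabel f \<pi>) (f ` C) y \<longleftrightarrow> i \<in> relabel f (restr \<pi> C) y"
      unfolding in_restr in_relabel .
  qed
qed

lemma noncrossing_wrt_relabel:
  assumes "inj_on f X" "idx \<pi> \<subseteq> X" "r \<subseteq> X \<times> X"
  shows "noncrossing_wrt (relabel f \<pi>) (map_prod f f ` r) \<longleftrightarrow> noncrossing_wrt \<pi> r"
proof (rule noncrossing_wrt_image)
  show "i \<in> relabel f \<pi> y \<longleftrightarrow> (\<exists>x\<in>X. y = f x \<and> (\<exists>i'\<in>\<pi> x. i = i'))" for i y
    using assms(2) in_idxI[of i \<pi>] unfolding in_relabel by blast
qed (use assms in_map_prod_iff[OF assms(1,3)] in auto)

lemma indexed_ncp_relabel: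
  assumes "indexed_ncp X \<pi>" "inj_on f X"
  shows "indexed_ncp (f ` X) (relabel f \<pi>)"
proof -
  note D = indexed_ncpD[OF assms(1)]
  have X: "x \<in> X" if "i \<in> \<pi> x" for x i
    using D(3) that by (auto dest: in_idxI)
  have "noncrossing_wrt (relabel f \<pi>) (map_prod f f ` (Id \<inter> X \<times> X))"
    using assms(2) D by (subst noncrossing_wrt_relabel) (auto intro: noncrossing_wrt_Int)
  also have "map_prod f f ` (Id \<inter> X \<times> X) = Id \<inter> f ` X \<times> f ` X"
    by auto
  finally have "noncrossing_wrt (relabel f \<pi>) Id"
    using D(3) by (subst (asm) noncrossing_wrt_Int_iff) (auto simp: idx_relabel)
  moreover have "disjoint_blocks (relabel f \<pi>)"
    using D(4) unfolding disjoint_blocks_def in_relabel by blast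
  moreover have "(\<Union>y\<in>f ` X. relabel f \<pi> y) = (\<Union>x\<in>X. \<pi> x)"
  proof (intro set_eqI iffI)
    fix i assume "i \<in> (\<Union>y\<in>f ` X. relabel f \<pi> y)"
    then obtain x where "i \<in> \<pi> x"
      by (auto simp: in_relabel)
    with X show "i \<in> (\<Union>x\<in>X. \<pi> x)"
      by blast
  qed (auto simp: in_relabel)
  ultimately show ?thesis
    using assms(1) unfolding indexed_ncp_iff by (auto simp: idx_relabel)
qed

section \<open>Monomials\<close>

text \<open>
  The factors of a monomial have disjoint nonempty index sets, hence are distinct: a monomial is the
  multiset of a set of indexed noncrossing partitions.
\<close>
lemma monoms_iff:
  "M \<in> monoms X \<longleftrightarrow> (\<exists>S. finite S \<and> M = mset_set S \<and> (\<forall>\<pi>\<in>S. indexed_ncp (idx \<pi>) \<pi>) \<and>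
     (\<forall>\<pi>\<in>S. \<forall>\<rho>\<in>S. \<pi> \<noteq> \<rho> \<longrightarrow> idx \<pi> \<inter> idx \<rho> = {}) \<and> X = (\<Union>\<pi>\<in>S. idx \<pi>))"
    (is "_ \<longleftrightarrow> ?R")
proof
  assume "M \<in> monoms X"
  then obtain F P where M: "M = image_mset F (mset_set P)" "finite P" "partition_on X P"
    "\<And>Y. Y \<in> P \<Longrightarrow> indexed_ncp Y (F Y)"
    unfolding monoms_def by blast
  have idx: "idx (F Y) = Y" if "Y \<in> P" for Y
    using indexed_ncpD(3)[OF M(4)[OF that]] .
  have "inj_on F P"
    using idx by (metis inj_onI)
  then have "M = mset_set (F ` P)"
    by (simp add: M(1) image_mset_mset_set)
  moreover have "\<forall>\<pi>\<in>F ` P. indexed_ncp (idx \<pi>) \<pi>"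
    using M(4) idx by simp
  moreover have "\<forall>\<pi>\<in>F ` P. \<forall>\<rho>\<in>F ` P. \<pi> \<noteq> \<rho> \<longrightarrow> idx \<pi> \<inter> idx \<rho> = {}"
  proof (intro ballI impI)
    fix \<pi> \<rho> assume "\<pi> \<in> F ` P" "\<rho> \<in> F ` P" "\<pi> \<noteq> \<rho>"
    then obtain Y Z where "Y \<in> P" "Z \<in> P" "Y \<noteq> Z" "\<pi> = F Y" "\<rho> = F Z"
      by blast
    then show "idx \<pi> \<inter> idx \<rho> = {}"
      using M(3) idx unfolding partition_on_def disjoint_def by simp
  qed
  moreover have "X = (\<Union>\<pi>\<in>F ` P. idx \<pi>)"
    using M(3) idx unfolding partition_on_def by simp
  ultimately show ?R
    using M(2) by blast
next
  assume ?R
  then obtain S where S: "finite S" "M = mset_set S" "\<And>\<pi>. \<pi> \<in> S \<Longrightarrow> indexed_ncp (idx \<pi>) \<pi>"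
    "\<And>\<pi> \<rho>. \<pi> \<in> S \<Longrightarrow> \<rho> \<in> S \<Longrightarrow> \<pi> \<noteq> \<rho> \<Longrightarrow> idx \<pi> \<inter> idx \<rho> = {}" "X = (\<Union>\<pi>\<in>S. idx \<pi>)"
    by blast
  have ne: "idx \<pi> \<noteq> {}" if "\<pi> \<in> S" for \<pi>
    using indexed_ncpD(2)[OF S(3)[OF that]] .
  have inj: "inj_on idx S"
    using S(4) ne by (metis inj_onI inf.idem)
  have "M = image_mset (inv_into S idx) (mset_set (idx ` S))"
  proof -
    have "image_mset (\<lambda>\<pi>. inv_into S idx (idx \<pi>)) (mset_set S) = image_mset (\<lambda>\<pi>. \<pi>) (mset_set S)"
      by (rule image_mset_cong) (use inj S(1) in simp)
    then show ?thesis
      unfolding S(2) image_mset_mset_set[OF inj, symmetric]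
      by (simp add: image_mset.compositionality comp_def)
  qed
  moreover have "partition_on X (idx ` S)"
    unfolding partition_on_def disjoint_def using S(4,5) ne by (auto; metis)
  moreover have "\<forall>Y\<in>idx ` S. indexed_ncp Y (inv_into S idx Y)"
    using inj S(3) by simp
  ultimately show "M \<in> monoms X"
    unfolding monoms_def using S(1) by blast
qed

lemma monomsD:
  assumes "M \<in> monoms X"
  shows "finite X" "\<And>\<pi>. \<pi> \<in># M \<Longrightarrow> indexed_ncp (idx \<pi>) \<pi>" "X = (\<Union>\<pi>\<in>set_mset M. idx \<pi>)"
    "\<And>\<pi> \<rho> x. \<pi> \<in># M \<Longrightarrow> \<rho> \<in># M \<Longrightarrow> x \<in> idx \<pi> \<Longrightarrow> x \<in> idx \<rho> \<Longrightarrow> \<pi> = \<rho>"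
    "M = mset_set (set_mset M)" "\<And>\<pi>. \<pi> \<in># M \<Longrightarrow> idx \<pi> \<subseteq> X"
proof -
  obtain S where S: "finite S" "M = mset_set S" "\<And>\<pi>. \<pi> \<in> S \<Longrightarrow> indexed_ncp (idx \<pi>) \<pi>"
    "\<And>\<pi> \<rho>. \<pi> \<in> S \<Longrightarrow> \<rho> \<in> S \<Longrightarrow> \<pi> \<noteq> \<rho> \<Longrightarrow> idx \<pi> \<inter> idx \<rho> = {}" "X = (\<Union>\<pi>\<in>S. idx \<pi>)"
    using assms unfolding monoms_iff by blast
  show "finite X"
    using S(1,3,5) indexed_ncpD(1) by blast
  show "indexed_ncp (idx \<pi>) \<pi>" if "\<pi> \<in># M" for \<pi>
    using S that by simp
  show "X = (\<Union>\<pi>\<in>set_mset M. idx \<pi>)"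
    using S by simp
  show "\<pi> = \<rho>" if "\<pi> \<in># M" "\<rho> \<in># M" "x \<in> idx \<pi>" "x \<in> idx \<rho>" for \<pi> \<rho> x
    using S(1,2) S(4)[of \<pi> \<rho>] that by auto
  show "M = mset_set (set_mset M)"
    using S by simp
  show "idx \<pi> \<subseteq> X" if "\<pi> \<in># M" for \<pi>
    using S that by auto
qed

lemma monoms_empty: "{#} \<in> monoms {}"
  unfolding monoms_iff by (intro exI[of _ "{}"]) auto

lemma monoms_single: "indexed_ncp X \<pi> \<Longrightarrow> {#\<pi>#} \<in> monoms X"
  unfolding monoms_iff using indexed_ncpD(3)[of X \<pi>] by (intro exI[of _ "{\<pi>}"]) auto

lemma monoms_add:
  assumes M: "M \<in> monoms X" and N: "N \<in> monoms Y" and "X \<inter> Y = {}"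
  shows "M + N \<in> monoms (X \<union> Y)"
proof -
  note MD = monomsD[OF M] and ND = monomsD[OF N]
  have disj: "idx \<pi> \<inter> idx \<rho> = {}" if "\<pi> \<in># M" "\<rho> \<in># N" for \<pi> \<rho>
    using MD(6)[OF that(1)] ND(6)[OF that(2)] assms(3) by blast
  have "set_mset M \<inter> set_mset N = {}"
  proof (rule ccontr)
    assume "set_mset M \<inter> set_mset N \<noteq> {}"
    then obtain \<pi> where "\<pi> \<in># M" "\<pi> \<in># N"
      by blast
    then show False
      using disj[of \<pi> \<pi>] indexed_ncpD(2)[OF MD(2)] by auto
  qed
  then have "M + N = mset_set (set_mset M \<union> set_mset N)"
    using MD(5) ND(5) by (simp add: mset_set_Union)
  moreover have "idx \<pi> \<inter> idx \<rho> = {}"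
    if "\<pi> \<in> set_mset M \<union> set_mset N" "\<rho> \<in> set_mset M \<union> set_mset N" "\<pi> \<noteq> \<rho>" for \<pi> \<rho>
  proof (rule ccontr)
    assume "idx \<pi> \<inter> idx \<rho> \<noteq> {}"
    then obtain x where "x \<in> idx \<pi>" "x \<in> idx \<rho>"
      by blast
    with that disj[of \<pi> \<rho>] disj[of \<rho> \<pi>] MD(4)[of \<pi> \<rho> x] ND(4)[of \<pi> \<rho> x] show False
      by auto
  qed
  moreover have "X \<union> Y = (\<Union>\<pi>\<in>set_mset M \<union> set_mset N. idx \<pi>)"
    using MD(3) ND(3) by (simp add: UN_Un)
  ultimately show ?thesis
    unfolding monoms_iff using MD(2) ND(2) by (intro exI[of _ "set_mset M \<union> set_mset N"]) auto
qed

lemma monoms_sum: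
  assumes "finite I" "\<And>i. i \<in> I \<Longrightarrow> f i \<in> monoms (Z i)"
    "\<And>i j x. i \<in> I \<Longrightarrow> j \<in> I \<Longrightarrow> x \<in> Z i \<Longrightarrow> x \<in> Z j \<Longrightarrow> i = j"
  shows "(\<Sum>i\<in>I. f i) \<in> monoms (\<Union>i\<in>I. Z i)"
  using assms
proof (induction I rule: finite_induct)
  case empty
  then show ?case
    using monoms_empty by simp
next
  case (insert i I)
  have "Z i \<inter> (\<Union>j\<in>I. Z j) = {}"
  proof (rule ccontr)
    assume "Z i \<inter> (\<Union>j\<in>I. Z j) \<noteq> {}"
    then obtain j x where "j \<in> I" "x \<in> Z i" "x \<in> Z j"
      by blast
    then show False
      using insert.prems(2)[of i j x] insert.hyps(2) by auto
  qed
  moreover have "(\<Sum>i\<in>I. f i) \<in> monoms (\<Union>i\<in>I. Z i)"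
    by (rule insert.IH) (use insert.prems in blast)+
  ultimately have "f i + (\<Sum>i\<in>I. f i) \<in> monoms (Z i \<union> (\<Union>i\<in>I. Z i))"
    using insert.prems(1)[of i] by (intro monoms_add) auto
  then show ?case
    using insert.hyps by simp
qed

lemma sum_mset_monoms: "M \<in> monoms X \<Longrightarrow> (\<Sum>\<pi>\<in>#M. f \<pi>) = (\<Sum>\<pi>\<in>set_mset M. f \<pi>)"
  using monomsD(5)[of M X] by (metis sum_unfold_sum_mset)

lemma image_mset_sum: "image_mset g (\<Sum>i\<in>I. f i) = (\<Sum>i\<in>I. image_mset g (f i))"
  by (induction I rule: infinite_finite_induct) auto

lemma image_mset_sum_mset: "image_mset g (\<Sum>x\<in>#M. f x) = (\<Sum>x\<in>#M. image_mset g (f x))"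
  by (induction M) auto

lemma sum_mset_cong: "(\<And>x. x \<in># M \<Longrightarrow> f x = g x) \<Longrightarrow> (\<Sum>x\<in>#M. f x) = (\<Sum>x\<in>#M. g x)"
  by (metis (mono_tags, lifting) image_mset_cong)

lemma sum_mset_in_monoms:
  assumes M: "M \<in> monoms X" and f: "\<And>\<pi>. \<pi> \<in># M \<Longrightarrow> f \<pi> \<in> monoms (Z \<inter> idx \<pi>)"
  shows "(\<Sum>\<pi>\<in>#M. f \<pi>) \<in> monoms (Z \<inter> X)"
proof -
  have "(\<Sum>\<pi>\<in>#M. f \<pi>) \<in> monoms (\<Union>\<pi>\<in>set_mset M. Z \<inter> idx \<pi>)"
    unfolding sum_mset_monoms[OF M] by (rule monoms_sum) (use f monomsD(4)[OF M] in auto)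
  moreover have "(\<Union>\<pi>\<in>set_mset M. Z \<inter> idx \<pi>) = Z \<inter> X"
    using monomsD(3)[OF M] by blast
  ultimately show ?thesis
    by simp
qed

subsection \<open>Extraction from one family\<close>

lemma finite_quotient_equiv: "equiv X r \<Longrightarrow> finite X \<Longrightarrow> finite (X // r)"
  by (simp add: quotient_def)

lemma quotient_class:
  assumes "equiv X r" "C \<in> X // r" "x \<in> C"
  shows "C = r `` {x}" "x \<in> X" "C \<subseteq> X" "\<And>y. (x, y) \<in> r \<longleftrightarrow> y \<in> C"
proof -
  obtain z where z: "z \<in> X" "C = r `` {z}"
    using assms(2) by (auto elim: quotientE)
  show C: "C = r `` {x}"
    using equiv_class_eq[OF assms(1), of z x] z assms(3) by auto
  show "x \<in> X" "C \<subseteq> X"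
    using z assms(3) equiv_mem[OF assms(1)] by auto
  show "(x, y) \<in> r \<longleftrightarrow> y \<in> C" for y
    unfolding C by simp
qed

lemma quotient_nonempty: "equiv X r \<Longrightarrow> C \<in> X // r \<Longrightarrow> C \<noteq> {}"
  by (auto elim!: quotientE dest: equiv_refl)

lemma extract_monom_eq: "equiv X r \<Longrightarrow> extract_monom X r \<pi> = (\<Sum>C\<in>X // r. {#restr \<pi> C#})"
  unfolding extract_monom_def restr_monom_def by (rule sum.cong) (auto dest: quotient_nonempty)

lemma extract_monom_in_monoms:
  assumes "indexed_ncp X \<pi>" "equiv X r"
  shows "extract_monom X r \<pi> \<in> monoms X"
proof -
  have "(\<Sum>C\<in>X // r. {#restr \<pi> C#}) \<in> monoms (\<Union>C\<in>X // r. C)"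
  proof (rule monoms_sum)
    show "finite (X // r)"
      using assms indexed_ncpD(1) finite_quotient_equiv by blast
    show "{#restr \<pi> C#} \<in> monoms C" if "C \<in> X // r" for C
      using that quotient_nonempty[OF assms(2) that] quotient_class(3)[OF assms(2) that]
      by (intro monoms_single indexed_ncp_restr[OF assms(1)]) auto
    show "C = D" if "C \<in> X // r" "D \<in> X // r" "x \<in> C" "x \<in> D" for C D x
      using quotient_class(1)[OF assms(2)] that by metis
  qed
  moreover have "(\<Union>C\<in>X // r. C) = X"
    using Union_quotient[OF assms(2)] by simp
  ultimately show ?thesis
    by (simp add: extract_monom_eq[OF assms(2)])
qed

lemma extract_monom_restr:
  assumes "equiv C r" "finite (\<Union>x\<in>C. \<pi> x)"
  shows "extract_monom C r (restr \<pi> C) = extract_monom C r \<pi>"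
  unfolding extract_monom_eq[OF assms(1)]
proof (rule sum.cong)
  fix D assume "D \<in> C // r"
  then have "D \<subseteq> C"
    using quotient_class(3)[OF assms(1)] quotient_nonempty[OF assms(1)] by blast
  then show "{#restr (restr \<pi> C) D#} = {#restr \<pi> D#}"
    using restr_restr[OF assms(2)] by simp
qed simp

lemma quotient_Restr:
  "(\<And>x y. x \<in> C \<Longrightarrow> (x, y) \<in> r \<Longrightarrow> y \<in> C) \<Longrightarrow> C // Restr r C = (\<lambda>x. r `` {x}) ` C"
  by (auto simp: quotient_def intro!: image_eqI)

text \<open>
  If \<open>r\<close> never leaves the parts of a partition of \<open>X\<close>, its classes are those inside the parts.
  A part may be empty; it contributes the empty monomial.
\<close>
lemma extract_monom_partition:
  assumes r: "equiv X r" "finite X" and P: "X = \<Union>P" "disjoint P"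
    and sat: "\<And>C x y. C \<in> P \<Longrightarrow> x \<in> C \<Longrightarrow> (x, y) \<in> r \<Longrightarrow> y \<in> C"
  shows "extract_monom X r \<pi> = (\<Sum>C\<in>P. extract_monom C (Restr r C) \<pi>)"
proof -
  have fin: "finite P"
    using P(1) r(2) by (simp add: finite_UnionD)
  have CX: "C \<subseteq> X" if "C \<in> P" for C
    using P(1) that by blast
  have Q: "C // Restr r C = (\<lambda>x. r `` {x}) ` C" if "C \<in> P" for C
    by (rule quotient_Restr) (use sat that in blast)
  have "X // r = (\<lambda>x. r `` {x}) ` X"
    by (auto simp: quotient_def)
  also have "\<dots> = (\<Union>C\<in>P. C // Restr r C)"
    using Q P(1) by auto
  finally have X: "X // r = (\<Union>C\<in>P. C // Restr r C)" .
  have "(C // Restr r C) \<inter> (D // Restr r D) = {}" if CD: "C \<in> P" "D \<in> P" "C \<noteq> D" for C D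
  proof (rule ccontr)
    assume "(C // Restr r C) \<inter> (D // Restr r D) \<noteq> {}"
    then obtain x y where "x \<in> C" "y \<in> D" "r `` {x} = r `` {y}"
      using Q CD by auto
    moreover from this have "(x, y) \<in> r"
      using CX CD equiv_refl[OF r(1)] by blast
    ultimately show False
      using sat[OF CD(1)] CD P(2) unfolding disjoint_def by blast
  qed
  moreover have "finite (C // Restr r C)" if "C \<in> P" for C
    using Q[OF that] finite_subset[OF CX[OF that] r(2)] by simp
  ultimately have "(\<Sum>D\<in>X // r. restr_monom \<pi> D) = (\<Sum>C\<in>P. \<Sum>D\<in>C // Restr r C. restr_monom \<pi> D)"
    unfolding X using fin by (intro sum.UNION_disjoint) auto
  then show ?thesis
    by (simp add: extract_monom_def)
qed

text \<open>
  The classes of the equivalence induced on \<open>X/r'\<close> are the images of the classes of \<open>r\<close>, and on each of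
  them extraction commutes with contraction.
\<close>
lemma extract_contract:
  assumes \<pi>: "indexed_ncp X \<pi>" and r: "equiv X r" "equiv X r'" "r' \<subseteq> r"
  shows "extract_monom (quot X r') (induced_rel r' r) (contract X r' \<pi>) =
    (\<Sum>C\<in>X // r. {#contract C (Restr r' C) (restr \<pi> C)#})"
proof -
  note fin = indexed_ncpD(1)[OF \<pi>]
  note ind = equiv_induced_rel[OF r(1,2) fin r(3)]
  have quo: "quot X r' // induced_rel r' r = (\<lambda>C. class_label r' ` C) ` (X // r)"
  proof -
    have "quot X r' // induced_rel r' r = (\<lambda>x. induced_rel r' r `` {class_label r' x}) ` X"
      by (auto simp: quotient_def quot_eq)
    also have "\<dots> = (\<lambda>x. class_label r' ` (r `` {x})) ` X"
      by (rule image_cong) (use class_induced_rel[OF r(1,2) fin r(3)] in auto)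
    finally show ?thesis
      by (auto simp: quotient_def)
  qed
  have sat: "y \<in> C" if "C \<in> X // r" "x \<in> C" "(x, y) \<in> r'" for C x y
    using quotient_class(4)[OF r(1) that(1,2)] that(3) r(3) by blast
  have sub: "C \<subseteq> X" if "C \<in> X // r" for C
    using quotient_class(3)[OF r(1) that] by blast
  have inj: "inj_on (\<lambda>C. class_label r' ` C) (X // r)"
  proof (rule inj_onI)
    fix C D assume CD: "C \<in> X // r" "D \<in> X // r" "class_label r' ` C = class_label r' ` D"
    obtain x where x: "x \<in> C"
      using quotient_nonempty[OF r(1) CD(1)] by blast
    with CD(3) obtain y where y: "y \<in> D" "class_label r' x = class_label r' y"
      by blast
    have "x \<in> X" "y \<in> X"
      using x y sub CD by blast+
    then have "(x, y) \<in> r'"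
      using y class_label_eq_iff[OF r(2) fin] by simp
    then have "y \<in> C"
      using sat CD(1) x by blast
    then show "C = D"
      using quotient_class(1)[OF r(1) CD(1)] quotient_class(1)[OF r(1) CD(2) y(1)] by simp
  qed
  show ?thesis
    unfolding extract_monom_eq[OF ind] quo sum.reindex[OF inj]
    by (rule sum.cong) (use contract_restr[OF r(2) fin] sat sub in auto)
qed

lemma extract_relabel:
  assumes r: "equiv X r" "finite X" "inj_on f X" and "idx \<pi> \<subseteq> X"
  shows "extract_monom (f ` X) (map_prod f f ` r) (relabel f \<pi>) =
    image_mset (relabel f) (extract_monom X r \<pi>)"
proof -
  have quo: "(f ` X) // (map_prod f f ` r) = (\<lambda>C. f ` C) ` (X // r)"
  proof -
    have "(f ` X) // (map_prod f f ` r) = (\<lambda>x. (map_prod f f ` r) `` {f x}) ` X"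
      by (auto simp: quotient_def)
    also have "\<dots> = (\<lambda>x. f ` (r `` {x})) ` X"
      by (rule image_cong) (use Image_map_prod[OF r(1,3)] in auto)
    finally show ?thesis
      by (auto simp: quotient_def)
  qed
  have sub: "C \<subseteq> X" if "C \<in> X // r" for C
    using quotient_class(3)[OF r(1) that] by blast
  then have inj: "inj_on (\<lambda>C. f ` C) (X // r)"
    using r(3) by (metis inj_on_image_eq_iff inj_onI)
  show ?thesis
    unfolding extract_monom_eq[OF r(1)] extract_monom_eq[OF equiv_map_prod[OF r(1,3)]] quo
      sum.reindex[OF inj] image_mset_sum
    by (rule sum.cong) (use restr_relabel[OF r(3) assms(4)] sub in auto)
qed

section \<open>The coproduct on monomials\<close>

text \<open>
  From here on \<open>r\<close> is an equivalence on all labels of a monomial, and \<open>Restr r (idx \<pi>)\<close> is what a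
  factor \<open>\<pi>\<close> sees of it.
\<close>

abbreviation contract_factor ::
  "('a label \<times> 'a label) set \<Rightarrow> 'a label family \<Rightarrow> 'a label family" where
  "contract_factor r \<pi> \<equiv> contract (idx \<pi>) (Restr r (idx \<pi>)) \<pi>"

abbreviation extract_factor ::
  "('a label \<times> 'a label) set \<Rightarrow> 'a label family \<Rightarrow> 'a label monom" where
  "extract_factor r \<pi> \<equiv> extract_monom (idx \<pi>) (Restr r (idx \<pi>)) \<pi>"

definition splits :: "('x \<times> 'x) set \<Rightarrow> 'x monom \<Rightarrow> bool" where
  "splits r M \<longleftrightarrow> (\<forall>x y. (x, y) \<in> r \<longrightarrow> (\<exists>\<pi>\<in>#M. x \<in> idx \<pi> \<and> y \<in> idx \<pi>))"

lemma splitsI: "(\<And>x y. (x, y) \<in> r \<Longrightarrow> \<exists>\<pi>\<in>#M. x \<in> idx \<pi> \<and> y \<in> idx \<pi>) \<Longrightarrow> splits r M"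
  by (auto simp: splits_def)

lemma splitsE:
  assumes "splits r M" "(x, y) \<in> r"
  obtains \<pi> where "\<pi> \<in># M" "x \<in> idx \<pi>" "y \<in> idx \<pi>"
  using assms by (auto simp: splits_def)

definition contractible :: "('a label \<times> 'a label) set \<Rightarrow> 'a label monom \<Rightarrow> bool" where
  "contractible r M \<longleftrightarrow> splits r M \<and> (\<forall>\<pi>\<in>#M. Restr r (idx \<pi>) \<in> Ec (idx \<pi>) \<pi>)"

definition contract_all :: "('a label \<times> 'a label) set \<Rightarrow> 'a label monom \<Rightarrow> 'a label monom" where
  "contract_all r M = image_mset (\<lambda>\<pi>. contract_factor r \<pi>) M"

definition extract_all :: "('a label \<times> 'a label) set \<Rightarrow> 'a label monom \<Rightarrow> 'a label monom" where
  "extract_all r M = (\<Sum>\<pi>\<in>#M. extract_factor r \<pi>)"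

lemma prod_mset_if_basis:
  "(\<Prod>x\<in>#M. if P x then basis (f x) else 0) =
    (if \<forall>x\<in>#M. P x then basis (\<Sum>x\<in>#M. f x) else (0 :: 'b::comm_monoid_add \<Rightarrow>\<^sub>0 'k::field_char_0))"
  by (induction M) (auto simp: mult_single)

lemma sum_mset_Pair: "(\<Sum>x\<in>#M. (f x, g x)) = (\<Sum>x\<in>#M. f x, \<Sum>x\<in>#M. g x)"
  by (induction M) (auto simp: zero_prod_def)

lemma delta_monom_eq:
  "delta_monom r M = (if contractible r M then basis (contract_all r M, extract_all r M)
    else (0 :: ('a label, 'k::field_char_0) alg2))"
proof -
  have "r = (\<Union>\<pi>\<in>set_mset M. Restr r (idx \<pi>)) \<longleftrightarrow> splits r M"
    by (auto simp: splits_def)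
  then show ?thesis
    unfolding delta_monom_def delta_ncp_def prod_mset_if_basis sum_mset_Pair contractible_def
      contract_all_def extract_all_def
    by simp
qed

lemma contract_all_add: "contract_all r (M + N) = contract_all r M + contract_all r N"
  and extract_all_add: "extract_all r (M + N) = extract_all r M + extract_all r N"
  by (simp_all add: contract_all_def extract_all_def)

lemma contract_all_empty [simp]: "contract_all r {#} = {#}"
  and extract_all_empty [simp]: "extract_all r {#} = {#}"
  by (simp_all add: contract_all_def extract_all_def)

lemma contract_all_sum: "contract_all r (\<Sum>i\<in>I. f i) = (\<Sum>i\<in>I. contract_all r (f i))"
  by (simp add: contract_all_def image_mset_sum)

lemma contract_all_sum_mset: "contract_all r (\<Sum>i\<in>#I. f i) = (\<Sum>i\<in>#I. contract_all r (f i))"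
  by (simp add: contract_all_def image_mset_sum_mset)

lemma extract_all_sum: "extract_all r (\<Sum>i\<in>I. f i) = (\<Sum>i\<in>I. extract_all r (f i))"
  by (induction I rule: infinite_finite_induct) (auto simp: extract_all_add)

lemma extract_all_sum_mset: "extract_all r (\<Sum>i\<in>#I. f i) = (\<Sum>i\<in>#I. extract_all r (f i))"
  by (induction I) (auto simp: extract_all_add)

text \<open>
  The noncrossing condition may be tested with \<open>r\<close> itself, as only pairs of labels of \<open>\<pi>\<close> matter.
\<close>
lemma contractible_iff:
  assumes M: "M \<in> monoms X" and r: "equiv X r"
  shows "contractible r M \<longleftrightarrow> splits r M \<and> (\<forall>\<pi>\<in>#M. noncrossing_wrt \<pi> r)"
proof -
  have "Restr r (idx \<pi>) \<in> Ec (idx \<pi>) \<pi> \<longleftrightarrow> noncrossing_wrt \<pi> r" if "\<pi> \<in># M" for \<pi>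
    using Ec_iff[OF monomsD(2)[OF M that]] equiv_Int[OF r monomsD(6)[OF M that]]
      noncrossing_wrt_Int_iff[of \<pi> "idx \<pi>" r] by simp
  then show ?thesis
    unfolding contractible_def by simp
qed

text \<open>
  When \<open>r\<close> splits along the factors, the labels of a factor form a union of classes; so classes of
  \<open>r\<close> and of its restriction to a factor have the same label.
\<close>
lemma splits_closed:
  assumes M: "M \<in> monoms X" and "splits r M"
    and "\<pi> \<in># M" "x \<in> idx \<pi>" "(x, y) \<in> r"
  shows "y \<in> idx \<pi>"
proof -
  obtain \<rho> where "\<rho> \<in># M" "x \<in> idx \<rho>" "y \<in> idx \<rho>"
    using assms(2,5) by (rule splitsE)
  then show ?thesis
    using monomsD(4)[OF M assms(3) _ assms(4), of \<rho>] by simp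
qed

lemma equiv_Restr_idx:
  assumes "M \<in> monoms X" "equiv X r" "\<pi> \<in># M"
  shows "equiv (idx \<pi>) (Restr r (idx \<pi>))"
  using equiv_Int[OF assms(2) monomsD(6)[OF assms(1,3)]] .

lemma class_label_Restr:
  assumes "M \<in> monoms X" "splits r M" "\<pi> \<in># M" "x \<in> idx \<pi>"
  shows "class_label (Restr r (idx \<pi>)) x = class_label r x"
  by (rule class_label_Int[OF _ assms(4)]) (rule splits_closed[OF assms(1-3)])

lemma quot_Restr:
  assumes "M \<in> monoms X" "splits r M" "\<pi> \<in># M"
  shows "quot (idx \<pi>) (Restr r (idx \<pi>)) = class_label r ` idx \<pi>"
  unfolding quot_eq by (rule image_cong[OF refl]) (rule class_label_Restr[OF assms])

lemma idx_contract_Restr: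
  assumes "M \<in> monoms X" "equiv X r" "\<pi> \<in># M"
  shows "idx (contract_factor r \<pi>) = quot (idx \<pi>) (Restr r (idx \<pi>))"
  by (rule idx_contract) (use equiv_Int[OF assms(2)] monomsD(6)[OF assms(1,3)] in auto)

lemma class_label_mem_iff:
  assumes M: "M \<in> monoms X" and r: "equiv X r" and "splits r M" "\<pi> \<in># M" "x \<in> X"
  shows "class_label r x \<in> class_label r ` idx \<pi> \<longleftrightarrow> x \<in> idx \<pi>"
proof
  assume "class_label r x \<in> class_label r ` idx \<pi>"
  then obtain y where y: "y \<in> idx \<pi>" "class_label r y = class_label r x"
    by auto
  then have "(y, x) \<in> r"
    using class_label_eq_iff[OF r monomsD(1)[OF M], of y x] monomsD(6)[OF M assms(4)] assms(5) by blast
  then show "x \<in> idx \<pi>"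
    using splits_closed[OF M assms(3,4) y(1)] by simp
qed simp

lemma contract_all_in_monoms:
  assumes M: "M \<in> monoms X" and r: "equiv X r" and c: "contractible r M"
  shows "contract_all r M \<in> monoms (quot X r)"
proof -
  note MD = monomsD[OF M]
  have sp: "splits r M"
    using c by (simp add: contractible_def)
  have eq: "contract_all r M = (\<Sum>\<pi>\<in>set_mset M. {#contract_factor r \<pi>#})"
    unfolding contract_all_def using sum_mset_monoms[OF M, of "\<lambda>\<pi>. {#contract_factor r \<pi>#}"]
    by simp
  have "contract_all r M \<in> monoms (\<Union>\<pi>\<in>set_mset M. class_label r ` idx \<pi>)"
    unfolding eq
  proof (rule monoms_sum)
    show "{#contract_factor r \<pi>#} \<in> monoms (class_label r ` idx \<pi>)" if "\<pi> \<in># M" for \<pi>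
      using c that quot_Restr[OF M sp that] unfolding contractible_def Ec_def
      by (intro monoms_single) auto
    show "\<pi> = \<rho>" if "\<pi> \<in># M" "\<rho> \<in># M" "a \<in> class_label r ` idx \<pi>" "a \<in> class_label r ` idx \<rho>" for \<pi> \<rho> a
    proof -
      obtain x where x: "x \<in> idx \<rho>" "a = class_label r x"
        using \<open>a \<in> class_label r ` idx \<rho>\<close> by blast
      then have "x \<in> idx \<pi>"
        using class_label_mem_iff[OF M r sp that(1), of x] \<open>a \<in> class_label r ` idx \<pi>\<close>
          MD(6)[OF that(2)] by blast
      then show ?thesis
        using MD(4) that(1,2) x(1) by blast
    qed
  qed simp
  also have "(\<Union>\<pi>\<in>set_mset M. class_label r ` idx \<pi>) = quot X r"
    unfolding quot_eq by (subst MD(3)) blast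
  finally show ?thesis .
qed

lemma extract_all_in_monoms:
  assumes M: "M \<in> monoms X" and r: "equiv X r"
  shows "extract_all r M \<in> monoms X"
proof -
  have "extract_factor r \<pi> \<in> monoms (idx \<pi>)" if "\<pi> \<in># M" for \<pi>
    by (rule extract_monom_in_monoms[OF monomsD(2)[OF M that] equiv_Restr_idx[OF M r that]])
  then show ?thesis
    using sum_mset_in_monoms[OF M, of "extract_factor r" UNIV] by (simp add: extract_all_def)
qed

lemma extract_all_eq:
  assumes M: "M \<in> monoms X" and r: "equiv X r"
  shows "extract_all r M = (\<Sum>\<pi>\<in>#M. \<Sum>C\<in>idx \<pi> // Restr r (idx \<pi>). {#restr \<pi> C#})"
  unfolding extract_all_def
  by (rule sum_mset_cong) (use extract_monom_eq equiv_Int[OF r] monomsD(6)[OF M] in blast)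

lemma set_extract_all:
  assumes M: "M \<in> monoms X" and r: "equiv X r"
  shows "set_mset (extract_all r M) = {restr \<pi> C | \<pi> C. \<pi> \<in># M \<and> C \<in> idx \<pi> // Restr r (idx \<pi>)}"
proof -
  have "finite (idx \<pi> // Restr r (idx \<pi>))" if "\<pi> \<in># M" for \<pi>
    using monomsD(2)[OF M that] by (simp add: quotient_def indexed_ncpD(1))
  then show ?thesis
    unfolding extract_all_eq[OF assms] by (auto simp: set_mset_sum)
qed

lemma idx_restr_class:
  assumes M: "M \<in> monoms X" and r: "equiv X r" and "\<pi> \<in># M" "C \<in> idx \<pi> // Restr r (idx \<pi>)"
  shows "idx (restr \<pi> C) = C" "C \<subseteq> idx \<pi>"
proof -
  have eq: "equiv (idx \<pi>) (Restr r (idx \<pi>))"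
    using equiv_Int[OF r] monomsD(6)[OF M assms(3)] by blast
  show "C \<subseteq> idx \<pi>"
    using quotient_class(3)[OF eq assms(4)] quotient_nonempty[OF eq assms(4)] by blast
  then show "idx (restr \<pi> C) = C"
    by (auto simp: idx_restr)
qed

subsection \<open>Products\<close>

lemma splits_Restr:
  assumes N: "N \<in> monoms Y" and "X \<inter> Y = {}" "splits r (M + N)"
  shows "splits (Restr r X) M"
proof (rule splitsI)
  fix x y assume xy: "(x, y) \<in> Restr r X"
  then obtain \<pi> where \<pi>: "\<pi> \<in># M + N" "x \<in> idx \<pi>" "y \<in> idx \<pi>"
    using splitsE[OF assms(3), of x y] by auto
  then have "\<pi> \<notin># N"
    using monomsD(6)[OF N, of \<pi>] xy assms(2) by auto
  with \<pi> show "\<exists>\<pi>\<in>#M. x \<in> idx \<pi> \<and> y \<in> idx \<pi>"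
    by auto
qed

text \<open>
  The coproduct \<open>\<delta>\<close> of a product was defined factor by factor; the content is that the splitting
  condition for \<open>M + N\<close> is the one for \<open>X\<close> against \<open>Y\<close> together with those for \<open>M\<close> and for \<open>N\<close>.
\<close>
lemma delta_monom_add:
  assumes M: "M \<in> monoms X" and N: "N \<in> monoms Y" and "X \<inter> Y = {}" and r: "equiv (X \<union> Y) r"
  shows "delta_monom r (M + N) = (if r = Restr r X \<union> Restr r Y
    then delta_monom (Restr r X) M * delta_monom (Restr r Y) N
    else (0 :: ('a label, 'k::field_char_0) alg2))"
proof -
  have on: "Restr (Restr r X) (idx \<pi>) = Restr r (idx \<pi>)" if "\<pi> \<in># M" for \<pi>
    using monomsD(6)[OF M that] by auto
  have on': "Restr (Restr r Y) (idx \<pi>) = Restr r (idx \<pi>)" if "\<pi> \<in># N" for \<pi>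
    using monomsD(6)[OF N that] by auto
  have c: "contract_all (Restr r X) M = contract_all r M" "contract_all (Restr r Y) N = contract_all r N"
    unfolding contract_all_def by (auto intro!: image_mset_cong simp: on on')
  have e: "extract_all (Restr r X) M = extract_all r M" "extract_all (Restr r Y) N = extract_all r N"
    unfolding extract_all_def by (auto intro!: sum_mset_cong simp: on on')
  have "splits r (M + N) \<longleftrightarrow> r = Restr r X \<union> Restr r Y \<and> splits (Restr r X) M \<and> splits (Restr r Y) N"
    (is "?L \<longleftrightarrow> ?R1 \<and> ?R2 \<and> ?R3")
  proof
    assume L: ?L
    have "(x, y) \<in> Restr r X \<union> Restr r Y" if "(x, y) \<in> r" for x y
      using L that
    proof (rule splitsE)
      fix \<pi> assume "\<pi> \<in># M + N" "x \<in> idx \<pi>" "y \<in> idx \<pi>"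
      then show ?thesis
        using monomsD(6)[OF M, of \<pi>] monomsD(6)[OF N, of \<pi>] that by auto
    qed
    then have ?R1
      by auto
    moreover have ?R2 ?R3
      using splits_Restr[OF N _ L] splits_Restr[OF M _ L[unfolded add.commute[of M]]] assms(3) by blast+
    ultimately show "?R1 \<and> ?R2 \<and> ?R3"
      by (intro conjI)
  next
    assume R: "?R1 \<and> ?R2 \<and> ?R3"
    show ?L
    proof (rule splitsI)
      fix x y assume "(x, y) \<in> r"
      then consider "(x, y) \<in> Restr r X" | "(x, y) \<in> Restr r Y"
        using R by blast
      then show "\<exists>\<pi>\<in>#M + N. x \<in> idx \<pi> \<and> y \<in> idx \<pi>"
      proof cases
        case 1
        show ?thesis
          by (rule splitsE[OF _ 1, of M]) (use R in auto)
      next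
        case 2
        show ?thesis
          by (rule splitsE[OF _ 2, of N]) (use R in auto)
      qed
    qed
  qed
  moreover have "(\<forall>\<pi>\<in>#M + N. Restr r (idx \<pi>) \<in> Ec (idx \<pi>) \<pi>) \<longleftrightarrow>
      (\<forall>\<pi>\<in>#M. Restr (Restr r X) (idx \<pi>) \<in> Ec (idx \<pi>) \<pi>) \<and>
      (\<forall>\<pi>\<in>#N. Restr (Restr r Y) (idx \<pi>) \<in> Ec (idx \<pi>) \<pi>)"
    by (auto simp: on on')
  ultimately have "contractible r (M + N) \<longleftrightarrow> r = Restr r X \<union> Restr r Y \<and>
      contractible (Restr r X) M \<and> contractible (Restr r Y) N"
    unfolding contractible_def by blast
  then show ?thesis
    unfolding delta_monom_eq by (auto simp: mult_single contract_all_add extract_all_add c e)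
qed

subsection \<open>Naturality\<close>

lemma delta_monom_relabel:
  assumes M: "M \<in> monoms X" and r: "equiv X r" and f: "inj_on f X"
  defines "s \<equiv> map_prod f f ` r"
  shows "contractible s (image_mset (relabel f) M) \<longleftrightarrow> contractible r M"
    and "contract_all s (image_mset (relabel f) M) = image_mset (relabel (quot_map f)) (contract_all r M)"
    and "extract_all s (image_mset (relabel f) M) = image_mset (relabel f) (extract_all r M)"
proof -
  note MD = monomsD[OF M]
  note I = in_map_prod_iff[OF f equiv_type[OF r]]
  have on: "Restr s (f ` Y) = map_prod f f ` Restr r Y" if "Y \<subseteq> X" for Y
  proof (intro set_eqI iffI)
    fix p assume "p \<in> Restr s (f ` Y)"
    then obtain x y where "p = (f x, f y)" "x \<in> Y" "y \<in> Y" "(f x, f y) \<in> s"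
      by auto
    then show "p \<in> map_prod f f ` Restr r Y"
      using I[of x y] that unfolding s_def by auto
  qed (auto simp: s_def)
  have eq: "equiv (idx \<pi>) (Restr r (idx \<pi>))" if "\<pi> \<in># M" for \<pi>
    using equiv_Int[OF r] MD(6) that by blast
  have inj: "inj_on f (idx \<pi>)" if "\<pi> \<in># M" for \<pi>
    using f MD(6) that by (meson inj_on_subset)
  have fin: "finite (idx \<pi>)" if "\<pi> \<in># M" for \<pi>
    using MD(2)[OF that] indexed_ncpD(1) by blast
  have Ec: "Restr s (f ` idx \<pi>) \<in> Ec (f ` idx \<pi>) (relabel f \<pi>) \<longleftrightarrow> Restr r (idx \<pi>) \<in> Ec (idx \<pi>) \<pi>"
    if "\<pi> \<in># M" for \<pi>
    using Ec_iff[OF MD(2)[OF that]] Ec_iff[OF indexed_ncp_relabel[OF MD(2)[OF that] inj[OF that]]]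
      on[OF MD(6)[OF that]] eq[OF that] equiv_map_prod[OF eq[OF that] inj[OF that]]
      noncrossing_wrt_relabel[OF inj[OF that], of \<pi> "Restr r (idx \<pi>)"] by auto
  have split: "(\<exists>\<pi>\<in>#M. f x \<in> f ` idx \<pi> \<and> f y \<in> f ` idx \<pi>) \<longleftrightarrow> (\<exists>\<pi>\<in>#M. x \<in> idx \<pi> \<and> y \<in> idx \<pi>)"
    if "(x, y) \<in> r" for x y
  proof -
    have "f x \<in> f ` idx \<pi> \<longleftrightarrow> x \<in> idx \<pi>" "f y \<in> f ` idx \<pi> \<longleftrightarrow> y \<in> idx \<pi>" if "\<pi> \<in># M" for \<pi>
      using inj_on_image_mem_iff[OF f _ MD(6)[OF that]] equiv_mem[OF r \<open>(x, y) \<in> r\<close>] by auto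
    then show ?thesis
      by auto
  qed
  show "contractible s (image_mset (relabel f) M) \<longleftrightarrow> contractible r M"
  proof -
    have "splits s (image_mset (relabel f) M) \<longleftrightarrow>
        (\<forall>x y. (x, y) \<in> r \<longrightarrow> (\<exists>\<pi>\<in>#M. f x \<in> f ` idx \<pi> \<and> f y \<in> f ` idx \<pi>))"
      unfolding splits_def s_def by (auto simp: idx_relabel; fastforce)
    also have "\<dots> \<longleftrightarrow> splits r M"
      unfolding splits_def using split by simp
    finally show ?thesis
      unfolding contractible_def using Ec by (simp add: idx_relabel)
  qed
  show "contract_all s (image_mset (relabel f) M) = image_mset (relabel (quot_map f)) (contract_all r M)"
    unfolding contract_all_def image_mset.compositionality comp_def idx_relabel
    by (rule image_mset_cong) (simp add: on MD(6) contract_relabel eq fin inj)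
  show "extract_all s (image_mset (relabel f) M) = image_mset (relabel f) (extract_all r M)"
    unfolding extract_all_def image_mset.compositionality comp_def idx_relabel image_mset_sum_mset
    by (rule sum_mset_cong) (simp add: on MD(6) extract_relabel eq fin inj)
qed

subsection \<open>Coassociativity\<close>

text \<open>
  If the classes of \<open>r\<close> do not cross, crossing classes of the finer \<open>r'\<close> lie in one class \<open>C\<close> of \<open>r\<close>.
  So noncrossing of \<open>\<pi>/r'\<close> can be tested on the extracted pieces; this is the heart of
  coassociativity.
\<close>
lemma noncrossing_wrt_classes:
  assumes \<pi>: "indexed_ncp X \<pi>" and r: "equiv X r" "noncrossing_wrt \<pi> r" "r' \<subseteq> r"
  shows "noncrossing_wrt \<pi> r' \<longleftrightarrow> (\<forall>C\<in>X // r. noncrossing_wrt (restr \<pi> C) r')"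
proof -
  have *: "noncrossing_wrt (restr \<pi> C) r' \<longleftrightarrow> noncrossing_wrt \<pi> (Restr r' C)" if "C \<in> X // r" for C
  proof -
    have "noncrossing_wrt (restr \<pi> C) r' \<longleftrightarrow> noncrossing_wrt (restr \<pi> C) (Restr r' C)"
      by (rule noncrossing_wrt_Int_iff[symmetric]) (simp add: idx_restr)
    also have "\<dots> \<longleftrightarrow> noncrossing_wrt \<pi> (Restr r' C)"
      by (rule noncrossing_wrt_restr[OF indexed_ncpD(6)[OF \<pi>]]) auto
    finally show ?thesis .
  qed
  show ?thesis
  proof
    assume "noncrossing_wrt \<pi> r'"
    then show "\<forall>C\<in>X // r. noncrossing_wrt (restr \<pi> C) r'"
      using * noncrossing_wrt_Int by blast
  next
    assume C: "\<forall>C\<in>X // r. noncrossing_wrt (restr \<pi> C) r'"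
    show "noncrossing_wrt \<pi> r'"
    proof (rule noncrossing_wrtI)
      fix x y z t i j k l
      assume a: "(x, z) \<in> r'" "(y, t) \<in> r'" "i \<in> \<pi> x" "j \<in> \<pi> y" "k \<in> \<pi> z" "l \<in> \<pi> t"
        "i < j" "j < k" "k < l"
      have xr: "(x, z) \<in> r" "(y, t) \<in> r"
        using a(1,2) r(3) by auto
      \<comment> \<open>The crossing pairs would cross in the coarser contraction, so all four labels are related by r.\<close>
      have xy: "(x, y) \<in> r"
        by (rule noncrossing_wrtD[OF r(2) xr a(3-9)])
      have x: "x \<in> X"
        using equiv_mem[OF r(1) xy] by simp
      have "noncrossing_wrt \<pi> (Restr r' (r `` {x}))"
        using C * quotientI[OF x, of r] by blast
      moreover have "(x, z) \<in> Restr r' (r `` {x})" "(y, t) \<in> Restr r' (r `` {x})"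
        using a(1,2) xr xy equiv_refl[OF r(1) x] equiv_transD[OF r(1) xy xr(2)] by auto
      ultimately have "(x, y) \<in> Restr r' (r `` {x})"
        using a(3-9) by (rule noncrossing_wrtD)
      then show "(x, y) \<in> r'"
        by blast
    qed
  qed
qed

context
  fixes M :: "'a label monom" and X r r'
  assumes M: "M \<in> monoms X" and r: "equiv X r" "equiv X r'" "r' \<subseteq> r"
begin

lemma idx_contract_finer:
  assumes "splits r' M" "\<pi> \<in># M"
  shows "idx (contract_factor r' \<pi>) = class_label r' ` idx \<pi>"
  using idx_contract_Restr[OF M r(2) assms(2)] quot_Restr[OF M assms] by simp

text \<open>
  A factor contracted by \<open>r'\<close> carries exactly the classes of its own labels, so relations between
  classes descend to relations between labels of the same factor.
\<close>
lemma splits_induced_iff: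
  assumes "splits r' M"
  shows "splits (induced_rel r' r) (contract_all r' M) \<longleftrightarrow> splits r M"
proof
  assume L: "splits (induced_rel r' r) (contract_all r' M)"
  show "splits r M"
  proof (rule splitsI)
    fix x y assume xy: "(x, y) \<in> r"
    note X = equiv_mem[OF r(1) xy]
    then have "(class_label r' x, class_label r' y) \<in> induced_rel r' r"
      using in_induced_rel[OF r(1,2) monomsD(1)[OF M] r(3)] xy by simp
    with L obtain \<rho> where "\<rho> \<in># contract_all r' M" "class_label r' x \<in> idx \<rho>" "class_label r' y \<in> idx \<rho>"
      by (rule splitsE)
    then obtain \<pi> where "\<pi> \<in># M" "class_label r' x \<in> class_label r' ` idx \<pi>"
      "class_label r' y \<in> class_label r' ` idx \<pi>"
      using idx_contract_finer[OF assms] by (auto simp: contract_all_def)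
    then show "\<exists>\<pi>\<in>#M. x \<in> idx \<pi> \<and> y \<in> idx \<pi>"
      using class_label_mem_iff[OF M r(2) assms] X by blast
  qed
next
  assume R: "splits r M"
  show "splits (induced_rel r' r) (contract_all r' M)"
  proof (rule splitsI)
    fix c d assume "(c, d) \<in> induced_rel r' r"
    then obtain x y where xy: "(x, y) \<in> r" "c = class_label r' x" "d = class_label r' y"
      using induced_rel_sub[OF r(1)] by blast
    obtain \<pi> where "\<pi> \<in># M" "x \<in> idx \<pi>" "y \<in> idx \<pi>"
      using R xy(1) by (rule splitsE)
    then show "\<exists>\<rho>\<in>#contract_all r' M. c \<in> idx \<rho> \<and> d \<in> idx \<rho>"
      using xy(2,3) idx_contract_finer[OF assms] by (auto simp: contract_all_def)
  qed
qed

lemma splits_finer: "splits r M \<Longrightarrow> splits r' M"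
  using r(3) by (auto simp: splits_def)

lemma Restr_induced_rel:
  assumes "splits r M" "\<pi> \<in># M"
  shows "Restr (induced_rel r' r) (class_label r' ` idx \<pi>) =
    induced_rel (Restr r' (idx \<pi>)) (Restr r (idx \<pi>))"
proof -
  note sp = splits_finer[OF assms(1)]
  have lab: "class_label (Restr r' (idx \<pi>)) x = class_label r' x" if "x \<in> idx \<pi>" for x
    by (rule class_label_Restr[OF M sp assms(2) that])
  show ?thesis
  proof (intro set_eqI iffI)
    fix p assume "p \<in> Restr (induced_rel r' r) (class_label r' ` idx \<pi>)"
    then obtain c d where cd: "p = (c, d)" "(c, d) \<in> induced_rel r' r"
      "c \<in> class_label r' ` idx \<pi>" "d \<in> class_label r' ` idx \<pi>"
      by (cases p) simp
    from induced_rel_sub[OF r(1) cd(2)] obtain x y where "(x, y) \<in> r" "c = class_label r' x"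
      "d = class_label r' y"
      by blast
    with cd have xy: "(x, y) \<in> r" "p = (class_label r' x, class_label r' y)"
      "class_label r' x \<in> class_label r' ` idx \<pi>" "class_label r' y \<in> class_label r' ` idx \<pi>"
      by simp_all
    then have "x \<in> idx \<pi>" "y \<in> idx \<pi>"
      using class_label_mem_iff[OF M r(2) sp assms(2)] equiv_mem[OF r(1) xy(1)] by blast+
    moreover from this have "p = (class_label (Restr r' (idx \<pi>)) x, class_label (Restr r' (idx \<pi>)) y)"
      using xy(2) lab by simp
    ultimately show "p \<in> induced_rel (Restr r' (idx \<pi>)) (Restr r (idx \<pi>))"
      using xy(1) unfolding induced_rel_def class_label_def by blast
  next
    fix p assume "p \<in> induced_rel (Restr r' (idx \<pi>)) (Restr r (idx \<pi>))"
    then obtain x y where xy: "(x, y) \<in> r" "x \<in> idx \<pi>" "y \<in> idx \<pi>"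
      "p = (class_label (Restr r' (idx \<pi>)) x, class_label (Restr r' (idx \<pi>)) y)"
      unfolding induced_rel_def class_label_def by blast
    then have p: "p = (class_label r' x, class_label r' y)"
      using lab by simp
    then have "p \<in> induced_rel r' r"
      using xy(1) unfolding induced_rel_def class_label_def by blast
    then show "p \<in> Restr (induced_rel r' r) (class_label r' ` idx \<pi>)"
      using p xy(2,3) by blast
  qed
qed

text \<open>
  Both sides of coassociativity are nonzero under the same condition: \<open>r\<close> splits along the factors and
  every factor is noncrossing with respect to both \<open>r\<close> and \<open>r'\<close>.
\<close>
lemma contractible_coassoc:
  "contractible r' M \<and> contractible (induced_rel r' r) (contract_all r' M) \<longleftrightarrow>
   contractible r M \<and> contractible r' (extract_all r M)" (is "?L \<longleftrightarrow> ?R")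
proof (cases "splits r M")
  case False
  have "\<not> ?L"
  proof
    assume L: ?L
    then have "splits r' M" "splits (induced_rel r' r) (contract_all r' M)"
      by (simp_all add: contractible_def)
    then show False
      using False splits_induced_iff by simp
  qed
  then show ?thesis
    using False by (auto simp: contractible_def)
next
  case sp: True
  note sp' = splits_finer[OF sp]
  note eq = r(1,2)[THEN equiv_Restr_idx[OF M]]
  have c: "contractible r M \<longleftrightarrow> (\<forall>\<pi>\<in>#M. noncrossing_wrt \<pi> r)"
    "contractible r' M \<longleftrightarrow> (\<forall>\<pi>\<in>#M. noncrossing_wrt \<pi> r')"
    using contractible_iff[OF M] r sp sp' by simp_all
  have ind: "contractible (induced_rel r' r) (contract_all r' M) \<longleftrightarrow> (\<forall>\<pi>\<in>#M. noncrossing_wrt \<pi> r)"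
    if "contractible r' M"
  proof -
    have "noncrossing_wrt (contract_factor r' \<pi>) (induced_rel r' r) \<longleftrightarrow> noncrossing_wrt \<pi> r"
      if "\<pi> \<in># M" for \<pi>
    proof (rule noncrossing_wrt_contract[OF eq(2)[OF that]])
      fix x y assume xy: "x \<in> idx \<pi>" "y \<in> idx \<pi>"
      then have "x \<in> X" "y \<in> X"
        using monomsD(6)[OF M that] by blast+
      moreover have "class_label (Restr r' (idx \<pi>)) x = class_label r' x"
        "class_label (Restr r' (idx \<pi>)) y = class_label r' y"
        using class_label_Restr[OF M sp' that] xy by simp_all
      ultimately show "(class_label (Restr r' (idx \<pi>)) x, class_label (Restr r' (idx \<pi>)) y)
          \<in> induced_rel r' r \<longleftrightarrow> (x, y) \<in> r"
        using in_induced_rel[OF r(1,2) monomsD(1)[OF M] r(3)] by simp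
    qed simp
    then show ?thesis
      using contractible_iff[OF contract_all_in_monoms[OF M r(2) that]
          equiv_induced_rel[OF r(1,2) monomsD(1)[OF M] r(3)]] splits_induced_iff[OF sp'] sp
      by (simp add: contract_all_def)
  qed
  have ext: "contractible r' (extract_all r M) \<longleftrightarrow> (\<forall>\<pi>\<in>#M. noncrossing_wrt \<pi> r')"
    if nc: "\<And>\<pi>. \<pi> \<in># M \<Longrightarrow> noncrossing_wrt \<pi> r"
  proof -
    have "splits r' (extract_all r M)"
    proof (rule splitsI)
      fix x y assume xy: "(x, y) \<in> r'"
      obtain \<pi> where \<pi>: "\<pi> \<in># M" "x \<in> idx \<pi>" "y \<in> idx \<pi>"
        using sp' xy by (rule splitsE)
      define C where "C = Restr r (idx \<pi>) `` {x}"
      have C: "C \<in> idx \<pi> // Restr r (idx \<pi>)"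
        unfolding C_def by (rule quotientI[OF \<pi>(2)])
      have "x \<in> C" "y \<in> C"
        using \<pi> xy r(3) equiv_refl[OF eq(1)[OF \<pi>(1)] \<pi>(2)] unfolding C_def by auto
      then show "\<exists>\<rho>\<in>#extract_all r M. x \<in> idx \<rho> \<and> y \<in> idx \<rho>"
        using set_extract_all[OF M r(1)] C \<pi>(1) idx_restr_class(1)[OF M r(1) \<pi>(1) C]
        by (intro bexI[of _ "restr \<pi> C"]) auto
    qed
    then have "contractible r' (extract_all r M) \<longleftrightarrow>
        (\<forall>\<pi>\<in>#M. \<forall>C\<in>idx \<pi> // Restr r (idx \<pi>). noncrossing_wrt (restr \<pi> C) r')"
      using contractible_iff[OF extract_all_in_monoms[OF M r(1)] r(2)] set_extract_all[OF M r(1)]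
      by auto
    also have "\<dots> \<longleftrightarrow> (\<forall>\<pi>\<in>#M. noncrossing_wrt \<pi> r')"
    proof (rule ball_cong[OF refl])
      fix \<pi> assume \<pi>: "\<pi> \<in># M"
      have "noncrossing_wrt (restr \<pi> C) r' \<longleftrightarrow> noncrossing_wrt (restr \<pi> C) (Restr r' (idx \<pi>))"
        for C
        by (rule noncrossing_wrt_Int_iff[symmetric]) (simp add: idx_restr)
      moreover have "noncrossing_wrt \<pi> r' \<longleftrightarrow> noncrossing_wrt \<pi> (Restr r' (idx \<pi>))"
        by (rule noncrossing_wrt_Int_iff[symmetric]) simp
      moreover have "noncrossing_wrt \<pi> (Restr r (idx \<pi>))"
        by (rule noncrossing_wrt_Int[OF nc[OF \<pi>]])
      ultimately show "(\<forall>C\<in>idx \<pi> // Restr r (idx \<pi>). noncrossing_wrt (restr \<pi> C) r') \<longleftrightarrow> noncrossing_wrt \<pi> r'"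
        using noncrossing_wrt_classes[OF monomsD(2)[OF M \<pi>] eq(1)[OF \<pi>], of "Restr r' (idx \<pi>)"] r(3)
        by auto
    qed
    finally show ?thesis .
  qed
  show ?thesis
    using c ind ext by blast
qed

text \<open>
  This and the next two lemmas compare the three tensor factors of the two sides of coassociativity.
\<close>
lemma contract_all_coassoc:
  assumes "splits r M"
  shows "image_mset (relabel flatten) (contract_all (induced_rel r' r) (contract_all r' M)) = contract_all r M"
  unfolding contract_all_def image_mset.compositionality comp_def
proof (rule image_mset_cong)
  fix \<pi> assume \<pi>: "\<pi> \<in># M"
  note sp' = splits_finer[OF assms]
  note eq = r(1,2)[THEN equiv_Restr_idx[OF M _ \<pi>]]
  have fin: "finite (idx \<pi>)"
    using indexed_ncpD(1)[OF monomsD(2)[OF M \<pi>]] .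
  have q: "class_label r' ` idx \<pi> = quot (idx \<pi>) (Restr r' (idx \<pi>))"
    using quot_Restr[OF M sp' \<pi>] by simp
  show "relabel flatten
      (contract (idx (contract_factor r' \<pi>))
        (Restr (induced_rel r' r) (idx (contract_factor r' \<pi>)))
        (contract_factor r' \<pi>)) =
      contract_factor r \<pi>"
    unfolding idx_contract_finer[OF sp' \<pi>] Restr_induced_rel[OF assms \<pi>] unfolding q
    by (rule relabel_flatten_contract_contract[OF eq fin]) (use r(3) in blast)
qed

lemma extract_contract_all:
  assumes "splits r M"
  shows "extract_all (induced_rel r' r) (contract_all r' M) = contract_all r' (extract_all r M)"
proof -
  have "extract_all (induced_rel r' r) (contract_all r' M) =
      (\<Sum>\<pi>\<in>#M. \<Sum>C\<in>idx \<pi> // Restr r (idx \<pi>). {#contract C (Restr r' C) (restr \<pi> C)#})"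
    unfolding extract_all_def contract_all_def image_mset.compositionality comp_def
  proof (rule sum_mset_cong)
    fix \<pi> assume \<pi>: "\<pi> \<in># M"
    note sp' = splits_finer[OF assms]
    note eq = r(1,2)[THEN equiv_Restr_idx[OF M _ \<pi>]]
    have q: "class_label r' ` idx \<pi> = quot (idx \<pi>) (Restr r' (idx \<pi>))"
      using quot_Restr[OF M sp' \<pi>] by simp
    have "extract_monom (quot (idx \<pi>) (Restr r' (idx \<pi>))) (induced_rel (Restr r' (idx \<pi>)) (Restr r (idx \<pi>)))
          (contract_factor r' \<pi>) =
        (\<Sum>C\<in>idx \<pi> // Restr r (idx \<pi>). {#contract C (Restr (Restr r' (idx \<pi>)) C) (restr \<pi> C)#})"
      by (rule extract_contract[OF monomsD(2)[OF M \<pi>] eq]) (use r(3) in blast)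
    also have "\<dots> = (\<Sum>C\<in>idx \<pi> // Restr r (idx \<pi>). {#contract C (Restr r' C) (restr \<pi> C)#})"
    proof (rule sum.cong[OF refl])
      fix C assume "C \<in> idx \<pi> // Restr r (idx \<pi>)"
      then have "Restr (Restr r' (idx \<pi>)) C = Restr r' C"
        using idx_restr_class(2)[OF M r(1) \<pi>] by blast
      then show "{#contract C (Restr (Restr r' (idx \<pi>)) C) (restr \<pi> C)#} =
          {#contract C (Restr r' C) (restr \<pi> C)#}"
        by simp
    qed
    finally show "extract_monom (idx (contract_factor r' \<pi>))
          (Restr (induced_rel r' r) (idx (contract_factor r' \<pi>)))
          (contract_factor r' \<pi>) =
        (\<Sum>C\<in>idx \<pi> // Restr r (idx \<pi>). {#contract C (Restr r' C) (restr \<pi> C)#})"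
      unfolding idx_contract_finer[OF sp' \<pi>] Restr_induced_rel[OF assms \<pi>] unfolding q .
  qed
  also have "\<dots> = contract_all r' (extract_all r M)"
    unfolding extract_all_eq[OF M r(1)] contract_all_sum_mset contract_all_sum
    by (intro sum_mset_cong sum.cong refl)
      (simp add: contract_all_def idx_restr_class(1)[OF M r(1)])
  finally show ?thesis .
qed

lemma extract_extract_all: "extract_all r' (extract_all r M) = extract_all r' M"
proof -
  have "extract_all r' (extract_all r M) =
      (\<Sum>\<pi>\<in>#M. \<Sum>C\<in>idx \<pi> // Restr r (idx \<pi>). extract_monom C (Restr r' C) (restr \<pi> C))"
    unfolding extract_all_eq[OF M r(1)] extract_all_sum_mset extract_all_sum
    by (intro sum_mset_cong sum.cong refl)
      (simp add: extract_all_def idx_restr_class(1)[OF M r(1)])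
  also have "\<dots> = extract_all r' M"
    unfolding extract_all_def
  proof (rule sum_mset_cong)
    fix \<pi> assume \<pi>: "\<pi> \<in># M"
    note \<pi>' = monomsD(2)[OF M \<pi>]
    note eq = r(1,2)[THEN equiv_Restr_idx[OF M _ \<pi>]]
    have "extract_factor r' \<pi> =
        (\<Sum>C\<in>idx \<pi> // Restr r (idx \<pi>). extract_monom C (Restr (Restr r' (idx \<pi>)) C) \<pi>)"
    proof (rule extract_monom_partition[OF eq(2) indexed_ncpD(1)[OF \<pi>']])
      show "idx \<pi> = \<Union> (idx \<pi> // Restr r (idx \<pi>))"
        using Union_quotient[OF eq(1)] by simp
      show "disjoint (idx \<pi> // Restr r (idx \<pi>))"
        unfolding disjoint_def using quotient_disj[OF eq(1)] by blast
      fix C x y assume "C \<in> idx \<pi> // Restr r (idx \<pi>)" "x \<in> C" "(x, y) \<in> Restr r' (idx \<pi>)"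
      then show "y \<in> C"
        using quotient_class(4)[OF eq(1)] r(3) by blast
    qed
    also have "\<dots> = (\<Sum>C\<in>idx \<pi> // Restr r (idx \<pi>). extract_monom C (Restr r' C) (restr \<pi> C))"
    proof (rule sum.cong[OF refl])
      fix C assume C: "C \<in> idx \<pi> // Restr r (idx \<pi>)"
      note CI = idx_restr_class(2)[OF M r(1) \<pi> C]
      have "Restr (Restr r' (idx \<pi>)) C = Restr r' C"
        using CI by blast
      moreover have "equiv C (Restr r' C)"
        by (rule equiv_Int[OF r(2)]) (use CI monomsD(6)[OF M \<pi>] in blast)
      ultimately show "extract_monom C (Restr (Restr r' (idx \<pi>)) C) \<pi> = extract_monom C (Restr r' C) (restr \<pi> C)"
        using extract_monom_restr[OF _ indexed_ncpD(6)[OF \<pi>']] by simp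
    qed
    finally show "(\<Sum>C\<in>idx \<pi> // Restr r (idx \<pi>). extract_monom C (Restr r' C) (restr \<pi> C)) =
        extract_factor r' \<pi>" ..
  qed
  finally show ?thesis .
qed

end

text \<open>
  The factors of an extracted monomial are indexed by classes of \<open>r\<close>, and \<open>r'\<close> can only split
  along them if it is finer than \<open>r\<close>.
\<close>
lemma contractible_extract_imp_finer:
  assumes M: "M \<in> monoms X" and r: "equiv X r" and "contractible r' (extract_all r M)"
  shows "r' \<subseteq> r"
proof (intro subrelI)
  fix x y assume xy: "(x, y) \<in> r'"
  have "splits r' (extract_all r M)"
    using assms(3) by (simp add: contractible_def)
  from this xy obtain \<rho> where "\<rho> \<in># extract_all r M" "x \<in> idx \<rho>" "y \<in> idx \<rho>"
    by (rule splitsE)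
  then obtain \<pi> C where *: "\<pi> \<in># M" "C \<in> idx \<pi> // Restr r (idx \<pi>)" "x \<in> C" "y \<in> C"
    using set_extract_all[OF M r] idx_restr_class(1)[OF M r] by auto
  then have "equiv (idx \<pi>) (Restr r (idx \<pi>))"
    using equiv_Int[OF r] monomsD(6)[OF M] by blast
  from quotient_class(4)[OF this *(2,3)] *(4) show "(x, y) \<in> r"
    by blast
qed

section \<open>Ideals\<close>

text \<open>
  A component of \<open>S\<close> is a maximal interval contained in \<open>S\<close>. Two elements of a finite \<open>S\<close> lie in the
  same component exactly if all numbers between them are in \<open>S\<close>, and this is how components are used below.
\<close>

lemma componentsD:
  assumes "T \<in> components S"
  shows "T \<noteq> {}" "T \<subseteq> S" "i \<in> T \<Longrightarrow> k \<in> T \<Longrightarrow> {i..k} \<subseteq> T"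
  using assms unfolding components_def segments_def by auto

lemma finite_components: "finite S \<Longrightarrow> finite (components S)"
  by (rule finite_subset[of _ "Pow S"]) (use componentsD(2) in auto)

lemma component_exists:
  assumes "finite S" "i \<in> S"
  obtains T where "T \<in> components S" "i \<in> T"
proof -
  let ?A = "{T \<in> segments S. i \<in> T}"
  have "?A \<subseteq> Pow S"
    unfolding segments_def by auto
  then have "finite ?A"
    using assms(1) by (meson finite_Pow_iff finite_subset)
  moreover have "{i..i} \<in> ?A"
    using assms(2) unfolding segments_def by fastforce
  ultimately have "\<exists>T\<in>?A. \<forall>T'\<in>?A. T \<subseteq> T' \<longrightarrow> T = T'"
    by (intro finite_has_maximal) auto
  then obtain T where T: "T \<in> ?A" "\<forall>T'\<in>?A. T \<subseteq> T' \<longrightarrow> T = T'"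
    by (rule bexE)
  have "T' = T" if "T' \<in> segments S" "T \<subseteq> T'" for T'
    using T that by auto
  with T(1) have "T \<in> components S"
    unfolding components_def by blast
  with T(1) that show thesis
    by blast
qed

text \<open>
  An interval in \<open>S\<close> that meets a component at one of its ends lies in it, by maximality of the component.
\<close>
lemma component_extend:
  assumes "T \<in> components S" "{i..k} \<subseteq> S" "i \<le> k" "i \<in> T \<or> k \<in> T"
  shows "i \<in> T" "k \<in> T"
proof -
  obtain a b where T: "T = {a..b}" "a \<le> b"
    using assms(1) unfolding components_def segments_def by blast
  have TS: "{a..b} \<subseteq> S"
    using componentsD(2)[OF assms(1)] T by simp
  \<comment> \<open>The hull of the two intervals: they overlap, so nothing outside S is added.\<close>
  have "{min a i..max b k} \<subseteq> S"
  proof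
    fix j assume "j \<in> {min a i..max b k}"
    then have "j \<in> {a..b} \<or> j \<in> {i..k}"
      using assms(3,4) T by (auto simp: min_def max_def split: if_splits)
    then show "j \<in> S"
      using TS assms(2) by blast
  qed
  then have "{min a i..max b k} \<in> segments S"
    unfolding segments_def mem_Collect_eq
    by (intro exI[of _ "min a i"] exI[of _ "max b k"] conjI refl) (use T(2) in auto)
  moreover have "T \<subseteq> {min a i..max b k}"
    using T by auto
  ultimately have eq: "{min a i..max b k} = T"
    using assms(1) unfolding components_def by blast
  show "i \<in> T" "k \<in> T"
    using assms(3) unfolding eq[symmetric] by simp_all
qed

lemma component_closed:
  assumes "T \<in> components S" "i \<in> T" "{i..k} \<subseteq> S" "{k..i} \<subseteq> S"
  shows "k \<in> T"
  using component_extend[OF assms(1), of i k] component_extend[OF assms(1), of k i] assms(2-4)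
  by (meson nat_le_linear)

lemma component_unique:
  assumes "T \<in> components S" "T' \<in> components S" "i \<in> T" "i \<in> T'"
  shows "T = T'"
proof -
  have "T \<subseteq> T'" if T: "T \<in> components S" "T' \<in> components S" "i \<in> T" "i \<in> T'" for T T'
  proof
    fix j assume "j \<in> T"
    then have "{i..j} \<subseteq> S" "{j..i} \<subseteq> S"
      using componentsD(2,3)[OF T(1)] T(3) by blast+
    then show "j \<in> T'"
      by (rule component_closed[OF T(2,4)])
  qed
  then show ?thesis
    using assms by blast
qed

text \<open>
  For an ideal \<open>J\<close>: the partition of \<open>J\<close> according to the components that contain the blocks.
\<close>
definition ideal_parts :: "'x family \<Rightarrow> 'x set \<Rightarrow> 'x set set" where
  "ideal_parts \<pi> J = (\<lambda>T. {x \<in> idx \<pi>. \<pi> x \<subseteq> T}) ` components (\<Union>x\<in>J. \<pi> x)"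

text \<open>
  A component is a union of blocks exactly if it contains every block that it meets, which means that
  no block of \<open>J\<close> spans a gap of the union of the blocks of \<open>J\<close>.
\<close>
lemma is_ideal_iff:
  assumes \<pi>: "indexed_ncp X \<pi>" and J: "J \<subseteq> X"
  shows "is_ideal \<pi> J \<longleftrightarrow> (\<forall>x\<in>J. \<forall>i\<in>\<pi> x. \<forall>k\<in>\<pi> x. {i..k} \<subseteq> (\<Union>x\<in>J. \<pi> x))"
proof
  let ?S = "\<Union>x\<in>J. \<pi> x"
  assume L: "is_ideal \<pi> J"
  show "\<forall>x\<in>J. \<forall>i\<in>\<pi> x. \<forall>k\<in>\<pi> x. {i..k} \<subseteq> ?S"
  proof (intro ballI)
    fix x i k assume a: "x \<in> J" "i \<in> \<pi> x" "k \<in> \<pi> x"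
    then have "i \<in> ?S"
      by blast
    then obtain T where T: "T \<in> components ?S" "i \<in> T"
      using component_exists[OF indexed_ncpD(6)[OF \<pi>]] by blast
    obtain K where K: "T = (\<Union>x\<in>K. \<pi> x)"
      using L T(1) unfolding is_ideal_def by blast
    then obtain y where "y \<in> K" "i \<in> \<pi> y"
      using T(2) by blast
    then have "x \<in> K"
      using a(2) indexed_ncpD(4)[OF \<pi>] unfolding disjoint_blocks_def by metis
    then have "k \<in> T"
      using a(3) K by blast
    then show "{i..k} \<subseteq> ?S"
      using componentsD(2,3)[OF T(1)] T(2) by blast
  qed
next
  let ?S = "\<Union>x\<in>J. \<pi> x"
  assume R: "\<forall>x\<in>J. \<forall>i\<in>\<pi> x. \<forall>k\<in>\<pi> x. {i..k} \<subseteq> ?S"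
  show "is_ideal \<pi> J"
    unfolding is_ideal_def
  proof
    fix T assume T: "T \<in> components ?S"
    let ?K = "{x \<in> J. \<pi> x \<inter> T \<noteq> {}}"
    have "\<pi> x \<subseteq> T" if "x \<in> ?K" for x
    proof
      fix k assume k: "k \<in> \<pi> x"
      obtain i where i: "i \<in> \<pi> x" "i \<in> T"
        using \<open>x \<in> ?K\<close> by blast
      have sub: "{i..k} \<subseteq> ?S" "{k..i} \<subseteq> ?S"
        using R that i(1) k by blast+
      show "k \<in> T"
        by (rule component_closed[OF T i(2) sub])
    qed
    moreover have "T \<subseteq> (\<Union>x\<in>?K. \<pi> x)"
      using componentsD(2)[OF T] by blast
    ultimately have "T = (\<Union>x\<in>?K. \<pi> x)"
      by blast
    moreover have "?K \<subseteq> idx \<pi>"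
      using J indexed_ncpD(3)[OF \<pi>] by blast
    ultimately show "\<exists>K\<subseteq>idx \<pi>. T = (\<Union>x\<in>K. \<pi> x)"
      by blast
  qed
qed

context
  fixes X J :: "'x set" and \<pi> :: "'x family"
  assumes \<pi>: "indexed_ncp X \<pi>" and J: "J \<subseteq> X" and ideal: "is_ideal \<pi> J"
begin

lemma component_block:
  assumes "T \<in> components (\<Union>x\<in>J. \<pi> x)" "x \<in> J" "i \<in> \<pi> x" "i \<in> T"
  shows "\<pi> x \<subseteq> T"
proof
  fix k assume k: "k \<in> \<pi> x"
  have sub: "{i..k} \<subseteq> (\<Union>x\<in>J. \<pi> x)" "{k..i} \<subseteq> (\<Union>x\<in>J. \<pi> x)"
    using ideal assms(2,3) k unfolding is_ideal_iff[OF \<pi> J] by simp_all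
  show "k \<in> T"
    by (rule component_closed[OF assms(1,4) sub])
qed

lemma block_in_component_mem:
  assumes "T \<in> components (\<Union>x\<in>J. \<pi> x)" "x \<in> idx \<pi>" "\<pi> x \<subseteq> T"
  shows "x \<in> J"
proof -
  obtain i where i: "i \<in> \<pi> x"
    using assms(2) in_idx_iff by metis
  then obtain y where "y \<in> J" "i \<in> \<pi> y"
    using componentsD(2)[OF assms(1)] assms(3) by blast
  then show ?thesis
    using i indexed_ncpD(4)[OF \<pi>] unfolding disjoint_blocks_def by metis
qed

lemma ideal_parts_nonempty: "C \<in> ideal_parts \<pi> J \<Longrightarrow> C \<noteq> {}"
proof -
  assume "C \<in> ideal_parts \<pi> J"
  then obtain T where T: "T \<in> components (\<Union>x\<in>J. \<pi> x)" "C = {x \<in> idx \<pi>. \<pi> x \<subseteq> T}"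
    unfolding ideal_parts_def by blast
  obtain i where i: "i \<in> T"
    using componentsD(1)[OF T(1)] by blast
  then obtain x where x: "x \<in> J" "i \<in> \<pi> x"
    using componentsD(2)[OF T(1)] by blast
  then have "\<pi> x \<subseteq> T"
    using component_block[OF T(1) x i] by simp
  then show ?thesis
    using x in_idx_iff T(2) by (metis (mono_tags, lifting) empty_iff mem_Collect_eq)
qed

lemma ideal_parts_sub: "C \<in> ideal_parts \<pi> J \<Longrightarrow> C \<subseteq> J"
  unfolding ideal_parts_def using block_in_component_mem by blast

text \<open>
  Distinct components contain distinct sets of blocks because each contains at least one. So the sum
  over components that defines \<open>ideal_restr\<close> is a sum over the parts.
\<close>
lemma inj_on_component_blocks:
  "inj_on (\<lambda>T. {x \<in> idx \<pi>. \<pi> x \<subseteq> T}) (components (\<Union>x\<in>J. \<pi> x))"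
proof (rule inj_onI)
  fix T T' assume T: "T \<in> components (\<Union>x\<in>J. \<pi> x)" "T' \<in> components (\<Union>x\<in>J. \<pi> x)"
    "{x \<in> idx \<pi>. \<pi> x \<subseteq> T} = {x \<in> idx \<pi>. \<pi> x \<subseteq> T'}"
  then have "{x \<in> idx \<pi>. \<pi> x \<subseteq> T} \<noteq> {}"
    using ideal_parts_nonempty unfolding ideal_parts_def by blast
  then obtain x where x: "x \<in> idx \<pi>" "\<pi> x \<subseteq> T"
    by blast
  then have "x \<in> {x \<in> idx \<pi>. \<pi> x \<subseteq> T'}"
    using T(3) by blast
  then have "\<pi> x \<subseteq> T'"
    by blast
  moreover obtain i where "i \<in> \<pi> x"
    using x(1) in_idx_iff by metis
  ultimately show "T = T'"
    using component_unique[OF T(1,2)] x(2) by blast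
qed

lemma ideal_restr_eq: "ideal_restr \<pi> J = (\<Sum>C\<in>ideal_parts \<pi> J. {#restr \<pi> C#})"
proof -
  have "ideal_restr \<pi> J = (\<Sum>C\<in>ideal_parts \<pi> J. restr_monom \<pi> C)"
    unfolding ideal_restr_def ideal_parts_def sum.reindex[OF inj_on_component_blocks] by simp
  also have "\<dots> = (\<Sum>C\<in>ideal_parts \<pi> J. {#restr \<pi> C#})"
    by (rule sum.cong[OF refl]) (simp add: restr_monom_def ideal_parts_nonempty)
  finally show ?thesis .
qed

lemma finite_ideal_parts: "finite (ideal_parts \<pi> J)"
  unfolding ideal_parts_def using finite_components[OF indexed_ncpD(6)[OF \<pi>]] by simp

lemma Union_ideal_parts: "\<Union>(ideal_parts \<pi> J) = J"
proof (intro subset_antisym subsetI)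
  fix x assume "x \<in> J"
  then have "x \<in> idx \<pi>"
    using J indexed_ncpD(3)[OF \<pi>] by blast
  then obtain i where i: "i \<in> \<pi> x"
    using in_idx_iff by metis
  then have "i \<in> (\<Union>x\<in>J. \<pi> x)"
    using \<open>x \<in> J\<close> by blast
  then obtain T where T: "T \<in> components (\<Union>x\<in>J. \<pi> x)" "i \<in> T"
    using component_exists[OF indexed_ncpD(6)[OF \<pi>]] by blast
  then have "\<pi> x \<subseteq> T"
    using component_block[OF T(1) \<open>x \<in> J\<close> i T(2)] by simp
  then show "x \<in> \<Union>(ideal_parts \<pi> J)"
    unfolding ideal_parts_def using T(1) \<open>x \<in> idx \<pi>\<close> by blast
qed (use ideal_parts_sub in blast)

lemma ideal_parts_component:
  assumes "C \<in> ideal_parts \<pi> J" "x \<in> C" "y \<in> J" "i \<in> \<pi> x" "j \<in> \<pi> y"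
    "{i..j} \<subseteq> (\<Union>x\<in>J. \<pi> x)" "{j..i} \<subseteq> (\<Union>x\<in>J. \<pi> x)"
  shows "y \<in> C"
proof -
  obtain T where T: "T \<in> components (\<Union>x\<in>J. \<pi> x)" "C = {x \<in> idx \<pi>. \<pi> x \<subseteq> T}"
    using assms(1) unfolding ideal_parts_def by blast
  have "i \<in> T"
    using T(2) assms(2,4) by blast
  then have "j \<in> T"
    using component_closed[OF T(1) _ assms(6,7)] by simp
  then have "\<pi> y \<subseteq> T"
    using component_block[OF T(1) assms(3,5)] by simp
  then show ?thesis
    using T(2) in_idxI[of j \<pi> y] assms(5) by blast
qed

lemma ideal_parts_interval:
  assumes "C \<in> ideal_parts \<pi> J" "x \<in> C" "y \<in> C" "i \<in> \<pi> x" "j \<in> \<pi> y"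
  shows "{i..j} \<subseteq> (\<Union>x\<in>J. \<pi> x)"
proof -
  obtain T where T: "T \<in> components (\<Union>x\<in>J. \<pi> x)" "C = {x \<in> idx \<pi>. \<pi> x \<subseteq> T}"
    using assms(1) unfolding ideal_parts_def by blast
  then have "i \<in> T" "j \<in> T"
    using assms(2-5) by blast+
  then show ?thesis
    using componentsD(2,3)[OF T(1)] by blast
qed

lemma ideal_parts_unique:
  assumes "C \<in> ideal_parts \<pi> J" "D \<in> ideal_parts \<pi> J" "x \<in> C" "x \<in> D"
  shows "C = D"
proof -
  obtain T where T: "T \<in> components (\<Union>x\<in>J. \<pi> x)" "C = {x \<in> idx \<pi>. \<pi> x \<subseteq> T}"
    using assms(1) unfolding ideal_parts_def by blast
  obtain T' where T': "T' \<in> components (\<Union>x\<in>J. \<pi> x)" "D = {x \<in> idx \<pi>. \<pi> x \<subseteq> T'}"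
    using assms(2) unfolding ideal_parts_def by blast
  have "x \<in> idx \<pi>"
    using T(2) assms(3) by blast
  then obtain i where "i \<in> \<pi> x"
    using in_idx_iff by metis
  then have "T = T'"
    using component_unique[OF T(1) T'(1), of i] T(2) T'(2) assms(3,4) by blast
  then show ?thesis
    using T(2) T'(2) by simp
qed

lemma ideal_restr_in_monoms: "ideal_restr \<pi> J \<in> monoms J"
proof -
  have "(\<Sum>C\<in>ideal_parts \<pi> J. {#restr \<pi> C#}) \<in> monoms (\<Union>C\<in>ideal_parts \<pi> J. C)"
  proof (rule monoms_sum[OF finite_ideal_parts])
    fix C assume C: "C \<in> ideal_parts \<pi> J"
    show "{#restr \<pi> C#} \<in> monoms C"
      by (intro monoms_single indexed_ncp_restr[OF \<pi>])
        (use ideal_parts_sub[OF C] ideal_parts_nonempty[OF C] J in auto)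
  qed (rule ideal_parts_unique)
  then show ?thesis
    using Union_ideal_parts ideal_restr_eq by simp
qed

end

lemma restr_monom_in_monoms: "indexed_ncp X \<pi> \<Longrightarrow> Y \<subseteq> X \<Longrightarrow> restr_monom \<pi> Y \<in> monoms Y"
  by (cases "Y = {}") (simp_all add: restr_monom_def monoms_empty monoms_single indexed_ncp_restr)

subsection \<open>Contracting an ideal and its complement\<close>

text \<open>
  The labels are divided into \<open>X\<close> and \<open>Y\<close> with equivalences \<open>r\<close> and \<open>s\<close>; this is first studied for a
  single noncrossing partition and then, factor by factor, for a monomial.
\<close>

locale disjoint_equivs =
  fixes X Y :: "'a label set" and r s
  assumes XY: "X \<inter> Y = {}" and r: "equiv X r" and s: "equiv Y s"
begin

lemma equiv_Un: "equiv (X \<union> Y) (r \<union> s)"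
proof (rule equivI)
  show "r \<union> s \<subseteq> (X \<union> Y) \<times> (X \<union> Y)"
    using equiv_type[OF r] equiv_type[OF s] by blast
  show "refl_on (X \<union> Y) (r \<union> s)"
    using equiv_refl[OF r] equiv_refl[OF s] by (auto intro!: refl_onI)
  show "sym (r \<union> s)"
    using equiv_symD[OF r] equiv_symD[OF s] by (auto intro!: symI)
  show "trans (r \<union> s)"
  proof (rule transI)
    fix x y z assume "(x, y) \<in> r \<union> s" "(y, z) \<in> r \<union> s"
    moreover have "\<not> ((x, y) \<in> r \<and> (y, z) \<in> s)" "\<not> ((x, y) \<in> s \<and> (y, z) \<in> r)"
      using equiv_mem[OF r] equiv_mem[OF s] XY by blast+
    ultimately show "(x, z) \<in> r \<union> s"
      using equiv_transD[OF r, of x y z] equiv_transD[OF s, of x y z] by blast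
  qed
qed

lemma class_label_Un:
  shows "x \<in> X \<Longrightarrow> class_label (r \<union> s) x = class_label r x"
    and "y \<in> Y \<Longrightarrow> class_label (r \<union> s) y = class_label s y"
proof -
  show "class_label (r \<union> s) x = class_label r x" if "x \<in> X"
  proof -
    have "(r \<union> s) `` {x} = r `` {x}"
      using that XY equiv_mem[OF s] by blast
    then show ?thesis
      by (simp add: class_label_def)
  qed
  show "class_label (r \<union> s) y = class_label s y" if "y \<in> Y"
  proof -
    have "(r \<union> s) `` {y} = s `` {y}"
      using that XY equiv_mem[OF r] by blast
    then show ?thesis
      by (simp add: class_label_def)
  qed
qed

lemma quot_Un: "quot X r = class_label (r \<union> s) ` X" "quot Y s = class_label (r \<union> s) ` Y"
  unfolding quot_eq using class_label_Un by (auto intro!: image_cong)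

lemma Restr_Un: "C \<subseteq> X \<Longrightarrow> Restr (r \<union> s) C = Restr r C" "D \<subseteq> Y \<Longrightarrow> Restr (r \<union> s) D = Restr s D"
  using XY equiv_type[OF r] equiv_type[OF s] by blast+

end

locale disjoint_equivs_ncp = disjoint_equivs +
  fixes \<pi> :: "'a label family"
  assumes \<pi>: "indexed_ncp (X \<union> Y) \<pi>"
begin

lemma UN_contract_ideal:
  "(\<Union>c\<in>quot Y s. contract (X \<union> Y) (r \<union> s) \<pi> c) = (\<Union>y\<in>Y. \<pi> y)"
  unfolding quot_Un(2)
  by (rule UN_contract[OF equiv_Un indexed_ncpD(1)[OF \<pi>]])
    (use XY equiv_mem[OF r] equiv_mem[OF s] in blast)+

text \<open>
  Contracting does not change the union of the blocks with labels in \<open>Y\<close>, hence neither its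
  components; the blocks to be contained in a component are now those of whole classes of \<open>s\<close>.
\<close>
lemma is_ideal_contract_iff:
  assumes "noncrossing_wrt \<pi> (r \<union> s)"
  shows "is_ideal (contract (X \<union> Y) (r \<union> s) \<pi>) (quot Y s) \<longleftrightarrow>
    (\<forall>x y i k. (x, y) \<in> s \<longrightarrow> i \<in> \<pi> x \<longrightarrow> k \<in> \<pi> y \<longrightarrow> {i..k} \<subseteq> (\<Union>y\<in>Y. \<pi> y))"
proof -
  let ?c = "contract (X \<union> Y) (r \<union> s) \<pi>"
  have "indexed_ncp (quot (X \<union> Y) (r \<union> s)) ?c"
    using indexed_ncp_contract_iff[OF \<pi> equiv_Un] assms by simp
  moreover have "quot Y s \<subseteq> quot (X \<union> Y) (r \<union> s)"
    unfolding quot_Un(2) quot_eq[of "X \<union> Y"] by blast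
  ultimately have "is_ideal ?c (quot Y s) \<longleftrightarrow>
      (\<forall>c\<in>quot Y s. \<forall>i\<in>?c c. \<forall>k\<in>?c c. {i..k} \<subseteq> (\<Union>c\<in>quot Y s. ?c c))"
    by (rule is_ideal_iff)
  also have "\<dots> \<longleftrightarrow> (\<forall>c\<in>quot Y s. \<forall>i\<in>?c c. \<forall>k\<in>?c c. {i..k} \<subseteq> (\<Union>y\<in>Y. \<pi> y))"
    unfolding UN_contract_ideal ..
  also have "\<dots> \<longleftrightarrow> (\<forall>x y i k. (x, y) \<in> s \<longrightarrow> i \<in> \<pi> x \<longrightarrow> k \<in> \<pi> y \<longrightarrow> {i..k} \<subseteq> (\<Union>y\<in>Y. \<pi> y))"
  proof (intro iffI ballI allI impI)
    fix x y i k assume L: "\<forall>c\<in>quot Y s. \<forall>i\<in>?c c. \<forall>k\<in>?c c. {i..k} \<subseteq> (\<Union>y\<in>Y. \<pi> y)"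
      and p: "(x, y) \<in> s" "i \<in> \<pi> x" "k \<in> \<pi> y"
    have Y: "x \<in> Y" "y \<in> Y"
      using equiv_mem[OF s p(1)] by simp_all
    have c: "class_label (r \<union> s) x = class_label (r \<union> s) y"
      using class_label_eq_iff[OF equiv_Un indexed_ncpD(1)[OF \<pi>], of x y] Y p(1) by simp
    have "i \<in> ?c (class_label (r \<union> s) x)"
      unfolding in_contract[OF equiv_Un] using Y(1) p(2) by blast
    moreover have "k \<in> ?c (class_label (r \<union> s) x)"
      unfolding in_contract[OF equiv_Un] using Y(2) c p(3) by blast
    moreover have "class_label (r \<union> s) x \<in> quot Y s"
      unfolding quot_Un(2) using Y(1) by blast
    ultimately show "{i..k} \<subseteq> (\<Union>y\<in>Y. \<pi> y)"
      using L by blast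
  next
    fix c i k assume R: "\<forall>x y i k. (x, y) \<in> s \<longrightarrow> i \<in> \<pi> x \<longrightarrow> k \<in> \<pi> y \<longrightarrow> {i..k} \<subseteq> (\<Union>y\<in>Y. \<pi> y)"
      and a: "c \<in> quot Y s" "i \<in> ?c c" "k \<in> ?c c"
    then obtain y where y: "y \<in> Y" "c = class_label (r \<union> s) y"
      unfolding quot_Un(2) by blast
    have *: "\<exists>x. (y, x) \<in> s \<and> i \<in> \<pi> x" if i: "i \<in> ?c c" for i
    proof -
      obtain x where x: "x \<in> X \<union> Y" "c = class_label (r \<union> s) x" "i \<in> \<pi> x"
        using i unfolding in_contract[OF equiv_Un] by blast
      then have "(y, x) \<in> r \<union> s"
        using class_label_eq_iff[OF equiv_Un indexed_ncpD(1)[OF \<pi>], of y x] y by simp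
      then have "(y, x) \<in> s"
        using y(1) XY equiv_mem[OF r] by blast
      then show ?thesis
        using x(3) by blast
    qed
    obtain x z where xz: "(y, x) \<in> s" "i \<in> \<pi> x" "(y, z) \<in> s" "k \<in> \<pi> z"
      using *[OF a(2)] *[OF a(3)] by blast
    have "(x, z) \<in> s"
      using equiv_transD[OF s equiv_symD[OF s xz(1)] xz(3)] .
    then show "{i..k} \<subseteq> (\<Union>y\<in>Y. \<pi> y)"
      using R[rule_format, of x z i k] xz by simp
  qed
  finally show ?thesis .
qed

text \<open>
  The conditions under which the two sides of the compatibility with \<open>\<Delta>\<close> are nonzero at \<open>\<pi>\<close>. The point
  of the converse direction is that crossings between \<open>r\<close> and \<open>s\<close>, and between different parts
  of the ideal, are excluded for free, since parts of the ideal occupy intervals.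
\<close>
lemma noncrossing_ideal_iff:
  "noncrossing_wrt \<pi> (r \<union> s) \<and> is_ideal (contract (X \<union> Y) (r \<union> s) \<pi>) (quot Y s) \<longleftrightarrow>
   is_ideal \<pi> Y \<and> noncrossing_wrt \<pi> r \<and>
   (\<forall>x y. (x, y) \<in> s \<longrightarrow> (\<exists>C\<in>ideal_parts \<pi> Y. x \<in> C \<and> y \<in> C)) \<and>
   (\<forall>C\<in>ideal_parts \<pi> Y. noncrossing_wrt \<pi> (Restr s C))" (is "?L \<longleftrightarrow> ?R")
proof
  let ?S = "\<Union>y\<in>Y. \<pi> y"
  assume L: ?L
  then have int: "\<And>x y i k. (x, y) \<in> s \<Longrightarrow> i \<in> \<pi> x \<Longrightarrow> k \<in> \<pi> y \<Longrightarrow> {i..k} \<subseteq> ?S"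
    using is_ideal_contract_iff by simp
  have ideal: "is_ideal \<pi> Y"
    unfolding is_ideal_iff[OF \<pi> Un_upper2] using int equiv_refl[OF s] by blast
  have "\<exists>C\<in>ideal_parts \<pi> Y. x \<in> C \<and> y \<in> C" if xy: "(x, y) \<in> s" for x y
  proof -
    have Y: "x \<in> Y" "y \<in> Y"
      using equiv_mem[OF s xy] by simp_all
    then obtain C where C: "C \<in> ideal_parts \<pi> Y" "x \<in> C"
      using Union_ideal_parts[OF \<pi> Un_upper2 ideal] by blast
    obtain i j where ij: "i \<in> \<pi> x" "j \<in> \<pi> y"
      using Y indexed_ncpD(3)[OF \<pi>] in_idx_iff[of x \<pi>] in_idx_iff[of y \<pi>] by blast
    have "{i..j} \<subseteq> ?S" "{j..i} \<subseteq> ?S"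
      using int[OF xy ij] int[OF equiv_symD[OF s xy] ij(2,1)] by simp_all
    then have "y \<in> C"
      using ideal_parts_component[OF \<pi> Un_upper2 ideal C Y(2) ij] by simp
    then show ?thesis
      using C by blast
  qed
  moreover have "noncrossing_wrt \<pi> r"
    using noncrossing_wrt_Int[of \<pi> "r \<union> s" X] L Restr_Un(1)[of X] equiv_type[OF r]
    by (simp add: Int_absorb2)
  moreover have "noncrossing_wrt \<pi> (Restr s C)" if "C \<in> ideal_parts \<pi> Y" for C
    using noncrossing_wrt_Int[of \<pi> "r \<union> s" C] L Restr_Un(2)[OF ideal_parts_sub[OF \<pi> Un_upper2 ideal that]]
    by simp
  ultimately show ?R
    using ideal by blast
next
  let ?S = "\<Union>y\<in>Y. \<pi> y"
  assume R: ?R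
  then have ideal: "is_ideal \<pi> Y" and nr: "noncrossing_wrt \<pi> r" by simp_all
  have part: "\<exists>C\<in>ideal_parts \<pi> Y. x \<in> C \<and> y \<in> C" if "(x, y) \<in> s" for x y
    using R that by blast
  have nC: "noncrossing_wrt \<pi> (Restr s C)" if "C \<in> ideal_parts \<pi> Y" for C
    using R that by blast
  have int: "{i..k} \<subseteq> ?S" if xy: "(x, y) \<in> s" "i \<in> \<pi> x" "k \<in> \<pi> y" for x y i k
  proof -
    obtain C where "C \<in> ideal_parts \<pi> Y" "x \<in> C" "y \<in> C"
      using part[OF xy(1)] by blast
    then show ?thesis
      using xy(2,3) by (rule ideal_parts_interval[OF \<pi> Un_upper2 ideal])
  qed
  have dis: "\<pi> x \<inter> ?S = {}" if "x \<in> X" for x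
  proof (rule ccontr)
    assume "\<pi> x \<inter> ?S \<noteq> {}"
    then obtain i y where "i \<in> \<pi> x" "i \<in> \<pi> y" "y \<in> Y"
      by blast
    then have "x = y"
      using indexed_ncpD(4)[OF \<pi>] unfolding disjoint_blocks_def by simp
    then show False
      using that XY \<open>y \<in> Y\<close> by blast
  qed
  have nc: "noncrossing_wrt \<pi> (r \<union> s)"
  proof (rule noncrossing_wrtI)
    fix x y z t i j k l
    assume a: "(x, z) \<in> r \<union> s" "(y, t) \<in> r \<union> s" "i \<in> \<pi> x" "j \<in> \<pi> y" "k \<in> \<pi> z" "l \<in> \<pi> t"
      "i < j" "j < k" "k < l"
    consider "(x, z) \<in> r" "(y, t) \<in> r" | "(x, z) \<in> r" "(y, t) \<in> s"
      | "(x, z) \<in> s" "(y, t) \<in> r" | "(x, z) \<in> s" "(y, t) \<in> s"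
      using a(1,2) by blast
    then show "(x, y) \<in> r \<union> s"
    proof cases
      case 1
      then show ?thesis
        using noncrossing_wrtD[OF nr 1 a(3-9)] by simp
    next
      case 2
      \<comment> \<open>k lies between two elements of one component of the ideal, so it cannot be in a block of X.\<close>
      have "k \<in> ?S"
        by (rule subsetD[OF int[OF 2(2) a(4,6)]]) (use a(8,9) in simp)
      moreover have "z \<in> X"
        using equiv_mem[OF r 2(1)] by simp
      ultimately show ?thesis
        using dis[of z] a(5) by blast
    next
      case 3
      \<comment> \<open>Likewise for j.\<close>
      have "j \<in> ?S"
        by (rule subsetD[OF int[OF 3(1) a(3,5)]]) (use a(7,8) in simp)
      moreover have "y \<in> X"
        using equiv_mem[OF r 3(2)] by simp
      ultimately show ?thesis
        using dis[of y] a(4) by blast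
    next
      case 4
      obtain C where C: "C \<in> ideal_parts \<pi> Y" "x \<in> C" "z \<in> C"
        using part[OF 4(1)] by blast
      have yt: "y \<in> Y" "t \<in> Y"
        using equiv_mem[OF s 4(2)] by simp_all
      \<comment> \<open>i and k are in one component, hence so is j between them: both classes belong to the same part C.\<close>
      have "{i..j} \<subseteq> {i..k}"
        using a(8) by auto
      then have "{i..j} \<subseteq> ?S"
        using int[OF 4(1) a(3,5)] by blast
      then have y: "y \<in> C"
        using ideal_parts_component[OF \<pi> Un_upper2 ideal C(1,2) yt(1) a(3,4)] a(7) by simp
      obtain D where "D \<in> ideal_parts \<pi> Y" "y \<in> D" "t \<in> D"
        using part[OF 4(2)] by blast
      then have t: "t \<in> C"
        using ideal_parts_unique[OF \<pi> Un_upper2 ideal C(1) _ y] by blast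
      have "(x, z) \<in> Restr s C" "(y, t) \<in> Restr s C"
        using 4 C y t by simp_all
      then have "(x, y) \<in> Restr s C"
        using a(3-9) by (rule noncrossing_wrtD[OF nC[OF C(1)]])
      then show ?thesis
        by blast
    qed
  qed
  moreover have "is_ideal (contract (X \<union> Y) (r \<union> s) \<pi>) (quot Y s)"
    unfolding is_ideal_contract_iff[OF nc] by (intro allI impI) (rule int)
  ultimately show ?L
    by simp
qed

text \<open>
  This and the next two lemmas compare the tensor factors of the two sides at \<open>\<pi>\<close>.
\<close>
lemma restr_monom_contract:
  "restr_monom (contract (X \<union> Y) (r \<union> s) \<pi>) (quot X r) =
    (if X = {} then {#} else {#contract X r (restr \<pi> X)#})"
proof (cases "X = {}")
  case False
  have "contract X (Restr (r \<union> s) X) (restr \<pi> X) =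
      restr (contract (X \<union> Y) (r \<union> s) \<pi>) (class_label (r \<union> s) ` X)"
    by (rule contract_restr[OF equiv_Un indexed_ncpD(1)[OF \<pi>]])
      (use XY equiv_mem[OF r] equiv_mem[OF s] in blast)+
  moreover have "Restr (r \<union> s) X = r"
    using Restr_Un(1)[of X] equiv_type[OF r] by blast
  ultimately show ?thesis
    using False by (simp add: restr_monom_def quot_Un(1))
qed (simp add: restr_monom_def quot_eq)

text \<open>
  The components are the same before and after contraction. The labels in a component
  \<open>T\<close> after contraction are the classes of the labels in \<open>T\<close> before.
\<close>
lemma ideal_restr_contract:
  assumes ideal: "is_ideal \<pi> Y"
    and part: "\<And>x y. (x, y) \<in> s \<Longrightarrow> \<exists>C\<in>ideal_parts \<pi> Y. x \<in> C \<and> y \<in> C"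
  shows "ideal_restr (contract (X \<union> Y) (r \<union> s) \<pi>) (quot Y s) =
    (\<Sum>C\<in>ideal_parts \<pi> Y. {#contract C (Restr s C) (restr \<pi> C)#})"
proof -
  let ?c = "contract (X \<union> Y) (r \<union> s) \<pi>" and ?S = "\<Union>y\<in>Y. \<pi> y"
  have idx: "idx \<pi> = X \<union> Y"
    using indexed_ncpD(3)[OF \<pi>] .
  have idxc: "idx ?c = class_label (r \<union> s) ` (X \<union> Y)"
    using idx_contract[OF equiv_Un, of \<pi>] idx by (simp add: quot_eq)
  have "restr_monom ?c {c \<in> idx ?c. ?c c \<subseteq> T} =
      {#contract (B T) (Restr s (B T)) (restr \<pi> (B T))#}"
    if T: "T \<in> components ?S" and B: "B = (\<lambda>T. {x \<in> idx \<pi>. \<pi> x \<subseteq> T})" for T B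
  proof -
    have BP: "B T \<in> ideal_parts \<pi> Y"
      unfolding ideal_parts_def using B T by blast
    have BY: "B T \<subseteq> Y"
      using ideal_parts_sub[OF \<pi> Un_upper2 ideal BP] .
    have ne: "B T \<noteq> {}"
      using ideal_parts_nonempty[OF \<pi> Un_upper2 ideal BP] .
    have sat: "y \<in> B T" if "x \<in> B T" "(x, y) \<in> r \<union> s" for x y
    proof -
      have "(x, y) \<in> s"
        using that BY XY equiv_mem[OF r] by blast
      then obtain C where "C \<in> ideal_parts \<pi> Y" "x \<in> C" "y \<in> C"
        using part by blast
      then show ?thesis
        using ideal_parts_unique[OF \<pi> Un_upper2 ideal BP _ that(1)] by blast
    qed
    have BT: "x \<in> B T \<longleftrightarrow> x \<in> X \<union> Y \<and> \<pi> x \<subseteq> T" for x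
      using B idx by simp
    have set: "{c \<in> idx ?c. ?c c \<subseteq> T} = class_label (r \<union> s) ` B T"
    proof (intro set_eqI iffI)
      fix c assume "c \<in> {c \<in> idx ?c. ?c c \<subseteq> T}"
      then obtain x where x: "x \<in> X \<union> Y" "c = class_label (r \<union> s) x" "?c c \<subseteq> T"
        using idxc by auto
      then have "\<pi> x \<subseteq> T"
        using in_contract[OF equiv_Un, of _ \<pi> c] by blast
      then have "x \<in> B T"
        using x(1) BT by simp
      then show "c \<in> class_label (r \<union> s) ` B T"
        using x(2) by blast
    next
      fix c assume "c \<in> class_label (r \<union> s) ` B T"
      then obtain x where x: "x \<in> B T" "c = class_label (r \<union> s) x"
        by blast
      have xXY: "x \<in> X \<union> Y"
        using x(1) BT by simp
      have "?c c \<subseteq> T"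
      proof
        fix i assume "i \<in> ?c c"
        then obtain y where y: "y \<in> X \<union> Y" "c = class_label (r \<union> s) y" "i \<in> \<pi> y"
          unfolding in_contract[OF equiv_Un] by blast
        then have "(x, y) \<in> r \<union> s"
          using class_label_eq_iff[OF equiv_Un indexed_ncpD(1)[OF \<pi>] xXY y(1)] x(2) by simp
        then have "y \<in> B T"
          using sat x(1) by blast
        then show "i \<in> T"
          using BT y(3) by blast
      qed
      moreover have "c \<in> idx ?c"
        using idxc x(2) xXY by blast
      ultimately show "c \<in> {c \<in> idx ?c. ?c c \<subseteq> T}"
        by blast
    qed
    have "contract (B T) (Restr (r \<union> s) (B T)) (restr \<pi> (B T)) = restr ?c (class_label (r \<union> s) ` B T)"
    proof (rule contract_restr[OF equiv_Un indexed_ncpD(1)[OF \<pi>]])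
      show "B T \<subseteq> X \<union> Y"
        using BY by blast
    qed (rule sat)
    then show ?thesis
      unfolding set restr_monom_def using ne Restr_Un(2)[OF BY] by simp
  qed
  then have "(\<Sum>T\<in>components ?S. restr_monom ?c {c \<in> idx ?c. ?c c \<subseteq> T}) =
      (\<Sum>T\<in>components ?S. (\<lambda>C. {#contract C (Restr s C) (restr \<pi> C)#}) {x \<in> idx \<pi>. \<pi> x \<subseteq> T})"
    by (intro sum.cong refl) simp
  also have "\<dots> = (\<Sum>C\<in>ideal_parts \<pi> Y. {#contract C (Restr s C) (restr \<pi> C)#})"
    unfolding ideal_parts_def sum.reindex[OF inj_on_component_blocks[OF \<pi> Un_upper2 ideal]] by simp
  finally show ?thesis
    unfolding ideal_restr_def UN_contract_ideal .
qed

text \<open>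
  The classes of \<open>r \<union> s\<close> are those of \<open>r\<close> and those of \<open>s\<close>, and the latter are distributed over the
  parts of the ideal.
\<close>
lemma extract_monom_Un:
  assumes ideal: "is_ideal \<pi> Y"
    and part: "\<And>x y. (x, y) \<in> s \<Longrightarrow> \<exists>C\<in>ideal_parts \<pi> Y. x \<in> C \<and> y \<in> C"
  shows "extract_monom (X \<union> Y) (r \<union> s) \<pi> = extract_monom X r \<pi> +
    (\<Sum>C\<in>ideal_parts \<pi> Y. extract_monom C (Restr s C) \<pi>)"
proof -
  let ?P = "ideal_parts \<pi> Y"
  note U = Union_ideal_parts[OF \<pi> Un_upper2 ideal]
  have PY: "C \<subseteq> Y" "C \<noteq> {}" if "C \<in> ?P" for C
    using ideal_parts_sub[OF \<pi> Un_upper2 ideal that] ideal_parts_nonempty[OF \<pi> Un_upper2 ideal that]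
    by simp_all
  have XP: "X \<notin> ?P"
  proof
    assume "X \<in> ?P"
    then show False
      using PY[of X] XY by blast
  qed
  have "extract_monom (X \<union> Y) (r \<union> s) \<pi> = (\<Sum>C\<in>insert X ?P. extract_monom C (Restr (r \<union> s) C) \<pi>)"
  proof (rule extract_monom_partition[OF equiv_Un indexed_ncpD(1)[OF \<pi>]])
    show "X \<union> Y = \<Union> (insert X ?P)"
      using U by simp
    show "disjoint (insert X ?P)"
      unfolding disjoint_def
    proof (intro ballI impI)
      fix C D assume CD: "C \<in> insert X ?P" "D \<in> insert X ?P" "C \<noteq> D"
      then consider "C = X" "D \<in> ?P" | "C \<in> ?P" "D = X" | "C \<in> ?P" "D \<in> ?P"
        by blast
      then show "C \<inter> D = {}"
      proof cases
        case 1
        then show ?thesis using PY(1)[of D] XY by blast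
      next
        case 2
        then show ?thesis using PY(1)[of C] XY by blast
      next
        case 3
        then show ?thesis
          using ideal_parts_unique[OF \<pi> Un_upper2 ideal 3] CD(3) by blast
      qed
    qed
    fix C x y assume a: "C \<in> insert X ?P" "x \<in> C" "(x, y) \<in> r \<union> s"
    show "y \<in> C"
    proof (cases "C = X")
      case True
      then show ?thesis
        using a XY equiv_mem[OF r] equiv_mem[OF s] by blast
    next
      case False
      then have C: "C \<in> ?P"
        using a(1) by simp
      then have "(x, y) \<in> s"
        using a(2,3) PY(1)[OF C] XY equiv_mem[OF r] by blast
      then obtain D where "D \<in> ?P" "x \<in> D" "y \<in> D"
        using part by blast
      then show ?thesis
        using ideal_parts_unique[OF \<pi> Un_upper2 ideal C _ a(2)] by blast
    qed
  qed
  also have "\<dots> = extract_monom X (Restr (r \<union> s) X) \<pi> + (\<Sum>C\<in>?P. extract_monom C (Restr (r \<union> s) C) \<pi>)"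
    using XP finite_ideal_parts[OF \<pi> Un_upper2 ideal] by simp
  also have "Restr (r \<union> s) X = r"
    using Restr_Un(1)[of X] equiv_type[OF r] by blast
  also have "(\<Sum>C\<in>?P. extract_monom C (Restr (r \<union> s) C) \<pi>) = (\<Sum>C\<in>?P. extract_monom C (Restr s C) \<pi>)"
    by (rule sum.cong[OF refl]) (use Restr_Un(2) PY(1) in simp)
  finally show ?thesis .
qed

end

subsection \<open>Compatibility with the coproduct on monomials\<close>

definition sub_all :: "'x set \<Rightarrow> 'x monom \<Rightarrow> 'x monom" where
  "sub_all I M = (\<Sum>\<pi>\<in>#M. restr_monom \<pi> (I \<inter> idx \<pi>))"

definition ideal_all :: "'x set \<Rightarrow> 'x monom \<Rightarrow> 'x monom" where
  "ideal_all J M = (\<Sum>\<pi>\<in>#M. ideal_restr \<pi> (J \<inter> idx \<pi>))"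

definition is_ideal_all :: "'x set \<Rightarrow> 'x monom \<Rightarrow> bool" where
  "is_ideal_all J M \<longleftrightarrow> (\<forall>\<pi>\<in>#M. is_ideal \<pi> (J \<inter> idx \<pi>))"

lemma prod_Delta_ncp:
  "(\<Prod>\<pi>\<in>#M. Delta_ncp (I \<inter> idx \<pi>) (J \<inter> idx \<pi>) \<pi>) =
    (if is_ideal_all J M then basis (sub_all I M, ideal_all J M) else (0 :: ('x, 'k::field_char_0) alg2))"
  unfolding Delta_ncp_def prod_mset_if_basis sum_mset_Pair sub_all_def ideal_all_def is_ideal_all_def ..

locale disjoint_equivs_monom = disjoint_equivs +
  fixes M :: "'a label monom"
  assumes M: "M \<in> monoms (X \<union> Y)"
begin

abbreviation parts :: "'a label family \<Rightarrow> 'a label set set" where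
  "parts \<pi> \<equiv> ideal_parts \<pi> (Y \<inter> idx \<pi>)"

lemma idx_Un: "\<pi> \<in># M \<Longrightarrow> (X \<inter> idx \<pi>) \<union> (Y \<inter> idx \<pi>) = idx \<pi>"
  using monomsD(6)[OF M] by blast

lemma local_equivs:
  assumes "\<pi> \<in># M"
  shows "disjoint_equivs_ncp (X \<inter> idx \<pi>) (Y \<inter> idx \<pi>) (Restr r (idx \<pi>)) (Restr s (idx \<pi>)) \<pi>"
proof
  show "(X \<inter> idx \<pi>) \<inter> (Y \<inter> idx \<pi>) = {}"
    using XY by blast
  have "Restr r (idx \<pi>) = Restr r (X \<inter> idx \<pi>)" "Restr s (idx \<pi>) = Restr s (Y \<inter> idx \<pi>)"
    using equiv_type[OF r] equiv_type[OF s] by blast+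
  then show "equiv (X \<inter> idx \<pi>) (Restr r (idx \<pi>))" "equiv (Y \<inter> idx \<pi>) (Restr s (idx \<pi>))"
    using equiv_Int[OF r, of "X \<inter> idx \<pi>"] equiv_Int[OF s, of "Y \<inter> idx \<pi>"] by simp_all
  show "indexed_ncp ((X \<inter> idx \<pi>) \<union> (Y \<inter> idx \<pi>)) \<pi>"
    using monomsD(2)[OF M assms] idx_Un[OF assms] by simp
qed

lemma Restr_Un_idx: "Restr (r \<union> s) Z = Restr r Z \<union> Restr s Z"
  by blast

lemma splits_Un: "splits (r \<union> s) M \<longleftrightarrow> splits r M \<and> splits s M"
  unfolding splits_def by blast

lemma class_label_image_Int:
  assumes "splits (r \<union> s) M" "\<pi> \<in># M" "Z \<subseteq> X \<union> Y"
  shows "class_label (r \<union> s) ` Z \<inter> class_label (r \<union> s) ` idx \<pi> = class_label (r \<union> s) ` (Z \<inter> idx \<pi>)"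
proof (intro subset_antisym subsetI)
  fix c assume c: "c \<in> class_label (r \<union> s) ` Z \<inter> class_label (r \<union> s) ` idx \<pi>"
  then obtain x where x: "x \<in> Z" "c = class_label (r \<union> s) x"
    by blast
  then have "x \<in> idx \<pi>"
    using class_label_mem_iff[OF M equiv_Un assms(1,2), of x] c assms(3) by blast
  then show "c \<in> class_label (r \<union> s) ` (Z \<inter> idx \<pi>)"
    using x by blast
qed blast

text \<open>
  The left-hand sides are how \<open>\<Delta>\<close> divides the labels of a contracted factor, the right-hand sides the
  quotients of the two sets of labels of the original factor.
\<close>
lemma quot_Int_idx:
  assumes "splits (r \<union> s) M" "\<pi> \<in># M"
  shows "quot X r \<inter> idx (contract_factor (r \<union> s) \<pi>) = quot (X \<inter> idx \<pi>) (Restr r (idx \<pi>))"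
    and "quot Y s \<inter> idx (contract_factor (r \<union> s) \<pi>) = quot (Y \<inter> idx \<pi>) (Restr s (idx \<pi>))"
proof -
  interpret L: disjoint_equivs_ncp "X \<inter> idx \<pi>" "Y \<inter> idx \<pi>" "Restr r (idx \<pi>)" "Restr s (idx \<pi>)" \<pi>
    by (rule local_equivs[OF assms(2)])
  have lab: "class_label (Restr r (idx \<pi>) \<union> Restr s (idx \<pi>)) ` (Z \<inter> idx \<pi>) = class_label (r \<union> s) ` (Z \<inter> idx \<pi>)" for Z
    unfolding Restr_Un_idx[symmetric]
    by (rule image_cong[OF refl]) (rule class_label_Restr[OF M assms], blast)
  show "quot X r \<inter> idx (contract_factor (r \<union> s) \<pi>) = quot (X \<inter> idx \<pi>) (Restr r (idx \<pi>))"
    unfolding L.quot_Un lab idx_contract_Restr[OF M equiv_Un assms(2)] quot_Restr[OF M assms] quot_Un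
    by (rule class_label_image_Int[OF assms]) blast
  show "quot Y s \<inter> idx (contract_factor (r \<union> s) \<pi>) = quot (Y \<inter> idx \<pi>) (Restr s (idx \<pi>))"
    unfolding L.quot_Un lab idx_contract_Restr[OF M equiv_Un assms(2)] quot_Restr[OF M assms] quot_Un
    by (rule class_label_image_Int[OF assms]) blast
qed

lemma sub_all_in_monoms: "sub_all X M \<in> monoms X"
  using sum_mset_in_monoms[OF M, of "\<lambda>\<pi>. restr_monom \<pi> (X \<inter> idx \<pi>)" X]
    restr_monom_in_monoms[OF monomsD(2)[OF M]]
  by (simp add: sub_all_def Int_absorb2)

lemma ideal_all_in_monoms:
  assumes "is_ideal_all Y M"
  shows "ideal_all Y M \<in> monoms Y"
proof -
  have "ideal_restr \<pi> (Y \<inter> idx \<pi>) \<in> monoms (Y \<inter> idx \<pi>)" if "\<pi> \<in># M" for \<pi>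
    by (rule ideal_restr_in_monoms[OF monomsD(2)[OF M that]])
      (use assms that in \<open>auto simp: is_ideal_all_def\<close>)
  then show ?thesis
    using sum_mset_in_monoms[OF M, of "\<lambda>\<pi>. ideal_restr \<pi> (Y \<inter> idx \<pi>)" Y]
    by (simp add: ideal_all_def Int_absorb2)
qed

lemma set_sub_all: "set_mset (sub_all X M) = {restr \<pi> (X \<inter> idx \<pi>) | \<pi>. \<pi> \<in># M \<and> X \<inter> idx \<pi> \<noteq> {}}"
  unfolding sub_all_def by (auto simp: restr_monom_def split: if_splits)

lemma set_ideal_all:
  assumes "is_ideal_all Y M"
  shows "set_mset (ideal_all Y M) = {restr \<pi> C | \<pi> C. \<pi> \<in># M \<and> C \<in> parts \<pi>}"
proof -
  have "set_mset (ideal_restr \<pi> (Y \<inter> idx \<pi>)) = restr \<pi> ` parts \<pi>" if "\<pi> \<in># M" for \<pi>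
  proof -
    note \<pi> = monomsD(2)[OF M that]
    have id: "is_ideal \<pi> (Y \<inter> idx \<pi>)"
      using assms that by (simp add: is_ideal_all_def)
    show ?thesis
      using ideal_restr_eq[OF \<pi> _ id] finite_ideal_parts[OF \<pi> _ id] by (auto simp: set_mset_sum)
  qed
  then show ?thesis
    unfolding ideal_all_def by auto
qed

lemma contractible_sub_all_iff:
  "contractible r (sub_all X M) \<longleftrightarrow> splits r M \<and> (\<forall>\<pi>\<in>#M. noncrossing_wrt \<pi> (Restr r (idx \<pi>)))"
proof -
  have "splits r (sub_all X M) \<longleftrightarrow> splits r M"
  proof
    assume L: "splits r (sub_all X M)"
    show "splits r M"
    proof (rule splitsI)
      fix x y assume "(x, y) \<in> r"
      with L obtain \<rho> where "\<rho> \<in># sub_all X M" "x \<in> idx \<rho>" "y \<in> idx \<rho>"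
        by (rule splitsE)
      then show "\<exists>\<pi>\<in>#M. x \<in> idx \<pi> \<and> y \<in> idx \<pi>"
        unfolding set_sub_all by (auto simp: idx_restr)
    qed
  next
    assume R: "splits r M"
    show "splits r (sub_all X M)"
    proof (rule splitsI)
      fix x y assume xy: "(x, y) \<in> r"
      with R obtain \<pi> where \<pi>: "\<pi> \<in># M" "x \<in> idx \<pi>" "y \<in> idx \<pi>"
        by (rule splitsE)
      then have "x \<in> X \<inter> idx \<pi>" "y \<in> X \<inter> idx \<pi>"
        using equiv_mem[OF r xy] by simp_all
      moreover from this have "restr \<pi> (X \<inter> idx \<pi>) \<in># sub_all X M"
        using \<pi>(1) unfolding set_sub_all by blast
      ultimately show "\<exists>\<rho>\<in>#sub_all X M. x \<in> idx \<rho> \<and> y \<in> idx \<rho>"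
        by (intro bexI[of _ "restr \<pi> (X \<inter> idx \<pi>)"]) (auto simp: idx_restr)
    qed
  qed
  moreover have "(\<forall>\<rho>\<in>#sub_all X M. noncrossing_wrt \<rho> r) \<longleftrightarrow> (\<forall>\<pi>\<in>#M. noncrossing_wrt \<pi> (Restr r (idx \<pi>)))"
  proof -
    have *: "noncrossing_wrt (restr \<pi> (X \<inter> idx \<pi>)) r \<longleftrightarrow> noncrossing_wrt \<pi> (Restr r (idx \<pi>))"
      if "\<pi> \<in># M" for \<pi>
    proof -
      have "noncrossing_wrt (restr \<pi> (X \<inter> idx \<pi>)) r \<longleftrightarrow>
          noncrossing_wrt (restr \<pi> (X \<inter> idx \<pi>)) (Restr r (X \<inter> idx \<pi>))"
        by (rule noncrossing_wrt_Int_iff[symmetric]) (simp add: idx_restr)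
      also have "\<dots> \<longleftrightarrow> noncrossing_wrt \<pi> (Restr r (X \<inter> idx \<pi>))"
        by (rule noncrossing_wrt_restr[OF indexed_ncpD(6)[OF monomsD(2)[OF M that]]]) blast
      also have "Restr r (X \<inter> idx \<pi>) = Restr r (idx \<pi>)"
        using equiv_type[OF r] by blast
      finally show ?thesis .
    qed
    have **: "noncrossing_wrt \<pi> (Restr r (idx \<pi>))" if "X \<inter> idx \<pi> = {}" for \<pi>
    proof -
      have "Restr r (idx \<pi>) = {}"
        using equiv_type[OF r] that by blast
      then show ?thesis
        by (simp add: noncrossing_wrt_def)
    qed
    show ?thesis
    proof
      assume L: "\<forall>\<rho>\<in>#sub_all X M. noncrossing_wrt \<rho> r"
      show "\<forall>\<pi>\<in>#M. noncrossing_wrt \<pi> (Restr r (idx \<pi>))"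
      proof
        fix \<pi> assume \<pi>: "\<pi> \<in># M"
        show "noncrossing_wrt \<pi> (Restr r (idx \<pi>))"
        proof (cases "X \<inter> idx \<pi> = {}")
          case False
          then have "restr \<pi> (X \<inter> idx \<pi>) \<in># sub_all X M"
            using \<pi> unfolding set_sub_all by blast
          then show ?thesis
            using L *[OF \<pi>] by blast
        qed (rule **)
      qed
    next
      assume "\<forall>\<pi>\<in>#M. noncrossing_wrt \<pi> (Restr r (idx \<pi>))"
      then show "\<forall>\<rho>\<in>#sub_all X M. noncrossing_wrt \<rho> r"
        unfolding set_sub_all using * by auto
    qed
  qed
  ultimately show ?thesis
    unfolding contractible_iff[OF sub_all_in_monoms r] by simp
qed

lemma idx_restr_ideal_part:
  assumes "is_ideal_all Y M" "\<pi> \<in># M" "C \<in> parts \<pi>"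
  shows "idx (restr \<pi> C) = C" "C \<subseteq> Y" "C \<subseteq> idx \<pi>"
proof -
  have "C \<subseteq> Y \<inter> idx \<pi>"
    by (rule ideal_parts_sub[OF monomsD(2)[OF M assms(2)] _ _ assms(3)])
      (use assms(1,2) in \<open>auto simp: is_ideal_all_def\<close>)
  then show "idx (restr \<pi> C) = C" "C \<subseteq> Y" "C \<subseteq> idx \<pi>"
    by (auto simp: idx_restr)
qed

lemma contractible_ideal_all_iff:
  assumes id: "is_ideal_all Y M"
  shows "contractible s (ideal_all Y M) \<longleftrightarrow> splits s M \<and> (\<forall>\<pi>\<in>#M.
    (\<forall>x y. (x, y) \<in> Restr s (idx \<pi>) \<longrightarrow> (\<exists>C\<in>parts \<pi>. x \<in> C \<and> y \<in> C)) \<and>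
    (\<forall>C\<in>parts \<pi>. noncrossing_wrt \<pi> (Restr (Restr s (idx \<pi>)) C)))"
proof -
  note I = idx_restr_ideal_part[OF id]
  have "splits s (ideal_all Y M) \<longleftrightarrow> splits s M \<and> (\<forall>\<pi>\<in>#M.
    (\<forall>x y. (x, y) \<in> Restr s (idx \<pi>) \<longrightarrow> (\<exists>C\<in>parts \<pi>. x \<in> C \<and> y \<in> C)))"
  proof
    assume L: "splits s (ideal_all Y M)"
    have *: "\<exists>\<pi>\<in>#M. \<exists>C\<in>parts \<pi>. x \<in> C \<and> y \<in> C" if xy: "(x, y) \<in> s" for x y
    proof -
      obtain \<rho> where \<rho>: "\<rho> \<in># ideal_all Y M" "x \<in> idx \<rho>" "y \<in> idx \<rho>"
        using L xy by (rule splitsE)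
      then obtain \<pi> C where "\<pi> \<in># M" "C \<in> parts \<pi>" "\<rho> = restr \<pi> C"
        unfolding set_ideal_all[OF id] by blast
      then show ?thesis
        using \<rho>(2,3) I(1) by auto
    qed
    have "splits s M"
    proof (rule splitsI)
      fix x y assume "(x, y) \<in> s"
      then obtain \<pi> C where "\<pi> \<in># M" "C \<in> parts \<pi>" "x \<in> C" "y \<in> C"
        using * by blast
      then show "\<exists>\<pi>\<in>#M. x \<in> idx \<pi> \<and> y \<in> idx \<pi>"
        using I(3) by blast
    qed
    moreover have "\<exists>C\<in>parts \<pi>. x \<in> C \<and> y \<in> C"
      if \<pi>: "\<pi> \<in># M" and xy: "(x, y) \<in> Restr s (idx \<pi>)" for \<pi> x y
    proof -
      obtain \<rho> C where \<rho>: "\<rho> \<in># M" "C \<in> parts \<rho>" "x \<in> C" "y \<in> C"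
        using * xy by blast
      then have "x \<in> idx \<rho>"
        using I(3) by blast
      then have "\<pi> = \<rho>"
        using monomsD(4)[OF M \<pi> \<rho>(1)] xy by blast
      then show ?thesis
        using \<rho> by blast
    qed
    ultimately show "splits s M \<and> (\<forall>\<pi>\<in>#M.
      (\<forall>x y. (x, y) \<in> Restr s (idx \<pi>) \<longrightarrow> (\<exists>C\<in>parts \<pi>. x \<in> C \<and> y \<in> C)))"
      by blast
  next
    assume R: "splits s M \<and> (\<forall>\<pi>\<in>#M.
      (\<forall>x y. (x, y) \<in> Restr s (idx \<pi>) \<longrightarrow> (\<exists>C\<in>parts \<pi>. x \<in> C \<and> y \<in> C)))"
    show "splits s (ideal_all Y M)"
    proof (rule splitsI)
      fix x y assume xy: "(x, y) \<in> s"
      obtain \<pi> where \<pi>: "\<pi> \<in># M" "x \<in> idx \<pi>" "y \<in> idx \<pi>"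
        using splitsE[OF conjunct1[OF R] xy] by blast
      then obtain C where C: "C \<in> parts \<pi>" "x \<in> C" "y \<in> C"
        using R xy by blast
      then have "restr \<pi> C \<in># ideal_all Y M"
        unfolding set_ideal_all[OF id] using \<pi>(1) by blast
      then show "\<exists>\<rho>\<in>#ideal_all Y M. x \<in> idx \<rho> \<and> y \<in> idx \<rho>"
        using C I(1)[OF \<pi>(1) C(1)] by (intro bexI[of _ "restr \<pi> C"]) simp_all
    qed
  qed
  moreover have "(\<forall>\<rho>\<in>#ideal_all Y M. noncrossing_wrt \<rho> s) \<longleftrightarrow>
    (\<forall>\<pi>\<in>#M. \<forall>C\<in>parts \<pi>. noncrossing_wrt \<pi> (Restr (Restr s (idx \<pi>)) C))"
  proof -
    have *: "noncrossing_wrt (restr \<pi> C) s \<longleftrightarrow> noncrossing_wrt \<pi> (Restr (Restr s (idx \<pi>)) C)"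
      if \<pi>: "\<pi> \<in># M" and C: "C \<in> parts \<pi>" for \<pi> C
    proof -
      have "noncrossing_wrt (restr \<pi> C) s \<longleftrightarrow> noncrossing_wrt (restr \<pi> C) (Restr s C)"
        by (rule noncrossing_wrt_Int_iff[symmetric]) (simp add: idx_restr)
      also have "\<dots> \<longleftrightarrow> noncrossing_wrt \<pi> (Restr s C)"
        by (rule noncrossing_wrt_restr[OF indexed_ncpD(6)[OF monomsD(2)[OF M \<pi>]]]) blast
      also have "Restr s C = Restr (Restr s (idx \<pi>)) C"
        using I(3)[OF \<pi> C] by blast
      finally show ?thesis .
    qed
    have "(\<forall>\<rho>\<in>#ideal_all Y M. noncrossing_wrt \<rho> s) \<longleftrightarrow>
        (\<forall>\<pi>\<in>#M. \<forall>C\<in>parts \<pi>. noncrossing_wrt (restr \<pi> C) s)"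
      unfolding set_ideal_all[OF id] by auto
    also have "\<dots> \<longleftrightarrow> (\<forall>\<pi>\<in>#M. \<forall>C\<in>parts \<pi>. noncrossing_wrt \<pi> (Restr (Restr s (idx \<pi>)) C))"
      using * by simp
    finally show ?thesis .
  qed
  ultimately show ?thesis
    unfolding contractible_iff[OF ideal_all_in_monoms[OF id] s] by blast
qed

text \<open>
  Both sides of the compatibility with \<open>\<Delta>\<close> are nonzero at the same monomials.
\<close>
lemma contractible_Un_iff:
  "contractible (r \<union> s) M \<and> is_ideal_all (quot Y s) (contract_all (r \<union> s) M) \<longleftrightarrow>
   is_ideal_all Y M \<and> contractible r (sub_all X M) \<and> contractible s (ideal_all Y M)" (is "?L \<longleftrightarrow> ?R")
proof (cases "splits (r \<union> s) M")
  case False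
  have "\<not> ?L"
    using False by (simp add: contractible_def)
  moreover have "\<not> ?R"
    using False contractible_sub_all_iff contractible_ideal_all_iff splits_Un by blast
  ultimately show ?thesis
    by blast
next
  case sp: True
  have "?L \<longleftrightarrow> (\<forall>\<pi>\<in>#M. noncrossing_wrt \<pi> (r \<union> s)) \<and>
      (\<forall>\<pi>\<in>#M. is_ideal (contract_factor (r \<union> s) \<pi>)
         (quot Y s \<inter> idx (contract_factor (r \<union> s) \<pi>)))"
    unfolding contractible_iff[OF M equiv_Un] is_ideal_all_def contract_all_def using sp by simp
  also have "\<dots> \<longleftrightarrow> (\<forall>\<pi>\<in>#M. noncrossing_wrt \<pi> (r \<union> s) \<and>
      is_ideal (contract_factor (r \<union> s) \<pi>)
         (quot Y s \<inter> idx (contract_factor (r \<union> s) \<pi>)))"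
    by blast
  also have "\<dots> \<longleftrightarrow> (\<forall>\<pi>\<in>#M. is_ideal \<pi> (Y \<inter> idx \<pi>) \<and> noncrossing_wrt \<pi> (Restr r (idx \<pi>)) \<and>
      (\<forall>x y. (x, y) \<in> Restr s (idx \<pi>) \<longrightarrow> (\<exists>C\<in>parts \<pi>. x \<in> C \<and> y \<in> C)) \<and>
      (\<forall>C\<in>parts \<pi>. noncrossing_wrt \<pi> (Restr (Restr s (idx \<pi>)) C)))"
  proof (rule ball_cong[OF refl])
    fix \<pi> assume \<pi>: "\<pi> \<in># M"
    interpret L: disjoint_equivs_ncp "X \<inter> idx \<pi>" "Y \<inter> idx \<pi>" "Restr r (idx \<pi>)" "Restr s (idx \<pi>)" \<pi>
      by (rule local_equivs[OF \<pi>])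
    have "noncrossing_wrt \<pi> (r \<union> s) \<longleftrightarrow> noncrossing_wrt \<pi> (Restr r (idx \<pi>) \<union> Restr s (idx \<pi>))"
      using noncrossing_wrt_Int_iff[of \<pi> "idx \<pi>" "r \<union> s"] unfolding Restr_Un_idx by simp
    then show "noncrossing_wrt \<pi> (r \<union> s) \<and>
        is_ideal (contract_factor (r \<union> s) \<pi>)
          (quot Y s \<inter> idx (contract_factor (r \<union> s) \<pi>)) \<longleftrightarrow>
      is_ideal \<pi> (Y \<inter> idx \<pi>) \<and> noncrossing_wrt \<pi> (Restr r (idx \<pi>)) \<and>
      (\<forall>x y. (x, y) \<in> Restr s (idx \<pi>) \<longrightarrow> (\<exists>C\<in>parts \<pi>. x \<in> C \<and> y \<in> C)) \<and>
      (\<forall>C\<in>parts \<pi>. noncrossing_wrt \<pi> (Restr (Restr s (idx \<pi>)) C))"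
      unfolding quot_Int_idx[OF sp \<pi>] unfolding Restr_Un_idx
      using L.noncrossing_ideal_iff idx_Un[OF \<pi>] by simp
  qed
  also have "\<dots> \<longleftrightarrow> ?R"
    using contractible_sub_all_iff contractible_ideal_all_iff sp splits_Un
    unfolding is_ideal_all_def by blast
  finally show ?thesis .
qed

text \<open>
  Where both sides are nonzero, the following three identities show that they agree.
\<close>
context
  assumes sp: "splits (r \<union> s) M" and id: "is_ideal_all Y M"
    and part: "\<And>\<pi> x y. \<pi> \<in># M \<Longrightarrow> (x, y) \<in> Restr s (idx \<pi>) \<Longrightarrow>
      \<exists>C\<in>parts \<pi>. x \<in> C \<and> y \<in> C"
begin

lemma sub_all_contract: "sub_all (quot X r) (contract_all (r \<union> s) M) = contract_all r (sub_all X M)"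
  unfolding sub_all_def contract_all_sum_mset
  unfolding contract_all_def[of "r \<union> s"] image_mset.compositionality comp_def
proof (rule sum_mset_cong)
  fix \<pi> assume \<pi>: "\<pi> \<in># M"
  interpret L: disjoint_equivs_ncp "X \<inter> idx \<pi>" "Y \<inter> idx \<pi>" "Restr r (idx \<pi>)" "Restr s (idx \<pi>)" \<pi>
    by (rule local_equivs[OF \<pi>])
  have "Restr r (X \<inter> idx \<pi>) = Restr r (idx \<pi>)"
    using equiv_type[OF r] by blast
  then have "contract_all r (restr_monom \<pi> (X \<inter> idx \<pi>)) = (if X \<inter> idx \<pi> = {} then {#}
      else {#contract (X \<inter> idx \<pi>) (Restr r (idx \<pi>)) (restr \<pi> (X \<inter> idx \<pi>))#})"
    by (simp add: restr_monom_def contract_all_def idx_restr Int_absorb2)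
  then show "restr_monom (contract_factor (r \<union> s) \<pi>)
      (quot X r \<inter> idx (contract_factor (r \<union> s) \<pi>)) =
      contract_all r (restr_monom \<pi> (X \<inter> idx \<pi>))"
    unfolding quot_Int_idx[OF sp \<pi>] unfolding Restr_Un_idx
    using L.restr_monom_contract idx_Un[OF \<pi>] by simp
qed

lemma ideal_all_contract: "ideal_all (quot Y s) (contract_all (r \<union> s) M) = contract_all s (ideal_all Y M)"
  unfolding ideal_all_def contract_all_sum_mset
  unfolding contract_all_def[of "r \<union> s"] image_mset.compositionality comp_def
proof (rule sum_mset_cong)
  fix \<pi> assume \<pi>: "\<pi> \<in># M"
  interpret L: disjoint_equivs_ncp "X \<inter> idx \<pi>" "Y \<inter> idx \<pi>" "Restr r (idx \<pi>)" "Restr s (idx \<pi>)" \<pi>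
    by (rule local_equivs[OF \<pi>])
  have ideal: "is_ideal \<pi> (Y \<inter> idx \<pi>)"
    using id \<pi> by (simp add: is_ideal_all_def)
  have "contract_all s (ideal_restr \<pi> (Y \<inter> idx \<pi>)) =
      (\<Sum>C\<in>parts \<pi>. contract_all s {#restr \<pi> C#})"
    using ideal_restr_eq[OF L.\<pi> Un_upper2 ideal] by (simp add: contract_all_sum)
  also have "\<dots> = (\<Sum>C\<in>parts \<pi>.
      {#contract C (Restr (Restr s (idx \<pi>)) C) (restr \<pi> C)#})"
  proof (rule sum.cong[OF refl])
    fix C assume C: "C \<in> parts \<pi>"
    note I = idx_restr_ideal_part[OF id \<pi> C]
    have "Restr (Restr s (idx \<pi>)) C = Restr s C"
      using I(3) by blast
    then show "contract_all s {#restr \<pi> C#} = {#contract C (Restr (Restr s (idx \<pi>)) C) (restr \<pi> C)#}"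
      by (simp add: contract_all_def I(1))
  qed
  also have "\<dots> = ideal_restr (contract_factor (r \<union> s) \<pi>) (quot (Y \<inter> idx \<pi>) (Restr s (idx \<pi>)))"
    unfolding Restr_Un_idx
    using L.ideal_restr_contract[OF ideal part[OF \<pi>]] idx_Un[OF \<pi>] by simp
  finally show "ideal_restr (contract_factor (r \<union> s) \<pi>)
      (quot Y s \<inter> idx (contract_factor (r \<union> s) \<pi>)) =
      contract_all s (ideal_restr \<pi> (Y \<inter> idx \<pi>))"
    unfolding quot_Int_idx[OF sp \<pi>] by simp
qed

lemma extract_all_Un: "extract_all (r \<union> s) M = extract_all r (sub_all X M) + extract_all s (ideal_all Y M)"
  unfolding sub_all_def ideal_all_def extract_all_sum_mset sum_mset.distrib[symmetric]
  unfolding extract_all_def[of "r \<union> s"]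
proof (rule sum_mset_cong)
  fix \<pi> assume \<pi>: "\<pi> \<in># M"
  note \<pi>' = monomsD(2)[OF M \<pi>]
  interpret L: disjoint_equivs_ncp "X \<inter> idx \<pi>" "Y \<inter> idx \<pi>" "Restr r (idx \<pi>)" "Restr s (idx \<pi>)" \<pi>
    by (rule local_equivs[OF \<pi>])
  have ideal: "is_ideal \<pi> (Y \<inter> idx \<pi>)"
    using id \<pi> by (simp add: is_ideal_all_def)
  have RX: "Restr r (X \<inter> idx \<pi>) = Restr r (idx \<pi>)"
    using equiv_type[OF r] by blast
  have X: "extract_all r (restr_monom \<pi> (X \<inter> idx \<pi>)) = extract_monom (X \<inter> idx \<pi>) (Restr r (idx \<pi>)) \<pi>"
  proof (cases "X \<inter> idx \<pi> = {}")
    case True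
    then show ?thesis
      by (simp add: restr_monom_def extract_monom_def)
  next
    case False
    then have "extract_all r (restr_monom \<pi> (X \<inter> idx \<pi>)) =
        extract_monom (X \<inter> idx \<pi>) (Restr r (idx \<pi>)) (restr \<pi> (X \<inter> idx \<pi>))"
      using RX by (simp add: restr_monom_def extract_all_def idx_restr Int_absorb2)
    also have "\<dots> = extract_monom (X \<inter> idx \<pi>) (Restr r (idx \<pi>)) \<pi>"
      by (rule extract_monom_restr[OF L.r indexed_ncpD(6)[OF \<pi>']])
    finally show ?thesis .
  qed
  have "extract_all s (ideal_restr \<pi> (Y \<inter> idx \<pi>)) =
      (\<Sum>C\<in>parts \<pi>. extract_all s {#restr \<pi> C#})"
    using ideal_restr_eq[OF L.\<pi> Un_upper2 ideal] by (simp add: extract_all_sum)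
  also have "\<dots> = (\<Sum>C\<in>parts \<pi>. extract_monom C (Restr (Restr s (idx \<pi>)) C) \<pi>)"
  proof (rule sum.cong[OF refl])
    fix C assume C: "C \<in> parts \<pi>"
    note I = idx_restr_ideal_part[OF id \<pi> C]
    have "Restr (Restr s (idx \<pi>)) C = Restr s C"
      using I(3) by blast
    moreover have "extract_monom C (Restr s C) (restr \<pi> C) = extract_monom C (Restr s C) \<pi>"
      by (rule extract_monom_restr[OF equiv_Int[OF s I(2)] indexed_ncpD(6)[OF \<pi>']])
    ultimately show "extract_all s {#restr \<pi> C#} = extract_monom C (Restr (Restr s (idx \<pi>)) C) \<pi>"
      by (simp add: extract_all_def I(1))
  qed
  finally show "extract_factor (r \<union> s) \<pi> =
      extract_all r (restr_monom \<pi> (X \<inter> idx \<pi>)) + extract_all s (ideal_restr \<pi> (Y \<inter> idx \<pi>))"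
    unfolding Restr_Un_idx X
    using L.extract_monom_Un[OF ideal part[OF \<pi>]] idx_Un[OF \<pi>] by simp
qed

end

end

section \<open>The counit\<close>

definition single_blocks :: "'x monom \<Rightarrow> bool" where
  "single_blocks M \<longleftrightarrow> (\<forall>\<pi>\<in>#M. card (idx \<pi>) = 1)"

definition counit :: "('x, 'k::field_char_0) alg \<Rightarrow> 'k" where
  "counit p = (\<Sum>M\<in>Poly_Mapping.keys p. Poly_Mapping.lookup p M * of_bool (single_blocks M))"

text \<open>
  A scalar \<open>c\<close> is identified with the constant \<open>single 0 c\<close> of a monoid algebra. The counit becomes a
  linear extension, and its linearity and multiplicativity follow from those of linear extensions.
\<close>
lemma single_counit:
  "Poly_Mapping.single (0::nat) (counit p) = lin_ext (\<lambda>M. Poly_Mapping.single 0 (of_bool (single_blocks M))) p"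
  for p :: "('x, 'k::field_char_0) alg"
proof -
  have "Poly_Mapping.single (0::nat) (\<Sum>b\<in>S. f b) = (\<Sum>b\<in>S. Poly_Mapping.single 0 (f b))" for S and f :: "'x monom \<Rightarrow> 'k::field_char_0"
    by (induction S rule: infinite_finite_induct) (auto simp: single_add)
  then show ?thesis
    unfolding counit_def lin_ext_def scale_single .
qed

lemma counit_eqI:
  "Poly_Mapping.single (0::nat) (counit p) = Poly_Mapping.single 0 c \<Longrightarrow> counit p = c"
  by (metis lookup_single_eq)

lemma counit_basis [simp]: "counit (basis M :: ('x, 'k::field_char_0) alg) = of_bool (single_blocks M)"
  by (rule counit_eqI) (simp only: single_counit lin_ext_single scale_1)

lemma counit_add: "counit (p + q) = counit p + counit q"
  by (rule counit_eqI) (simp add: single_counit lin_ext_add single_add)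

lemma counit_scale: "counit (scale c p) = c * counit p"
proof (rule counit_eqI)
  have "Poly_Mapping.single (0::nat) (c * counit p) = scale c (Poly_Mapping.single 0 (counit p))"
    by simp
  then show "Poly_Mapping.single (0::nat) (counit (scale c p)) = Poly_Mapping.single 0 (c * counit p)"
    by (simp add: single_counit lin_ext_scale del: scale_single)
qed

lemma single_blocks_add: "single_blocks (M + N) \<longleftrightarrow> single_blocks M \<and> single_blocks N"
  by (auto simp: single_blocks_def)

lemma counit_mult: "counit (p * q) = counit p * counit q"
proof (rule counit_eqI)
  have "Poly_Mapping.single (0::nat) (counit (p * q)) =
      Poly_Mapping.single 0 (counit p) * Poly_Mapping.single 0 (counit q)"
    unfolding single_counit
    by (rule lin_ext_mult) (simp add: mult_single single_blocks_add of_bool_conj)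
  then show "Poly_Mapping.single (0::nat) (counit (p * q)) = Poly_Mapping.single 0 (counit p * counit q)"
    by (simp add: mult_single)
qed

lemma counit_A_map:
  assumes "inj_on f X" "p \<in> A X"
  shows "counit (A_map f p) = counit p"
proof (rule counit_eqI)
  have "single_blocks (image_mset (relabel f) M) \<longleftrightarrow> single_blocks M" if "M \<in> Poly_Mapping.keys p" for M
  proof -
    have M: "M \<in> monoms X"
      using assms(2) that by (auto simp: A_def)
    have "card (idx (relabel f \<pi>)) = card (idx \<pi>)" if "\<pi> \<in># M" for \<pi>
      unfolding idx_relabel using assms(1) monomsD(6)[OF M that] by (meson card_image inj_on_subset)
    then show ?thesis
      by (simp add: single_blocks_def)
  qed
  then show "Poly_Mapping.single (0::nat) (counit (A_map f p)) = Poly_Mapping.single 0 (counit p)"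
    unfolding single_counit A_map_def lin_ext_lin_ext by (intro lin_ext_cong) simp
qed

lemma twisted_algebra_morphism_counit:
  "twisted_algebra_morphism_to_Com (\<lambda>X. counit :: ('x, 'k::field_char_0) alg \<Rightarrow> 'k)"
proof -
  have "counit (1 :: ('x, 'k) alg) = 1"
    using counit_basis[of "0 :: 'x monom"] by (simp add: single_blocks_def)
  then show ?thesis
    unfolding twisted_algebra_morphism_to_Com_def linear_between_def
    by (auto simp: counit_add counit_scale counit_mult bij_betw_def intro: counit_A_map)
qed

text \<open>
  Among the equivalences that split along the factors, the only one whose contraction turns each
  factor into a single block.
\<close>
definition total_rel :: "'x monom \<Rightarrow> ('x \<times> 'x) set" where
  "total_rel M = (\<Union>\<pi>\<in>set_mset M. idx \<pi> \<times> idx \<pi>)"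

lemma Restr_total_rel: "\<pi> \<in># M \<Longrightarrow> Restr (total_rel M) (idx \<pi>) = idx \<pi> \<times> idx \<pi>"
  unfolding total_rel_def by blast

lemma equiv_total_rel:
  assumes M: "M \<in> monoms X"
  shows "equiv X (total_rel M)"
proof (rule equivI)
  show "total_rel M \<subseteq> X \<times> X"
    using monomsD(6)[OF M] unfolding total_rel_def by blast
  show "refl_on X (total_rel M)"
    using monomsD(3)[OF M] unfolding total_rel_def by (auto intro!: refl_onI)
  show "sym (total_rel M)"
    unfolding total_rel_def by (auto intro!: symI)
  show "trans (total_rel M)"
  proof (rule transI)
    fix x y z assume "(x, y) \<in> total_rel M" "(y, z) \<in> total_rel M"
    then obtain \<pi> \<rho> where *: "\<pi> \<in># M" "x \<in> idx \<pi>" "y \<in> idx \<pi>" "\<rho> \<in># M" "y \<in> idx \<rho>" "z \<in> idx \<rho>"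
      unfolding total_rel_def by blast
    then have "\<pi> = \<rho>"
      using monomsD(4)[OF M] by blast
    then show "(x, z) \<in> total_rel M"
      using * unfolding total_rel_def by blast
  qed
qed

lemma splits_total_rel: "splits (total_rel M) M"
  unfolding splits_def total_rel_def by blast

lemma contractible_total_rel:
  assumes M: "M \<in> monoms X"
  shows "contractible (total_rel M) M"
proof -
  have "noncrossing_wrt \<pi> (total_rel M)" if "\<pi> \<in># M" for \<pi>
  proof -
    have "noncrossing_wrt \<pi> (Restr (total_rel M) (idx \<pi>))"
      unfolding Restr_total_rel[OF that] noncrossing_wrt_def by simp
    then show ?thesis
      using noncrossing_wrt_Int_iff by blast
  qed
  then show ?thesis
    using contractible_iff[OF M equiv_total_rel[OF M]] splits_total_rel by blast
qed

lemma extract_all_total_rel: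
  assumes M: "M \<in> monoms X"
  shows "extract_all (total_rel M) M = M"
proof -
  have "extract_all (total_rel M) M = (\<Sum>\<pi>\<in>#M. {#\<pi>#})"
    unfolding extract_all_def
  proof (rule sum_mset_cong)
    fix \<pi> assume \<pi>: "\<pi> \<in># M"
    have "idx \<pi> \<noteq> {}"
      using indexed_ncpD(2)[OF monomsD(2)[OF M \<pi>]] .
    then have "idx \<pi> // (idx \<pi> \<times> idx \<pi>) = {idx \<pi>}"
      by (auto simp: quotient_def)
    then show "extract_factor (total_rel M) \<pi> = {#\<pi>#}"
      unfolding Restr_total_rel[OF \<pi>] extract_monom_def
      using \<open>idx \<pi> \<noteq> {}\<close> restr_idx[OF monomsD(2)[OF M \<pi>]] by (simp add: restr_monom_def)
  qed
  then show ?thesis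
    by simp
qed

text \<open>
  Exactly one equivalence contributes to the left counit sum, and by \<open>extract_all_total_rel\<close>
  it contributes \<open>M\<close>.
\<close>
lemma single_blocks_contract_iff:
  assumes M: "M \<in> monoms X" and r: "equiv X r"
  shows "contractible r M \<and> single_blocks (contract_all r M) \<longleftrightarrow> r = total_rel M"
proof
  assume L: "contractible r M \<and> single_blocks (contract_all r M)"
  then have sp: "splits r M"
    by (simp add: contractible_def)
  show "r = total_rel M"
  proof (intro subset_antisym subrelI)
    fix x y assume "(x, y) \<in> r"
    then show "(x, y) \<in> total_rel M"
      using sp unfolding splits_def total_rel_def by blast
  next
    fix x y assume "(x, y) \<in> total_rel M"
    then obtain \<pi> where \<pi>: "\<pi> \<in># M" "x \<in> idx \<pi>" "y \<in> idx \<pi>"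
      unfolding total_rel_def by blast
    note eq = equiv_Restr_idx[OF M r \<pi>(1)]
    have "card (quot (idx \<pi>) (Restr r (idx \<pi>))) = 1"
      using L \<pi>(1) unfolding single_blocks_def contract_all_def
      by (auto simp: idx_contract_Restr[OF M r])
    then obtain c where "quot (idx \<pi>) (Restr r (idx \<pi>)) = {c}"
      by (auto simp: card_1_singleton_iff)
    then have "class_label (Restr r (idx \<pi>)) x = class_label (Restr r (idx \<pi>)) y"
      using \<pi>(2,3) unfolding quot_eq by (metis image_eqI singletonD)
    then show "(x, y) \<in> r"
      using class_label_eq_iff[OF eq indexed_ncpD(1)[OF monomsD(2)[OF M \<pi>(1)]] \<pi>(2,3)] by blast
  qed
next
  assume R: "r = total_rel M"
  have "card (idx \<rho>) = 1" if \<rho>: "\<rho> \<in># contract_all r M" for \<rho>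
  proof -
    obtain \<pi> where \<pi>: "\<pi> \<in># M" "\<rho> = contract_factor r \<pi>"
      using \<rho> by (auto simp: contract_all_def)
    obtain x where x: "x \<in> idx \<pi>"
      using indexed_ncpD(2)[OF monomsD(2)[OF M \<pi>(1)]] by blast
    have "class_label (idx \<pi> \<times> idx \<pi>) y = cls (idx \<pi>)" if "y \<in> idx \<pi>" for y
    proof -
      have "(idx \<pi> \<times> idx \<pi>) `` {y} = idx \<pi>"
        using that by blast
      then show ?thesis
        by (simp add: class_label_def)
    qed
    then have "quot (idx \<pi>) (idx \<pi> \<times> idx \<pi>) = {cls (idx \<pi>)}"
      using x unfolding quot_eq by auto
    then show ?thesis
      using idx_contract_Restr[OF M r \<pi>(1)] Restr_total_rel[OF \<pi>(1)] R \<pi>(2) by simp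
  qed
  then show "contractible r M \<and> single_blocks (contract_all r M)"
    using contractible_total_rel[OF M] R unfolding single_blocks_def by blast
qed

text \<open>
  The factors of the extracted monomial are indexed by the classes of \<open>r\<close>, so they have one block
  each exactly if all classes are singletons.
\<close>
lemma single_blocks_extract_iff:
  assumes M: "M \<in> monoms X" and r: "equiv X r"
  shows "contractible r M \<and> single_blocks (extract_all r M) \<longleftrightarrow> r = Id_on X"
proof
  assume L: "contractible r M \<and> single_blocks (extract_all r M)"
  then have sp: "splits r M"
    by (simp add: contractible_def)
  have "x = y" if xy: "(x, y) \<in> r" for x y
  proof -
    obtain \<pi> where \<pi>: "\<pi> \<in># M" "x \<in> idx \<pi>" "y \<in> idx \<pi>"
      using sp xy by (rule splitsE)
    note eq = equiv_Restr_idx[OF M r \<pi>(1)]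
    let ?C = "Restr r (idx \<pi>) `` {x}"
    have C: "?C \<in> idx \<pi> // Restr r (idx \<pi>)"
      by (rule quotientI[OF \<pi>(2)])
    then have "restr \<pi> ?C \<in># extract_all r M"
      unfolding set_extract_all[OF M r] using \<pi>(1) by blast
    then have "card ?C = 1"
      using L idx_restr_class(1)[OF M r \<pi>(1) C] unfolding single_blocks_def by metis
    moreover have "x \<in> ?C" "y \<in> ?C"
      using equiv_refl[OF eq \<pi>(2)] xy \<pi> by simp_all
    ultimately show "x = y"
      by (metis card_1_singletonE singletonD)
  qed
  then show "r = Id_on X"
    using equiv_mem[OF r] equiv_refl[OF r] by (auto simp: Id_on_iff)
next
  assume R: "r = Id_on X"
  have Id: "Id_on X = Id \<inter> X \<times> X"
    by auto
  have "splits r M"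
    using monomsD(3)[OF M] unfolding R splits_def by auto
  moreover have "noncrossing_wrt \<pi> r" if "\<pi> \<in># M" for \<pi>
    unfolding R Id using indexed_ncpD(5)[OF monomsD(2)[OF M that]] by (rule noncrossing_wrt_Int)
  ultimately have "contractible r M"
    using contractible_iff[OF M r] by blast
  moreover have "card (idx \<rho>) = 1" if \<rho>: "\<rho> \<in># extract_all r M" for \<rho>
  proof -
    obtain \<pi> C where \<pi>: "\<pi> \<in># M" "C \<in> idx \<pi> // Restr r (idx \<pi>)" "\<rho> = restr \<pi> C"
      using \<rho> unfolding set_extract_all[OF M r] by blast
    obtain x where x: "x \<in> idx \<pi>" "C = Restr r (idx \<pi>) `` {x}"
      using \<pi>(2) by (auto elim: quotientE)
    then have "C = {x}"
      using monomsD(6)[OF M \<pi>(1)] unfolding R by auto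
    then show ?thesis
      using idx_restr_class(1)[OF M r \<pi>(1,2)] \<pi>(3) by simp
  qed
  ultimately show "contractible r M \<and> single_blocks (extract_all r M)"
    unfolding single_blocks_def by blast
qed

lemma unsingleton_contract_all:
  assumes M: "M \<in> monoms X"
  shows "image_mset (relabel unsingleton) (contract_all (Id_on X) M) = M"
proof -
  have "image_mset (relabel unsingleton) (contract_all (Id_on X) M) = image_mset (\<lambda>\<pi>. \<pi>) M"
    unfolding contract_all_def image_mset.compositionality comp_def
  proof (rule image_mset_cong)
    fix \<pi> assume \<pi>: "\<pi> \<in># M"
    have "Restr (Id_on X) (idx \<pi>) = Id_on (idx \<pi>)"
      using monomsD(6)[OF M \<pi>] by auto
    then show "relabel unsingleton (contract_factor (Id_on X) \<pi>) = \<pi>"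
      using relabel_unsingleton_contract_Id[of \<pi> "idx \<pi>"] indexed_ncpD(1)[OF monomsD(2)[OF M \<pi>]] by simp
  qed
  then show ?thesis
    by simp
qed

section \<open>The contraction-extraction coproduct\<close>

lemma lin_ext_at_basis: "lin_ext g (basis b) = g b"
  by simp

lemma delta_basis: "delta X r (basis M) = delta_monom r M"
  and A_map_basis: "A_map f (basis N) = basis (image_mset (relabel f) N)"
  and assoc_basis: "assoc (basis ((u, v), w)) = basis (u, v, w)"
  and m1324_basis: "m1324 (basis ((a, c), (b, d))) = basis ((a, b), c + d)"
  and form_left_basis: "form_left e (basis (u1, v1)) = scale (e (basis u1)) (basis v1)"
  and form_right_basis: "form_right e' (basis (u2, v2)) = scale (e' (basis v2)) (basis u2)"
  and tensor_map_basis: "tensor_map g h (basis (u3, v3)) = tensor (g (basis u3)) (h (basis v3))"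
  and Delta_basis: "Delta I J (basis L) =
    (if is_ideal_all J L then basis (sub_all I L, ideal_all J L) else 0)"
  unfolding delta_def A_map_def assoc_def m1324_def form_left_def form_right_def tensor_map_def
    Delta_def lin_ext_at_basis prod_Delta_ncp
  by simp_all

lemma linear_maps_0:
  "assoc 0 = 0" "m1324 0 = 0" "form_left e 0 = 0" "form_right e' 0 = 0" "tensor_map g h 0 = 0" "A_map f 0 = 0"
  by (simp_all add: assoc_def m1324_def form_left_def form_right_def tensor_map_def A_map_def)

lemma linear_maps_lin_ext:
  "delta X r (lin_ext g p) = lin_ext (\<lambda>b. delta X r (g b)) p"
  "assoc (lin_ext g' p) = lin_ext (\<lambda>b. assoc (g' b)) p"
  "m1324 (lin_ext g'' p) = lin_ext (\<lambda>b. m1324 (g'' b)) p"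
  "form_left e (lin_ext g1 p) = lin_ext (\<lambda>b. form_left e (g1 b)) p"
  "form_right e' (lin_ext g2 p) = lin_ext (\<lambda>b. form_right e' (g2 b)) p"
  "tensor_map u v (lin_ext g3 p) = lin_ext (\<lambda>b. tensor_map u v (g3 b)) p"
  "A_map f (lin_ext g4 p) = lin_ext (\<lambda>b. A_map f (g4 b)) p"
  by (simp_all add: delta_def assoc_def m1324_def form_left_def form_right_def tensor_map_def A_map_def
      lin_ext_lin_ext)

lemmas on_basis = delta_basis A_map_basis assoc_basis m1324_basis form_left_basis form_right_basis
  tensor_map_basis Delta_basis linear_maps_0

lemma A_keysD: "p \<in> A X \<Longrightarrow> M \<in> Poly_Mapping.keys p \<Longrightarrow> M \<in> monoms X"
  by (auto simp: A_def)

lemma lin_ext_cong_A: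
  "p \<in> A X \<Longrightarrow> (\<And>M. M \<in> monoms X \<Longrightarrow> g M = h M) \<Longrightarrow> lin_ext g p = lin_ext h p"
  by (rule lin_ext_cong) (drule A_keysD, assumption, simp)

lemma lin_ext_eq_id_A:
  "p \<in> A X \<Longrightarrow> (\<And>M. M \<in> monoms X \<Longrightarrow> g M = basis M) \<Longrightarrow> lin_ext g p = p"
  using lin_ext_cong_A[of p X g basis] by (simp add: lin_ext_basis)

lemma lin_ext_eq_0_A:
  "p \<in> A X \<Longrightarrow> (\<And>M. M \<in> monoms X \<Longrightarrow> g M = 0) \<Longrightarrow> lin_ext g p = 0"
  by (rule lin_ext_eq_0) (drule A_keysD, assumption, simp)

lemma finite_equivs:
  assumes "finite X"
  shows "finite {r. equiv X r}"
  by (rule finite_subset[of _ "Pow (X \<times> X)"]) (use assms equiv_type in auto)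

lemma natural_linear_family_delta:
  "natural_linear_family (delta :: ('a, 'k::field_char_0) coproduct_family)"
proof -
  have "linear_between scale (A X) scale (A2 (quot X r) X) (delta X r :: _ \<Rightarrow> ('a label, 'k) alg2)"
    if r: "equiv X r" for X :: "'a label set" and r
    unfolding linear_between_def
  proof (intro conjI ballI allI)
    fix p :: "('a label, 'k) alg" assume p: "p \<in> A X"
    have "Poly_Mapping.keys (delta_monom r M :: ('a label, 'k) alg2) \<subseteq> monoms (quot X r) \<times> monoms X"
      if "M \<in> monoms X" for M
      unfolding delta_monom_eq
      using contract_all_in_monoms[OF that r] extract_all_in_monoms[OF that r] by simp
    then show "delta X r p \<in> A2 (quot X r) X"
      unfolding A2_def delta_def using keys_lin_ext[of p "delta_monom r"] A_keysD[OF p] by simp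
  qed (simp_all add: delta_def lin_ext_add lin_ext_scale)
  moreover have "delta Y (map_prod f f ` r) (A_map f p) =
      tensor_map (A_map (quot_map f)) (A_map f) (delta X r p)"
    if f: "bij_betw f X Y" and r: "equiv X r" and p: "p \<in> A X"
    for X Y :: "'a label set" and f r and p :: "('a label, 'k) alg"
  proof -
    have "delta Y (map_prod f f ` r) (A_map f p) =
        lin_ext (\<lambda>M. delta_monom (map_prod f f ` r) (image_mset (relabel f) M)) p"
      unfolding A_map_def linear_maps_lin_ext on_basis ..
    also have "\<dots> = lin_ext (\<lambda>M. tensor_map (A_map (quot_map f)) (A_map f) (delta_monom r M)) p"
    proof (rule lin_ext_cong_A[OF p])
      fix M assume M: "M \<in> monoms X"
      have inj: "inj_on f X"
        using f by (simp add: bij_betw_def)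
      show "delta_monom (map_prod f f ` r) (image_mset (relabel f) M) =
          tensor_map (A_map (quot_map f)) (A_map f) (delta_monom r M :: ('a label, 'k) alg2)"
        unfolding delta_monom_eq delta_monom_relabel[OF M r inj] by (simp add: on_basis)
    qed
    also have "\<dots> = tensor_map (A_map (quot_map f)) (A_map f) (delta X r p)"
      unfolding delta_def linear_maps_lin_ext ..
    finally show ?thesis .
  qed
  ultimately show ?thesis
    unfolding natural_linear_family_def by blast
qed

lemma coassociative_delta: "coassociative (delta :: ('a, 'k::field_char_0) coproduct_family)"
proof -
  have "tensor_map (A_map flatten) id
      (assoc (tensor_map (delta (quot X r') (induced_rel r' r)) id (delta X r' p))) =
      tensor_map id (delta X r') (delta X r p)"
    if r: "equiv X r" "equiv X r'" "r' \<subseteq> r" and p: "p \<in> A X"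
    for X :: "'a label set" and r r' and p :: "('a label, 'k) alg"
    unfolding delta_def[of X r'] delta_def[of X r] linear_maps_lin_ext
  proof (rule lin_ext_cong_A[OF p])
    fix M assume M: "M \<in> monoms X"
    note co = contractible_coassoc[OF M r]
    let ?i = "induced_rel r' r"
    show "tensor_map (A_map flatten) id
        (assoc (tensor_map (delta (quot X r') ?i) id (delta_monom r' M :: ('a label, 'k) alg2))) =
        tensor_map id (lin_ext (delta_monom r')) (delta_monom r M)"
    proof (cases "contractible r M \<and> contractible r' (extract_all r M)")
      case True
      then have sp: "splits r M"
        by (simp add: contractible_def)
      have "contractible r' M" "contractible ?i (contract_all r' M)"
        using co True by simp_all
      then show ?thesis
        using True contract_all_coassoc[OF M r sp] extract_contract_all[OF M r sp]
          extract_extract_all[OF M r]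
        by (simp add: delta_monom_eq on_basis)
    next
      case False
      then have "\<not> (contractible r' M \<and> contractible ?i (contract_all r' M))"
        using co by simp
      with False show ?thesis
        by (auto simp: delta_monom_eq on_basis)
    qed
  qed
  moreover have "tensor_map id (delta X r') (delta X r p) = 0"
    if r: "equiv X r" "equiv X r'" "\<not> r' \<subseteq> r" and p: "p \<in> A X"
    for X :: "'a label set" and r r' and p :: "('a label, 'k) alg"
    unfolding delta_def[of X r] linear_maps_lin_ext
  proof (rule lin_ext_eq_0_A[OF p])
    fix M assume M: "M \<in> monoms X"
    have "\<not> contractible r' (extract_all r M)"
      using contractible_extract_imp_finer[OF M r(1)] r(3) by blast
    then show "tensor_map id (delta X r') (delta_monom r M :: ('a label, 'k) alg2) = 0"
      by (simp add: delta_monom_eq on_basis)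
  qed
  ultimately show ?thesis
    unfolding coassociative_def by blast
qed

lemma counital_delta: "counital (delta :: ('a, 'k::field_char_0) coproduct_family)"
  unfolding counital_def
proof (intro exI[of _ "\<lambda>X. counit"] conjI allI impI ballI)
  show "twisted_algebra_morphism_to_Com (\<lambda>X. counit :: ('a label, 'k) alg \<Rightarrow> 'k)"
    by (rule twisted_algebra_morphism_counit)
next
  fix X :: "'a label set" and p :: "('a label, 'k) alg" assume X: "finite X" and p: "p \<in> A X"
  show "(\<Sum>r\<in>{r. equiv X r}. form_left counit (delta X r p)) = p"
    unfolding delta_def linear_maps_lin_ext sum_lin_ext
  proof (rule lin_ext_eq_id_A[OF p])
    fix M assume M: "M \<in> monoms X"
    have "form_left counit (delta_monom r M :: ('a label, 'k) alg2) =
        (if r = total_rel M then basis M else 0)" if "equiv X r" for r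
    proof -
      have "form_left counit (delta_monom r M :: ('a label, 'k) alg2) =
          (if contractible r M \<and> single_blocks (contract_all r M) then basis (extract_all r M) else 0)"
        by (simp add: delta_monom_eq on_basis)
      then show ?thesis
        using single_blocks_contract_iff[OF M that] extract_all_total_rel[OF M] by simp
    qed
    then have "(\<Sum>r\<in>{r. equiv X r}. form_left counit (delta_monom r M :: ('a label, 'k) alg2)) =
        (\<Sum>r\<in>{r. equiv X r}. if r = total_rel M then basis M else 0)"
      by (intro sum.cong) simp_all
    also have "\<dots> = basis M"
      using finite_equivs[OF X] equiv_total_rel[OF M] by simp
    finally show "(\<Sum>r\<in>{r. equiv X r}. form_left counit (delta_monom r M :: ('a label, 'k) alg2)) = basis M" .
  qed
next
  fix X r and p :: "('a label, 'k) alg" assume a: "finite X \<and> equiv X r" and p: "p \<in> A X"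
  then have r: "equiv X r"
    by simp
  have *: "form_right counit (delta_monom r M :: ('a label, 'k) alg2) =
      (if r = Id_on X then basis (contract_all r M) else 0)" if M: "M \<in> monoms X" for M
  proof -
    have "form_right counit (delta_monom r M :: ('a label, 'k) alg2) =
        (if contractible r M \<and> single_blocks (extract_all r M) then basis (contract_all r M) else 0)"
      by (simp add: delta_monom_eq on_basis)
    then show ?thesis
      unfolding single_blocks_extract_iff[OF M r] .
  qed
  show "A_map unsingleton (form_right counit (delta X r p)) = p" if "r = Id_on X"
    unfolding delta_def linear_maps_lin_ext
  proof (rule lin_ext_eq_id_A[OF p])
    fix M assume M: "M \<in> monoms X"
    show "A_map unsingleton (form_right counit (delta_monom r M :: ('a label, 'k) alg2)) = basis M"
      using *[OF M] that unsingleton_contract_all[OF M] by (simp add: on_basis)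
  qed
  show "form_right counit (delta X r p) = 0" if "r \<noteq> Id_on X"
    unfolding delta_def linear_maps_lin_ext
    by (rule lin_ext_eq_0_A[OF p]) (use * A_keysD[OF p] that in simp)
qed

lemma compatible_with_product_delta:
  "compatible_with_product (delta :: ('a, 'k::field_char_0) coproduct_family)"
proof -
  have "delta (X \<union> Y) r (p * q) = (if r = Restr r X \<union> Restr r Y
      then delta X (Restr r X) p * delta Y (Restr r Y) q else 0)"
    if "X \<inter> Y = {}" "equiv (X \<union> Y) r" "p \<in> A X" "q \<in> A Y"
    for X Y :: "'a label set" and r and p q :: "('a label, 'k) alg"
  proof (cases "r = Restr r X \<union> Restr r Y")
    case True
    have "lin_ext (delta_monom r) (p * q) = lin_ext (delta_monom (Restr r X)) p * lin_ext (delta_monom (Restr r Y)) q"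
    proof (rule lin_ext_mult)
      fix M N assume "M \<in> Poly_Mapping.keys p" "N \<in> Poly_Mapping.keys q"
      then show "delta_monom r (M + N) = delta_monom (Restr r X) M * (delta_monom (Restr r Y) N :: ('a label, 'k) alg2)"
        using delta_monom_add[OF A_keysD[OF that(3)] A_keysD[OF that(4)] that(1,2)] True by simp
    qed
    then show ?thesis
      using True by (simp add: delta_def)
  next
    case False
    \<comment> \<open>The coproduct vanishes at every product of two monomials: a multiplicative rule with zero factors.\<close>
    have "lin_ext (delta_monom r) (p * q) =
        lin_ext (\<lambda>_. 0 :: ('a label, 'k) alg2) p * lin_ext (\<lambda>_. 0) q"
    proof (rule lin_ext_mult)
      fix M N assume "M \<in> Poly_Mapping.keys p" "N \<in> Poly_Mapping.keys q"
      then show "delta_monom r (M + N) = (0 :: ('a label, 'k) alg2) * 0"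
        using delta_monom_add[OF A_keysD[OF that(3)] A_keysD[OF that(4)] that(1,2)] False by simp
    qed
    then show ?thesis
      using False by (simp add: delta_def lin_ext_eq_0)
  qed
  moreover have "delta {} {} 1 = tensor 1 (1 :: ('a label, 'k) alg)"
  proof -
    have one: "(1 :: ('a label, 'k) alg) = basis {#}"
      by simp
    have "contractible {} ({#} :: 'a label monom)"
      by (simp add: contractible_def splits_def)
    then show ?thesis
      unfolding one delta_basis delta_monom_eq tensor_basis by simp
  qed
  ultimately show ?thesis
    unfolding compatible_with_product_def by blast
qed

lemma compatible_with_Delta_delta:
  "compatible_with_Delta (delta :: ('a, 'k::field_char_0) coproduct_family)"
proof -
  have "tensor_map (Delta (quot X r) (quot Y s)) id (delta (X \<union> Y) (r \<union> s) p) =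
      m1324 (tensor_map (delta X r) (delta Y s) (Delta X Y p))"
    if XY: "X \<inter> Y = {}" "equiv X r" "equiv Y s" and p: "p \<in> A (X \<union> Y)"
    for X Y :: "'a label set" and r s and p :: "('a label, 'k) alg"
    unfolding delta_def[of "X \<union> Y"] Delta_def[of X Y] linear_maps_lin_ext prod_Delta_ncp
  proof (rule lin_ext_cong_A[OF p])
    fix M assume M: "M \<in> monoms (X \<union> Y)"
    interpret disjoint_equivs_monom X Y r s M
      by unfold_locales (use XY M in auto)
    show "tensor_map (Delta (quot X r) (quot Y s)) id (delta_monom (r \<union> s) M :: ('a label, 'k) alg2) =
        m1324 (tensor_map (delta X r) (delta Y s)
          (if is_ideal_all Y M then basis (sub_all X M, ideal_all Y M) else 0))"
    proof (cases "is_ideal_all Y M \<and> contractible r (sub_all X M) \<and> contractible s (ideal_all Y M)")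
      case True
      then have L: "contractible (r \<union> s) M" "is_ideal_all (quot Y s) (contract_all (r \<union> s) M)"
        using contractible_Un_iff by simp_all
      have sp: "splits (r \<union> s) M"
        using L(1) by (simp add: contractible_def)
      have id: "is_ideal_all Y M"
        using True by simp
      have part: "\<exists>C\<in>ideal_parts \<pi> (Y \<inter> idx \<pi>). x \<in> C \<and> y \<in> C"
        if "\<pi> \<in># M" "(x, y) \<in> Restr s (idx \<pi>)" for \<pi> x y
        using True contractible_ideal_all_iff[OF id] that by blast
      show ?thesis
        using True L sub_all_contract[OF sp id part] ideal_all_contract[OF sp id part]
          extract_all_Un[OF sp id part]
        by (simp add: delta_monom_eq on_basis)
    next
      case False
      then have "\<not> (contractible (r \<union> s) M \<and> is_ideal_all (quot Y s) (contract_all (r \<union> s) M))"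
        using contractible_Un_iff by simp
      with False show ?thesis
        by (auto simp: delta_monom_eq on_basis)
    qed
  qed
  then show ?thesis
    unfolding compatible_with_Delta_def by blast
qed

theorem proposition2p10:
  shows "contraction_extraction_coproduct (delta :: ('a, 'k::field_char_0) coproduct_family)"
  unfolding contraction_extraction_coproduct_def
  by (intro conjI natural_linear_family_delta coassociative_delta counital_delta
      compatible_with_product_delta compatible_with_Delta_delta)

end
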